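(* Let $X$ be a Banach function space over $\mathbb{R}^n$ such that the Hardy–Littlewood maximal operator $M$ is bounded on $X$. Let $0<\eta<1$. The following conditions are equivalent: (i) $M$ is bounded on the associate space $X'$; (ii) there exist $c,\delta>0$ such that for every dyadic grid $\mathscr{D}$ and any finite $\eta$-sparse family $\mathcal{S}\subset\mathscr{D}$, $$\Big\|\sum_{Q\in\mathcal{S}}\alpha_Q\chi_{G_Q}\Big\|_X\le c\left(\max_{Q\in\mathcal{S}}\frac{|G_Q|}{|Q|}\right)^{\delta}\Big\|\sum_{Q\in\mathcal{S}}\alpha_Q\chi_Q\Big\|_X,$$ where $\{\alpha_Q\}_{Q\in\mathcal{S}}$ is an arbitrary sequence of non-negative numbers and $\{G_Q\}_{Q\in\mathcal{S}}$ is any sequence of pairwise disjoint measurable subsets $G_Q\subset Q$.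
   Context: Let $\mathcal{M}^+$ be the set of Lebesgue measurable non-negative functions on $\mathbb{R}^n$. A Banach function space (BFS) $X$ over $\mathbb{R}^n$ (with Lebesgue measure) is the collection of functions $f$ with $\|f\|_X=\rho(|f|)<\infty$, where $\rho:\mathcal{M}^+\to[0,\infty]$ satisfies: (1) $\rho(f)=0\Leftrightarrow f=0$ a.e.; $\rho(\alpha f)=\alpha\rho(f)$ for $\alpha\ge0$; $\rho(f+g)\le\rho(f)+\rho(g)$; (2) $g\le f$ a.e. implies $\rho(g)\le\rho(f)$; (3) $f_n\uparrow f$ a.e. implies $\rho(f_n)\uparrow\rho(f)$; (4) if $E\subset\mathbb{R}^n$ is bounded (measurable), then $\rho(\chi_E)<\infty$; (5) if $E\subset\mathbb{R}^n$ is bounded (measurable), then $\int_E f\,dx\le c_E\,\rho(f)$ for all $f\in\mathcal{M}^+$, with $c_E<\infty$ depending only on $E$. The associate space $X'$ consists of $f$ with $\|f\|_{X'}=\sup_{g\in X:\|g\|_X\le1}\int_{\mathbb{R}^n}|fg|\,dx<\infty$; it is again a BFS. The maximal operator is $Mf(x)=\sup_{Q\ni x}\frac1{|Q|}\int_Q|f(y)|dy$, the supremum over all cubes $Q\subset\mathbb{R}^n$ containing $x$. "$M$ is bounded on $X$" means there is $C>0$ with $\|Mf\|_X\le C\|f\|_X$ for all $f\in X$. A family of cubes $\mathscr{D}$ in $\mathbb{R}^n$ is a (general) dyadic grid if: every $Q\in\mathscr{D}$ has sidelength $2^k$ for some $k\in\mathbb{Z}$; $Q\cap R\in\{Q,R,\emptyset\}$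 for all $Q,R\in\mathscr{D}$; and for every $k\in\mathbb{Z}$ the cubes of $\mathscr{D}$ of sidelength $2^k$ form a partition of $\mathbb{R}^n$. (The model example is the standard dyadic grid, whose cubes are $2^{-k}([0,1)^n+j)$, $k\in\mathbb{Z}$, $j\in\mathbb{Z}^n$.) A family $\mathcal{S}\subset\mathscr{D}$ is $\eta$-sparse if for every $Q\in\mathcal{S}$ there is a measurable subset $E(Q)\subset Q$ with $\eta|Q|\le|E(Q)|$, and the sets $\{E(Q)\}_{Q\in\mathcal{S}}$ are pairwise disjoint. *)

theory Defs
  imports "HOL-Analysis.Analysis"
begin

text \<open>
  All cubes have sides parallel to the axes and are half-open, as in the standard dyadic grid, so
  that the cubes of a fixed sidelength can partition the space.
\<close>

definition cube_of_side :: "real \<Rightarrow> (real ^ 'n) set \<Rightarrow> bool" where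
  "cube_of_side l Q \<longleftrightarrow> 0 < l \<and> (\<exists>a. Q = {x. \<forall>i. a $ i \<le> x $ i \<and> x $ i < a $ i + l})"

definition is_cube :: "(real ^ 'n) set \<Rightarrow> bool" where
  "is_cube Q \<longleftrightarrow> (\<exists>l. cube_of_side l Q)"

definition dyadic_grid :: "(real ^ 'n) set set \<Rightarrow> bool" where
  "dyadic_grid D \<longleftrightarrow>
     (\<forall>Q\<in>D. \<exists>k::int. cube_of_side (2 powi k) Q) \<and>
     (\<forall>Q\<in>D. \<forall>R\<in>D. Q \<inter> R \<in> {Q, R, {}}) \<and>
     (\<forall>k::int. partition_on UNIV {Q \<in> D. cube_of_side (2 powi k) Q})"

definition sparse_family :: "real \<Rightarrow> (real ^ 'n) set set \<Rightarrow> bool" where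
  "sparse_family \<eta> S \<longleftrightarrow>
     (\<exists>E. (\<forall>Q\<in>S. E Q \<in> sets lebesgue \<and> E Q \<subseteq> Q \<and>
                  \<eta> * measure lebesgue Q \<le> measure lebesgue (E Q)) \<and>
          disjoint_family_on E S)"

text \<open>
  A Banach function space is represented by its functional \<open>\<rho>\<close>. Functions in the domain of \<open>\<rho>\<close> may
  take the value \<open>\<infinity>\<close>, so that \<open>\<rho>\<close> can be applied to maximal functions and to pointwise limits of
  increasing sequences; the values of \<open>\<rho>\<close> at functions that are not Lebesgue measurable are
  irrelevant.
\<close>

definition banach_function_norm :: "((real ^ 'n \<Rightarrow> ennreal) \<Rightarrow> ennreal) \<Rightarrow> bool" where
  "banach_function_norm \<rho> \<longleftrightarrow>
     (\<forall>f \<in> borel_measurable lebesgue. \<rho> f = 0 \<longleftrightarrow> (AE x in lebesgue. f x = 0)) \<and>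
     (\<forall>f \<in> borel_measurable lebesgue. \<forall>a::real. 0 \<le> a \<longrightarrow>
        \<rho> (\<lambda>x. ennreal a * f x) = ennreal a * \<rho> f) \<and>
     (\<forall>f \<in> borel_measurable lebesgue. \<forall>g \<in> borel_measurable lebesgue.
        \<rho> (\<lambda>x. f x + g x) \<le> \<rho> f + \<rho> g) \<and>
     (\<forall>f \<in> borel_measurable lebesgue. \<forall>g \<in> borel_measurable lebesgue.
        (AE x in lebesgue. g x \<le> f x) \<longrightarrow> \<rho> g \<le> \<rho> f) \<and>
     (\<forall>F f. (\<forall>k::nat. F k \<in> borel_measurable lebesgue) \<and> f \<in> borel_measurable lebesgue \<and>
        (AE x in lebesgue. incseq (\<lambda>k. F k x) \<and> (\<lambda>k. F k x) \<longlonglongrightarrow> f x) \<longrightarrow>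
        incseq (\<lambda>k. \<rho> (F k)) \<and> (\<lambda>k. \<rho> (F k)) \<longlonglongrightarrow> \<rho> f) \<and>
     (\<forall>E \<in> sets lebesgue. bounded E \<longrightarrow> \<rho> (indicator E) < \<infinity>) \<and>
     (\<forall>E \<in> sets lebesgue. bounded E \<longrightarrow>
        (\<exists>c<\<infinity>. \<forall>f \<in> borel_measurable lebesgue. (\<integral>\<^sup>+x\<in>E. f x \<partial>lebesgue) \<le> c * \<rho> f))"

definition bfs_norm :: "((real ^ 'n \<Rightarrow> ennreal) \<Rightarrow> ennreal) \<Rightarrow> (real ^ 'n \<Rightarrow> real) \<Rightarrow> ennreal" where
  "bfs_norm \<rho> f = \<rho> (\<lambda>x. ennreal \<bar>f x\<bar>)"

definition bfs :: "((real ^ 'n \<Rightarrow> ennreal) \<Rightarrow> ennreal) \<Rightarrow> (real ^ 'n \<Rightarrow> real) set" where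
  "bfs \<rho> = {f \<in> borel_measurable lebesgue. bfs_norm \<rho> f < \<infinity>}"

definition associate_norm :: "((real ^ 'n \<Rightarrow> ennreal) \<Rightarrow> ennreal) \<Rightarrow> (real ^ 'n \<Rightarrow> ennreal) \<Rightarrow> ennreal" where
  "associate_norm \<rho> f =
     (SUP g \<in> {g \<in> bfs \<rho>. bfs_norm \<rho> g \<le> 1}. \<integral>\<^sup>+x. f x * ennreal \<bar>g x\<bar> \<partial>lebesgue)"

definition maximal_op :: "(real ^ 'n \<Rightarrow> real) \<Rightarrow> real ^ 'n \<Rightarrow> ennreal" where
  "maximal_op f x =
     (SUP Q \<in> {Q. is_cube Q \<and> x \<in> Q}.
        (\<integral>\<^sup>+y\<in>Q. ennreal \<bar>f y\<bar> \<partial>lebesgue) / emeasure lebesgue Q)"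

definition maximal_op_bounded_on :: "((real ^ 'n \<Rightarrow> ennreal) \<Rightarrow> ennreal) \<Rightarrow> bool" where
  "maximal_op_bounded_on \<rho> \<longleftrightarrow>
     (\<exists>C::real. 0 < C \<and> (\<forall>f \<in> bfs \<rho>. \<rho> (maximal_op f) \<le> ennreal C * bfs_norm \<rho> f))"

end

(*
  (i) implies (ii): by the Lorentz-Luxemburg duality it suffices to test against h in the unit ball
  of X'. The Rubio de Francia iteration of M on X' produces an A_1 majorant w of h with norm at
  most 2, and the A_1 condition gives w(G) <= c (|G|/|Q|)^delta w(Q) for G inside Q. Then
  sum alpha_Q w(G_Q) is compared with sum alpha_Q w(Q) term by term.

  (ii) implies (i): by the one-third trick it suffices to bound dyadic maximal operators, and these
  are linearised by principal cubes: M f <= a sum f_Q chi_E(Q), with E(Q) the part of Q outside its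
  children. Dually one needs the norm of sum alpha_Q chi_Q in X, with alpha_Q = |Q|^-1 int_E(Q) g.
  The descendants of Q in the l-th generation fill at most a^-l |Q|, and for fixed l the layers
  between consecutive generations are pairwise disjoint, so (ii) bounds the contribution of the
  l-th layer by c a^(-l delta) times the full norm. For large a everything with l >= 1 is absorbed,
  and the sum over the disjoint sets E(Q) is at most M g pointwise.
*)

theory Submission
  imports Defs
begin

section \<open>Cubes and Banach function norms\<close>

text \<open>Duality is needed only for finite combinations of indicators of bounded sets. These are
  square integrable, so separation from the unit ball can be done in \<open>L\<^sup>2\<close>: the
  norming functional is a multiple of \<open>f - g0\<close>, where \<open>g0\<close> is the point
  nearest to \<open>f\<close> in the set of \<open>g\<close> with \<open>0 \<le> g \<le> f\<close>
  and \<open>\<rho> g \<le> 1\<close>, closed by the Fatou property. The exponent in (ii) is the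
  logarithm of \<open>\<gamma> = 1 - 1/(4C)\<close> to base
  \<open>\<theta> = 2\<^sup>-\<^sup>n\<^sup>-\<^sup>1\<close>, where \<open>C \<ge> 1\<close> bounds
  \<open>M\<close> on the associate space. It depends on the dimension and \<open>C\<close> alone,
  hence is the same for every weight and every grid. Absorption subtracts half of a norm from the
  norm itself, which is legitimate only if that norm is finite. Therefore principal cubes are built
  inside a finite family, and the whole grid is reached at the end by monotone convergence. The
  parts of principal cubes outside their children fill at least the proportion
  \<open>1 - 1/a\<close>. Since \<open>a\<close> may be as large as desired, every sparsity constant
  below one is attained by the same choice that makes absorption work.\<close>

definition cube :: "real ^ 'n \<Rightarrow> real \<Rightarrow> (real ^ 'n) set" where
  "cube a l = {x. \<forall>i. a $ i \<le> x $ i \<and> x $ i < a $ i + l}"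

lemma cube_of_side_iff: "cube_of_side l Q \<longleftrightarrow> 0 < l \<and> (\<exists>a. Q = cube a l)"
  by (simp add: cube_of_side_def cube_def)

lemma sets_borel_cube: "cube a l \<in> sets borel"
proof -
  have "cube a l = (\<Inter>i. {x. a $ i \<le> x $ i} \<inter> {x. x $ i < a $ i + l})"
    by (auto simp: cube_def)
  also have "\<dots> \<in> sets borel"
    by (intro sets.countable_INT'' sets.Int borel_closed borel_open
      closed_Collect_le open_Collect_less continuous_intros) auto
  finally show ?thesis .
qed

lemma emeasure_cube:
  fixes a :: "real ^ 'n"
  assumes "0 \<le> l"
  shows "emeasure lebesgue (cube a l) = ennreal (l ^ CARD('n))"
proof -
  let ?b = "a + (\<chi> i. l)"
  have inner: "(?b - a) \<bullet> b = l" if "b \<in> Basis" for b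
    using that by (auto simp: Basis_vec_def inner_axis)
  have le: "a \<bullet> b \<le> ?b \<bullet> b" if "b \<in> Basis" for b
    using inner[OF that] assms by (simp add: inner_diff_left inner_add_left)
  have prod: "(\<Prod>b\<in>Basis. (?b - a) \<bullet> b) = l ^ CARD('n)"
    using inner by simp
  have 1: "emeasure lborel (box a ?b) = l ^ CARD('n)"
    using emeasure_lborel_box[OF le] prod by simp
  have 2: "emeasure lborel (cbox a ?b) = l ^ CARD('n)"
    using emeasure_lborel_cbox[OF le] prod by simp
  have "box a ?b \<subseteq> cube a l" "cube a l \<subseteq> cbox a ?b"
    by (auto simp: cube_def mem_box_cart less_imp_le)
  then have "emeasure lborel (box a ?b) \<le> emeasure lborel (cube a l)"
    "emeasure lborel (cube a l) \<le> emeasure lborel (cbox a ?b)"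
    using sets_borel_cube[of a l] by (auto intro!: emeasure_mono)
  then have "emeasure lborel (cube a l) = l ^ CARD('n)"
    using 1 2 by simp
  then show ?thesis
    using sets_borel_cube[of a l] by (simp add: emeasure_completion)
qed

lemma lmeasurable_cube: "cube a l \<in> lmeasurable"
proof (cases "0 \<le> l")
  case True
  then show ?thesis
    using emeasure_cube[OF True, of a] sets_borel_cube[of a l]
    by (auto simp: fmeasurable_def intro: sets_completionI_sets)
next
  case False
  have "x \<notin> cube a l" for x
  proof
    assume "x \<in> cube a l"
    then have "a $ undefined \<le> x $ undefined \<and> x $ undefined < a $ undefined + l"
      unfolding cube_def by blast
    with False show False by linarith
  qed
  then have "cube a l = {}" by blast
  then show ?thesis by simp
qed

lemma measure_cube:
  fixes a :: "real ^ 'n"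
  assumes "0 \<le> l"
  shows "measure lebesgue (cube a l) = l ^ CARD('n)"
  using emeasure_cube[OF assms, of a] assms by (simp add: measure_def)

lemma bounded_cube: "bounded (cube a l)"
proof (rule bounded_subset)
  show "cube a l \<subseteq> cbox a (a + (\<chi> i. l))"
    by (auto simp: cube_def mem_box_cart less_imp_le)
qed simp

lemma cube_nonempty: "0 < l \<Longrightarrow> cube a l \<noteq> {}"
  by (auto simp: cube_def intro!: exI[of _ a])

lemma cube_of_side_lmeasurable: "cube_of_side l Q \<Longrightarrow> Q \<in> lmeasurable"
  by (auto simp: cube_of_side_iff lmeasurable_cube)

lemma cube_of_side_measure:
  fixes Q :: "(real ^ 'n) set"
  shows "cube_of_side l Q \<Longrightarrow> measure lebesgue Q = l ^ CARD('n)"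
  by (auto simp: cube_of_side_iff measure_cube)

lemma cube_of_side_unique:
  fixes Q :: "(real ^ 'n) set"
  assumes "cube_of_side l Q" "cube_of_side m Q"
  shows "l = m"
proof -
  have "l ^ CARD('n) = m ^ CARD('n)"
    using cube_of_side_measure assms by metis
  then show ?thesis
    using assms by (auto simp: cube_of_side_iff power_eq_iff_eq_base)
qed

lemma is_cube_props:
  fixes Q :: "(real ^ 'n) set"
  assumes "is_cube Q"
  shows is_cube_lmeasurable: "Q \<in> lmeasurable" and is_cube_bounded: "bounded Q"
    and is_cube_measure_pos: "0 < measure lebesgue Q"
  using assms by (auto simp: is_cube_def cube_of_side_iff lmeasurable_cube bounded_cube measure_cube)

lemma is_cube_sets: "is_cube Q \<Longrightarrow> Q \<in> sets lebesgue"
  using is_cube_lmeasurable by blast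

lemma is_cube_emeasure:
  "is_cube Q \<Longrightarrow> emeasure lebesgue Q = ennreal (measure lebesgue Q)"
  using is_cube_lmeasurable emeasure_eq_measure2 by blast

section \<open>Consequences of the axioms of a Banach function norm, and the Hoelder
  inequality\<close>

context
  fixes \<rho> :: "(real ^ 'n \<Rightarrow> ennreal) \<Rightarrow> ennreal"
  assumes bfn: "banach_function_norm \<rho>"
begin

lemma bfn_zero_iff:
  "f \<in> borel_measurable lebesgue \<Longrightarrow> \<rho> f = 0 \<longleftrightarrow> (AE x in lebesgue. f x = 0)"
  using bfn[unfolded banach_function_norm_def, THEN conjunct1] by blast

lemma bfn_scale:
  "f \<in> borel_measurable lebesgue \<Longrightarrow> 0 \<le> a \<Longrightarrow> \<rho> (\<lambda>x. ennreal a * f x) = ennreal a * \<rho> f"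
  using bfn[unfolded banach_function_norm_def, THEN conjunct2, THEN conjunct1] by blast

lemma bfn_triangle:
  "f \<in> borel_measurable lebesgue \<Longrightarrow> g \<in> borel_measurable lebesgue \<Longrightarrow>
    \<rho> (\<lambda>x. f x + g x) \<le> \<rho> f + \<rho> g"
  using bfn[unfolded banach_function_norm_def, THEN conjunct2, THEN conjunct2, THEN conjunct1] by blast

lemma bfn_mono_AE:
  "f \<in> borel_measurable lebesgue \<Longrightarrow> g \<in> borel_measurable lebesgue \<Longrightarrow>
    AE x in lebesgue. g x \<le> f x \<Longrightarrow> \<rho> g \<le> \<rho> f"
  using bfn[unfolded banach_function_norm_def,
      THEN conjunct2, THEN conjunct2, THEN conjunct2, THEN conjunct1] by blast

lemma bfn_mono:
  "f \<in> borel_measurable lebesgue \<Longrightarrow> g \<in> borel_measurable lebesgue \<Longrightarrow>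
    (\<And>x. g x \<le> f x) \<Longrightarrow> \<rho> g \<le> \<rho> f"
  by (rule bfn_mono_AE) auto

lemma bfn_LIMSEQ:
  assumes "\<And>k. F k \<in> borel_measurable lebesgue" "f \<in> borel_measurable lebesgue"
    and "AE x in lebesgue. incseq (\<lambda>k. F k x) \<and> (\<lambda>k. F k x) \<longlonglongrightarrow> f x"
  shows "(\<lambda>k. \<rho> (F k)) \<longlonglongrightarrow> \<rho> f"
  using bfn[unfolded banach_function_norm_def,
      THEN conjunct2, THEN conjunct2, THEN conjunct2, THEN conjunct2, THEN conjunct1] assms by blast

lemma bfn_indicator_finite:
  "E \<in> sets lebesgue \<Longrightarrow> bounded E \<Longrightarrow> \<rho> (indicator E) < \<infinity>"
  using bfn[unfolded banach_function_norm_def,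
      THEN conjunct2, THEN conjunct2, THEN conjunct2, THEN conjunct2, THEN conjunct2, THEN conjunct1] by blast

lemma bfn_locally_integrable:
  assumes "E \<in> sets lebesgue" "bounded E"
  obtains c where "c < \<infinity>"
    "\<And>f. f \<in> borel_measurable lebesgue \<Longrightarrow> (\<integral>\<^sup>+x\<in>E. f x \<partial>lebesgue) \<le> c * \<rho> f"
  using bfn[unfolded banach_function_norm_def,
      THEN conjunct2, THEN conjunct2, THEN conjunct2, THEN conjunct2, THEN conjunct2, THEN conjunct2] assms by blast

lemma bfn_sum:
  assumes "finite I" "\<And>i. i \<in> I \<Longrightarrow> F i \<in> borel_measurable lebesgue"
  shows "\<rho> (\<lambda>x. \<Sum>i\<in>I. F i x) \<le> (\<Sum>i\<in>I. \<rho> (F i))"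
  using assms
proof (induction I rule: finite_induct)
  case empty
  have "\<rho> (\<lambda>x. 0) = 0"
    by (subst bfn_zero_iff) auto
  then show ?case by simp
next
  case (insert i I)
  have "\<rho> (\<lambda>x. F i x + (\<Sum>j\<in>I. F j x)) \<le> \<rho> (F i) + \<rho> (\<lambda>x. \<Sum>j\<in>I. F j x)"
    using insert.prems by (intro bfn_triangle borel_measurable_sum) auto
  also have "\<dots> \<le> \<rho> (F i) + (\<Sum>j\<in>I. \<rho> (F j))"
    using insert by (intro add_left_mono) auto
  finally show ?case using insert.hyps by simp
qed

text \<open>The infima over tails increase to the limit, so the monotone convergence axiom applies
  to them, and each lies below \<open>F k\<close>. This is what makes the unit ball closed under
  a.e. limits.\<close>

lemma bfn_Fatou:
  assumes F: "\<And>k. F k \<in> borel_measurable lebesgue" and f: "f \<in> borel_measurable lebesgue"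
    and lim: "AE x in lebesgue. (\<lambda>k. F k x) \<longlonglongrightarrow> f x"
    and bound: "\<And>k. \<rho> (F k) \<le> B"
  shows "\<rho> f \<le> B"
proof -
  define L where "L k x = (INF j\<in>{k..}. F j x)" for k x
  have L: "L k \<in> borel_measurable lebesgue" for k
    unfolding L_def[abs_def] using F by (intro borel_measurable_INF) auto
  have "AE x in lebesgue. incseq (\<lambda>k. L k x) \<and> (\<lambda>k. L k x) \<longlonglongrightarrow> f x"
    using lim
  proof eventually_elim
    case (elim x)
    have inc: "incseq (\<lambda>k. L k x)"
      unfolding L_def by (intro monoI INF_superset_mono) auto
    have "(SUP k. L k x) = liminf (\<lambda>k. F k x)"
      unfolding L_def liminf_SUP_INF by simp
    also have "\<dots> = f x"
      using elim by (simp add: lim_imp_Liminf)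
    finally show ?case using LIMSEQ_SUP[OF inc] inc by simp
  qed
  from bfn_LIMSEQ[OF L f this] have "(\<lambda>k. \<rho> (L k)) \<longlonglongrightarrow> \<rho> f" .
  moreover have "\<rho> (L k) \<le> B" for k
  proof -
    have "L k x \<le> F k x" for x unfolding L_def by (intro INF_lower) simp
    from bfn_mono[OF F L this] bound[of k] show ?thesis by (rule order_trans)
  qed
  ultimately show ?thesis by (meson LIMSEQ_le_const2)
qed

text \<open>Dividing \<open>g\<close> by its finite norm gives a competitor in the supremum that
  defines the associate norm. If the norm is zero this is impossible, but then \<open>g\<close>
  vanishes a.e. and so does the integrand.\<close>

lemma associate_norm_Hoelder:
  assumes f: "f \<in> borel_measurable lebesgue" and g: "g \<in> borel_measurable lebesgue"
    and g0: "\<And>x. 0 \<le> g x" and fin: "\<rho> (\<lambda>x. ennreal (g x)) < \<infinity>"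
  shows "(\<integral>\<^sup>+x. f x * ennreal (g x) \<partial>lebesgue) \<le> associate_norm \<rho> f * \<rho> (\<lambda>x. ennreal (g x))"
proof -
  have gm: "(\<lambda>x. ennreal (g x)) \<in> borel_measurable lebesgue" using g by simp
  obtain r where r: "0 \<le> r" "\<rho> (\<lambda>x. ennreal (g x)) = ennreal r"
    using fin by (cases "\<rho> (\<lambda>x. ennreal (g x))") auto
  show ?thesis
  proof (cases "r = 0")
    case True
    then have "AE x in lebesgue. ennreal (g x) = 0"
      using r bfn_zero_iff[OF gm] by simp
    then have "(\<integral>\<^sup>+x. f x * ennreal (g x) \<partial>lebesgue) = 0"
      using f gm by (subst nn_integral_0_iff_AE) (auto elim: eventually_mono)
    then show ?thesis by simp
  next
    case False
    with r have rp: "0 < r" by simp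
    define g' where "g' x = g x / r" for x
    have g'eq: "ennreal \<bar>g' x\<bar> = ennreal (1 / r) * ennreal (g x)" for x
      using rp g0[of x] by (simp add: g'_def ennreal_mult'[symmetric])
    have "bfs_norm \<rho> g' = ennreal (1 / r) * ennreal r"
      unfolding bfs_norm_def g'eq using bfn_scale[OF gm, of "1/r"] rp r by simp
    also have "\<dots> = 1" using rp by (simp add: ennreal_mult'[symmetric])
    finally have n1: "bfs_norm \<rho> g' = 1" .
    have g'm: "g' \<in> bfs \<rho>" using g n1 by (simp add: bfs_def g'_def[abs_def])
    have "(\<integral>\<^sup>+x. f x * ennreal \<bar>g' x\<bar> \<partial>lebesgue) \<le> associate_norm \<rho> f"
      unfolding associate_norm_def using g'm n1 by (intro SUP_upper) auto
    then have "ennreal r * (\<integral>\<^sup>+x. f x * ennreal \<bar>g' x\<bar> \<partial>lebesgue) \<le> ennreal r * associate_norm \<rho> f"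
      by (intro mult_left_mono) auto
    moreover have "ennreal r * (\<integral>\<^sup>+x. f x * ennreal \<bar>g' x\<bar> \<partial>lebesgue)
      = (\<integral>\<^sup>+x. ennreal r * (f x * ennreal \<bar>g' x\<bar>) \<partial>lebesgue)"
      using f g by (intro nn_integral_cmult[symmetric]) (auto simp: g'_def[abs_def])
    moreover have "ennreal r * (f x * ennreal \<bar>g' x\<bar>) = f x * ennreal (g x)" for x
    proof -
      have "ennreal r * (f x * ennreal \<bar>g' x\<bar>) = (ennreal r * ennreal (1/r)) * (f x * ennreal (g x))"
        by (simp add: g'eq mult.left_commute mult.commute)
      also have "ennreal r * ennreal (1/r) = 1" using rp by (simp add: ennreal_mult'[symmetric])
      finally show ?thesis by simp
    qed
    ultimately show ?thesis using r by (simp add: mult.commute)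
  qed
qed

lemma associate_norm_locally_integrable:
  assumes f: "f \<in> borel_measurable lebesgue" and fin: "associate_norm \<rho> f < \<infinity>"
    and E: "E \<in> sets lebesgue" "bounded E"
  shows "(\<integral>\<^sup>+x\<in>E. f x \<partial>lebesgue) < \<infinity>"
proof -
  have eq: "ennreal (indicator E x) = indicator E x" for x by (simp add: ennreal_indicator)
  have "(\<integral>\<^sup>+x\<in>E. f x \<partial>lebesgue) \<le> associate_norm \<rho> f * \<rho> (indicator E)"
    using associate_norm_Hoelder[OF f, of "indicator E"] E bfn_indicator_finite[OF E]
    by (simp add: eq)
  also have "\<dots> < \<infinity>"
    using fin bfn_indicator_finite[OF E] by (simp add: ennreal_mult_less_top)
  finally show ?thesis .
qed

text \<open>Local integrability gives finiteness a.e. on each ball, and countably many balls exhaust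
  the space. Applied to maximal functions, it shows that making them real-valued changes them only
  on a null set.\<close>

lemma associate_norm_finite_AE:
  assumes f: "f \<in> borel_measurable lebesgue" and fin: "associate_norm \<rho> f < \<infinity>"
  shows "AE x in lebesgue. f x \<noteq> \<infinity>"
proof -
  have "AE x in lebesgue. \<forall>k::nat. f x * indicator (ball 0 (real k)) x \<noteq> \<infinity>"
    unfolding AE_all_countable
  proof
    fix k :: nat
    have B: "ball 0 (real k) \<in> sets (lebesgue :: (real ^ 'n) measure)" by simp
    show "AE x in lebesgue. f x * indicator (ball 0 (real k)) x \<noteq> \<infinity>"
      using associate_norm_locally_integrable[OF f fin B] f B
      by (intro nn_integral_PInf_AE borel_measurable_times_ennreal borel_measurable_indicator) auto
  qed
  then show ?thesis
  proof eventually_elim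
    case (elim x)
    obtain k :: nat where "norm x < real k" using reals_Archimedean2 by blast
    then show ?case using elim[rule_format, of k] by simp
  qed
qed

end

lemma associate_norm_mono:
  "(\<And>x. f x \<le> g x) \<Longrightarrow> associate_norm \<rho> f \<le> associate_norm \<rho> g"
  unfolding associate_norm_def
  by (intro SUP_mono') (auto intro!: nn_integral_mono mult_right_mono)

section \<open>Lorentz--Luxemburg duality\<close>

lemma integrable_square_bound:
  fixes f u :: "'a \<Rightarrow> real"
  assumes "integrable M (\<lambda>x. (f x)\<^sup>2)" "u \<in> borel_measurable M"
    and "\<And>x. \<bar>u x\<bar> \<le> c * \<bar>f x\<bar>"
  shows "integrable M (\<lambda>x. (u x)\<^sup>2)"
proof (rule Bochner_Integration.integrable_bound)
  show "integrable M (\<lambda>x. c\<^sup>2 * (f x)\<^sup>2)" using assms(1) by simp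
  have "(u x)\<^sup>2 \<le> c\<^sup>2 * (f x)\<^sup>2" for x
  proof -
    have "\<bar>u x\<bar>\<^sup>2 \<le> (c * \<bar>f x\<bar>)\<^sup>2" using assms(3)[of x] by (intro power_mono) auto
    then show ?thesis by (simp add: power_mult_distrib)
  qed
  then show "AE x in M. norm ((u x)\<^sup>2) \<le> norm (c\<^sup>2 * (f x)\<^sup>2)" by simp
  show "(\<lambda>x. (u x)\<^sup>2) \<in> borel_measurable M" using assms(2) by simp
qed

lemma integrable_mult_square_bound:
  fixes f h u :: "'a \<Rightarrow> real"
  assumes f2: "integrable M (\<lambda>x. (f x)\<^sup>2)" and hm: "h \<in> borel_measurable M"
    and hb: "\<And>x. 0 \<le> h x \<and> h x \<le> f x" and um: "u \<in> borel_measurable M"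
    and ub: "\<And>x. 0 \<le> u x \<and> u x \<le> b * f x"
  shows "integrable M (\<lambda>x. h x * u x)"
proof (rule Bochner_Integration.integrable_bound)
  show "integrable M (\<lambda>x. b * (f x)\<^sup>2)" using f2 by simp
  show "(\<lambda>x. h x * u x) \<in> borel_measurable M" using hm um by simp
  have "\<bar>h x * u x\<bar> \<le> \<bar>b * (f x)\<^sup>2\<bar>" for x
  proof -
    have "h x * u x \<le> f x * (b * f x)" using hb[of x] ub[of x] by (intro mult_mono) auto
    moreover have "0 \<le> h x * u x" using hb[of x] ub[of x] by simp
    ultimately show ?thesis by (simp add: power2_eq_square mult_ac)
  qed
  then show "AE x in M. norm (h x * u x) \<le> norm (b * (f x)\<^sup>2)" by simp
qed

text \<open>The Hilbert space projection onto a convex set, in the special case where the set is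
  dominated by the projected function, so that the parallelogram law can be applied to real
  integrals without introducing $L^2$.\<close>

lemma L2_projection_exists:
  fixes f :: "'a \<Rightarrow> real" and K :: "('a \<Rightarrow> real) set"
  assumes fm: "f \<in> borel_measurable M" and f2: "integrable M (\<lambda>x. (f x)\<^sup>2)"
    and Km: "\<And>g. g \<in> K \<Longrightarrow> g \<in> borel_measurable M"
    and Kb: "\<And>g x. g \<in> K \<Longrightarrow> 0 \<le> g x \<and> g x \<le> f x"
    and ne: "K \<noteq> {}"
    and mid: "\<And>g g'. g \<in> K \<Longrightarrow> g' \<in> K \<Longrightarrow> (\<lambda>x. (g x + g' x) / 2) \<in> K"
    and closed: "\<And>G g. (\<And>k::nat. G k \<in> K) \<Longrightarrow> g \<in> borel_measurable M \<Longrightarrow>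
      (\<And>x. 0 \<le> g x \<and> g x \<le> f x) \<Longrightarrow> AE x in M. (\<lambda>k. G k x) \<longlonglongrightarrow> g x \<Longrightarrow> g \<in> K"
  obtains g0 where "g0 \<in> K"
    "\<And>g. g \<in> K \<Longrightarrow> (\<integral>x. (f x - g0 x)\<^sup>2 \<partial>M) \<le> (\<integral>x. (f x - g x)\<^sup>2 \<partial>M)"
proof -
  define J where "J g = (\<integral>x. (f x - g x)\<^sup>2 \<partial>M)" for g
  have f0: "0 \<le> f x" for x using ne Kb by (meson equals0I order_trans)
  have int: "integrable M (\<lambda>x. (u x)\<^sup>2)"
    if "u \<in> borel_measurable M" "\<And>x. \<bar>u x\<bar> \<le> f x" for u
    using that f0 by (intro integrable_square_bound[OF f2, of _ 1]) auto
  have intJ: "integrable M (\<lambda>x. (f x - g x)\<^sup>2)" if "g \<in> K" for g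
    using Kb[OF that] Km[OF that] fm by (intro int) auto
  have bdd: "bdd_below (J ` K)"
    by (rule bdd_belowI[of _ 0]) (auto simp: J_def)
  define d where "d = Inf (J ` K)"
  have d_le: "d \<le> J g" if "g \<in> K" for g
    unfolding d_def using bdd that by (intro cInf_lower) auto
  \<comment> \<open>The rate \<open>8^-k\<close> leaves room for the weight \<open>2^k\<close> on
    the squared increments below, so the minimizing sequence itself converges a.e. and no
    subsequence has to be extracted.\<close>
  have "\<exists>g\<in>K. J g < d + 1/8^k" for k :: nat
    using cInf_lessD[of "J ` K" "d + 1/8^k"] ne by (auto simp: d_def)
  then obtain G where GK: "\<And>k. G k \<in> K" and GJ: "\<And>k::nat. J (G k) < d + 1/8^k"
    by metis
  define D where "D k x = G (Suc k) x - G k x" for k x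
  have Dm: "D k \<in> borel_measurable M" for k
    unfolding D_def[abs_def] using GK Km by (intro borel_measurable_diff) auto
  have intD: "integrable M (\<lambda>x. (D k x)\<^sup>2)" for k
    using Kb[OF GK[of k]] Kb[OF GK[of "Suc k"]]
    by (intro int Dm) (auto simp: D_def abs_le_iff intro: add_increasing2 order_trans[rotated] 
        simp: algebra_simps add_mono add_increasing)
  have Dle: "(\<integral>x. (D k x)\<^sup>2 \<partial>M) \<le> 4 / 8^k" for k
  proof -
    \<comment> \<open>The midpoint lies in \<open>K\<close>, so its distance is at least
      \<open>d\<close>; the parallelogram law then turns near-minimality of both ends into
      closeness.\<close>
    let ?m = "\<lambda>x. (G (Suc k) x + G k x) / 2"
    have mK: "?m \<in> K" by (intro mid GK)
    have "(\<integral>x. (D k x)\<^sup>2 \<partial>M)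
      = (\<integral>x. 2 * (f x - G (Suc k) x)\<^sup>2 + 2 * (f x - G k x)\<^sup>2 - 4 * (f x - ?m x)\<^sup>2 \<partial>M)"
      by (intro Bochner_Integration.integral_cong) (auto simp: D_def power2_eq_square field_simps)
    also have "\<dots> = 2 * J (G (Suc k)) + 2 * J (G k) - 4 * J ?m"
      using intJ[OF GK[of k]] intJ[OF GK[of "Suc k"]] intJ[OF mK] by (simp add: J_def)
    also have "\<dots> \<le> 2 * (d + 1/8^Suc k) + 2 * (d + 1/8^k) - 4 * d"
      using less_imp_le[OF GJ[of k]] less_imp_le[OF GJ[of "Suc k"]] d_le[OF mK]
      by (intro diff_mono add_mono mult_left_mono) auto
    also have "\<dots> \<le> 4 / 8^k" by (simp add: divide_simps)
    finally show ?thesis .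
  qed
  have "(\<integral>\<^sup>+x. (\<Sum>k. ennreal (2^k * (D k x)\<^sup>2)) \<partial>M) = (\<Sum>k. (\<integral>\<^sup>+x. ennreal (2^k * (D k x)\<^sup>2) \<partial>M))"
    using Dm by (intro nn_integral_suminf) auto
  also have "\<dots> \<le> (\<Sum>k. ennreal (4 * (1/4)^k))"
  proof (intro suminf_le allI)
    fix k :: nat
    have "(\<integral>\<^sup>+x. ennreal (2^k * (D k x)\<^sup>2) \<partial>M) = ennreal (\<integral>x. 2^k * (D k x)\<^sup>2 \<partial>M)"
      using intD[of k] by (intro nn_integral_eq_integral) auto
    also have "\<dots> = ennreal (2^k * (\<integral>x. (D k x)\<^sup>2 \<partial>M))" by simp
    also have "\<dots> \<le> ennreal (2^k * (4 / 8^k))"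
      using Dle[of k] by (intro ennreal_leI mult_left_mono) auto
    also have "2^k * (4 / 8^k) = 4 * (1/4::real)^k"
    proof -
      have "(8::real)^k = 2^k * 4^k" by (simp flip: power_mult_distrib)
      then show ?thesis by (simp add: power_divide)
    qed
    finally show "(\<integral>\<^sup>+x. ennreal (2^k * (D k x)\<^sup>2) \<partial>M) \<le> ennreal (4 * (1/4)^k)" .
  qed auto
  also have "\<dots> = ennreal (\<Sum>k. 4 * (1/4)^k)"
    by (intro suminf_ennreal2) (auto intro!: summable_mult summable_geometric)
  also have "\<dots> < \<infinity>" by simp
  finally have "AE x in M. (\<Sum>k. ennreal (2^k * (D k x)\<^sup>2)) \<noteq> \<infinity>"
    using Dm by (intro nn_integral_PInf_AE) auto
  then have conv: "AE x in M. convergent (\<lambda>k. G k x)"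
  proof eventually_elim
    case (elim x)
    then have s: "summable (\<lambda>k. 2^k * (D k x)\<^sup>2)"
      by (intro summable_suminf_not_top) auto
    have "summable (\<lambda>k. (1/2::real)^k + 2^k * (D k x)\<^sup>2)"
      using s by (intro summable_add summable_geometric) auto
    \<comment> \<open>The weighted arithmetic-geometric inequality passes from weighted square
      summability of the increments to absolute summability.\<close>
    moreover have "norm (D k x) \<le> (1/2)^k + 2^k * (D k x)\<^sup>2" for k
    proof -
      have "0 \<le> 2^k * (\<bar>D k x\<bar> - (1/2)^k)\<^sup>2" by simp
      also have "\<dots> = (1/2)^k + 2^k * (D k x)\<^sup>2 - 2 * \<bar>D k x\<bar>"
        by (simp add: power2_eq_square field_simps power_divide)
      finally show ?thesis by simp
    qed
    ultimately have "summable (\<lambda>k. D k x)"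
      by (rule summable_comparison_test'[where N = 0])
    then have "(\<lambda>n. \<Sum>k<n. D k x) \<longlonglongrightarrow> (\<Sum>k. D k x)" by (rule summable_LIMSEQ)
    then have "(\<lambda>n. G n x - G 0 x) \<longlonglongrightarrow> (\<Sum>k. D k x)"
      unfolding D_def using sum_lessThan_telescope[of "\<lambda>k. G k x"] by simp
    from tendsto_add[OF this tendsto_const[of "G 0 x"]] show ?case
      by (auto simp: convergent_def)
  qed
  \<comment> \<open>Clamping to the interval from 0 to \<open>f x\<close> enforces the bounds also
    at the exceptional points, where \<open>lim\<close> is an unspecified value, and changes nothing
    where the sequence converges.\<close>
  define g0 where "g0 x = max 0 (min (f x) (lim (\<lambda>k. G k x)))" for x
  have g0m: "g0 \<in> borel_measurable M"
    unfolding g0_def[abs_def] using fm GK Km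
    by (intro borel_measurable_max borel_measurable_min borel_measurable_lim_metric) auto
  have g0b: "0 \<le> g0 x \<and> g0 x \<le> f x" for x using f0[of x] by (auto simp: g0_def)
  have lim: "AE x in M. (\<lambda>k. G k x) \<longlonglongrightarrow> g0 x"
    using conv
  proof eventually_elim
    case (elim x)
    then have L: "(\<lambda>k. G k x) \<longlonglongrightarrow> lim (\<lambda>k. G k x)" by (simp add: convergent_LIMSEQ_iff)
    have "0 \<le> lim (\<lambda>k. G k x)" "lim (\<lambda>k. G k x) \<le> f x"
      using Kb GK by (auto intro!: LIMSEQ_le_const[OF L] LIMSEQ_le_const2[OF L])
    with L show ?case by (simp add: g0_def)
  qed
  have g0K: "g0 \<in> K" by (rule closed[OF GK g0m g0b lim])
  have "(\<lambda>k. J (G k)) \<longlonglongrightarrow> J g0"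
    unfolding J_def
  proof (rule integral_dominated_convergence)
    show "integrable M (\<lambda>x. (f x)\<^sup>2)" by (rule f2)
    show "(\<lambda>x. (f x - g0 x)\<^sup>2) \<in> borel_measurable M" using fm g0m by simp
    show "(\<lambda>x. (f x - G k x)\<^sup>2) \<in> borel_measurable M" for k using fm Km[OF GK] by simp
    show "AE x in M. (\<lambda>k. (f x - G k x)\<^sup>2) \<longlonglongrightarrow> (f x - g0 x)\<^sup>2"
      using lim by eventually_elim (intro tendsto_intros)
    show "AE x in M. norm ((f x - G k x)\<^sup>2) \<le> (f x)\<^sup>2" for k
      using Kb[OF GK[of k]] by (intro AE_I2) (auto intro!: power_mono)
  qed
  moreover have "(\<lambda>k. d + (1/8)^k) \<longlonglongrightarrow> d + 0"
    by (intro tendsto_intros LIMSEQ_power_zero) auto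
  ultimately have "J g0 \<le> d + 0"
    using GJ by (intro LIMSEQ_le[of "\<lambda>k. J (G k)" _ "\<lambda>k. d + (1/8)^k"])
      (auto simp: power_divide intro!: less_imp_le exI[of _ 0])
  then show ?thesis using that[OF g0K] d_le by (force simp: J_def)
qed

text \<open>The first-order condition at a minimizer: expanding the square along the segment from
  \<open>g0\<close> to \<open>g\<close> gives \<open>2 * P \<le> t * R\<close>, and \<open>t\<close>
  tends to zero. Minimality is assumed along this segment only, because \<open>g\<close> may exceed
  \<open>f\<close> and then lies outside the set projected onto.\<close>

lemma L2_projection_variational:
  fixes f g g0 :: "'a \<Rightarrow> real"
  assumes fm: "f \<in> borel_measurable M" and f2: "integrable M (\<lambda>x. (f x)\<^sup>2)"
    and g0m: "g0 \<in> borel_measurable M" and g0b: "\<And>x. 0 \<le> g0 x \<and> g0 x \<le> f x"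
    and gm: "g \<in> borel_measurable M" and gb: "\<And>x. 0 \<le> g x \<and> g x \<le> c * f x"
    and min: "\<And>t. 0 < t \<Longrightarrow> t \<le> 1 \<Longrightarrow>
      (\<integral>x. (f x - g0 x)\<^sup>2 \<partial>M) \<le> (\<integral>x. (f x - ((1 - t) * g0 x + t * g x))\<^sup>2 \<partial>M)"
  shows "(\<integral>x. (f x - g0 x) * g x \<partial>M) \<le> (\<integral>x. (f x - g0 x) * g0 x \<partial>M)"
proof -
  have f0: "0 \<le> f x" for x using g0b[of x] by linarith
  define h where "h x = f x - g0 x" for x
  have hm: "h \<in> borel_measurable M" unfolding h_def[abs_def] using fm g0m by simp
  have hb: "0 \<le> h x \<and> h x \<le> f x" for x using g0b[of x] by (auto simp: h_def)
  note prod = integrable_mult_square_bound[OF f2 hm hb]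
  have i1: "integrable M (\<lambda>x. h x * g x)" using prod[OF gm gb] .
  have i2: "integrable M (\<lambda>x. h x * g0 x)" using prod[OF g0m, of 1] g0b by auto
  have i3: "integrable M (\<lambda>x. (h x)\<^sup>2)"
    using hb f0 by (intro integrable_square_bound[OF f2 hm, of 1]) auto
  have i4: "integrable M (\<lambda>x. (g x - g0 x)\<^sup>2)"
  proof (intro integrable_square_bound[OF f2, of _ "\<bar>c\<bar> + 1"])
    fix x
    have "c * f x \<le> \<bar>c\<bar> * f x" using f0[of x] by (intro mult_right_mono) auto
    moreover have "0 \<le> \<bar>c\<bar> * f x" using f0[of x] by simp
    ultimately show "\<bar>g x - g0 x\<bar> \<le> (\<bar>c\<bar> + 1) * \<bar>f x\<bar>"
      using g0b[of x] gb[of x] f0[of x] by (simp add: distrib_right abs_le_iff)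
  qed (use gm g0m in simp)
  define P where "P = (\<integral>x. h x * g x \<partial>M) - (\<integral>x. h x * g0 x \<partial>M)"
  define R where "R = (\<integral>x. (g x - g0 x)\<^sup>2 \<partial>M)"
  have key: "2 * P \<le> t * R" if t: "0 < t" "t \<le> 1" for t
  proof -
    have "(\<integral>x. (h x)\<^sup>2 \<partial>M) \<le> (\<integral>x. (f x - ((1 - t) * g0 x + t * g x))\<^sup>2 \<partial>M)"
      using min[OF t] by (simp add: h_def)
    also have "\<dots> = (\<integral>x. (h x)\<^sup>2 - 2 * t * (h x * g x - h x * g0 x) + t\<^sup>2 * (g x - g0 x)\<^sup>2 \<partial>M)"
      by (intro Bochner_Integration.integral_cong)
        (auto simp: h_def power2_eq_square algebra_simps)
    also have "\<dots> = (\<integral>x. (h x)\<^sup>2 \<partial>M) - 2 * t * P + t\<^sup>2 * R"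
      using i1 i2 i3 i4 by (simp add: P_def R_def)
    finally have "t * (2 * P) \<le> t * (t * R)" by (simp add: power2_eq_square)
    with t show ?thesis by simp
  qed
  have "2 * P \<le> 0"
  proof (rule tendsto_lowerbound)
    show "((\<lambda>t. t * R) \<longlongrightarrow> 0) (at_right 0)" by (auto intro!: tendsto_eq_intros)
    show "\<forall>\<^sub>F t in at_right 0. 2 * P \<le> t * R"
      using eventually_at_right_real[of 0 1] by (auto elim!: eventually_mono intro!: key)
  qed simp
  then show ?thesis by (simp add: P_def h_def)
qed

lemma integral_square_pos:
  fixes h :: "'a \<Rightarrow> real"
  assumes "integrable M (\<lambda>x. (h x)\<^sup>2)" "\<not> (AE x in M. h x = 0)"
  shows "0 < (\<integral>x. (h x)\<^sup>2 \<partial>M)"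
proof -
  have "(\<integral>x. (h x)\<^sup>2 \<partial>M) \<noteq> 0"
    using assms by (subst integral_nonneg_eq_0_iff_AE) auto
  moreover have "0 \<le> (\<integral>x. (h x)\<^sup>2 \<partial>M)" by simp
  ultimately show ?thesis by linarith
qed

lemma associate_norm_leI:
  assumes "\<And>g. g \<in> borel_measurable lebesgue \<Longrightarrow> (\<And>x. 0 \<le> g x) \<Longrightarrow>
      \<rho> (\<lambda>x. ennreal (g x)) \<le> 1 \<Longrightarrow> (\<integral>\<^sup>+x. f x * ennreal (g x) \<partial>lebesgue) \<le> B"
  shows "associate_norm \<rho> f \<le> B"
  unfolding associate_norm_def
proof (intro SUP_least)
  fix g assume "g \<in> {g \<in> bfs \<rho>. bfs_norm \<rho> g \<le> 1}"
  then show "(\<integral>\<^sup>+x. f x * ennreal \<bar>g x\<bar> \<partial>lebesgue) \<le> B"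
    by (intro assms) (auto simp: bfs_def bfs_norm_def)
qed

text \<open>With \<open>g0\<close> the projection of \<open>f\<close> and \<open>h = f - g0\<close>,
  the pairing of \<open>h\<close> with any function of the unit ball is at most its pairing
  \<open>A\<close> with \<open>g0\<close>, whereas its pairing with \<open>f\<close> is
  \<open>A + d\<close>, where \<open>d\<close> is the squared norm of \<open>h\<close>. It is
  positive because \<open>f\<close> lies outside the unit ball.\<close>

lemma norming_functional_exists:
  fixes \<rho> :: "(real ^ 'n \<Rightarrow> ennreal) \<Rightarrow> ennreal" and f :: "real ^ 'n \<Rightarrow> real"
  assumes bfn: "banach_function_norm \<rho>"
    and fm: "f \<in> borel_measurable lebesgue" and f0: "\<And>x. 0 \<le> f x"
    and f2: "integrable lebesgue (\<lambda>x. (f x)\<^sup>2)"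
    and gt: "1 < \<rho> (\<lambda>x. ennreal (f x))"
  obtains h where "h \<in> borel_measurable lebesgue" "\<And>x. 0 \<le> h x"
    "associate_norm \<rho> (\<lambda>x. ennreal (h x)) \<le> 1"
    "1 < (\<integral>\<^sup>+x. ennreal (f x) * ennreal (h x) \<partial>lebesgue)"
proof -
  \<comment> \<open>Staying below \<open>f\<close> provides the common integrable majorant of all
    squares. Elements of the unit ball that are not below \<open>f\<close> are recovered by
    truncation afterwards.\<close>
  define K where "K = {g. g \<in> borel_measurable lebesgue \<and> (\<forall>x. 0 \<le> g x \<and> g x \<le> f x) \<and>
    \<rho> (\<lambda>x. ennreal (g x)) \<le> 1}"
  have convex: "\<rho> (\<lambda>x. ennreal ((1 - t) * g x + t * g' x)) \<le> 1"
    if "g \<in> borel_measurable lebesgue" "g' \<in> borel_measurable lebesgue"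
      "\<And>x. 0 \<le> g x" "\<And>x. 0 \<le> g' x" "\<rho> (\<lambda>x. ennreal (g x)) \<le> 1" "\<rho> (\<lambda>x. ennreal (g' x)) \<le> 1"
      "0 \<le> t" "t \<le> 1" for t g g'
  proof -
    have "\<rho> (\<lambda>x. ennreal ((1 - t) * g x + t * g' x))
      = \<rho> (\<lambda>x. ennreal (1 - t) * ennreal (g x) + ennreal t * ennreal (g' x))"
      using that by (simp add: ennreal_mult)
    also have "\<dots> \<le> \<rho> (\<lambda>x. ennreal (1 - t) * ennreal (g x)) + \<rho> (\<lambda>x. ennreal t * ennreal (g' x))"
      using that by (intro bfn_triangle[OF bfn]) auto
    also have "\<dots> = ennreal (1 - t) * \<rho> (\<lambda>x. ennreal (g x)) + ennreal t * \<rho> (\<lambda>x. ennreal (g' x))"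
      using that by (simp add: bfn_scale[OF bfn])
    also have "\<dots> \<le> ennreal (1 - t) * 1 + ennreal t * 1"
      using that by (intro add_mono mult_left_mono) auto
    also have "\<dots> = 1" using that by (simp flip: ennreal_plus)
    finally show ?thesis .
  qed
  have zero: "(\<lambda>x. 0) \<in> K"
  proof -
    have "\<rho> (\<lambda>x. 0) = 0" by (subst bfn_zero_iff[OF bfn]) auto
    then show ?thesis using f0 by (simp add: K_def)
  qed
  obtain g0 where g0K: "g0 \<in> K" and g0min:
    "\<And>g. g \<in> K \<Longrightarrow> (\<integral>x. (f x - g0 x)\<^sup>2 \<partial>lebesgue) \<le> (\<integral>x. (f x - g x)\<^sup>2 \<partial>lebesgue)"
  proof (rule L2_projection_exists[OF fm f2, of K])
    show "K \<noteq> {}" using zero by blast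
    show "(\<lambda>x. (g x + g' x) / 2) \<in> K" if "g \<in> K" "g' \<in> K" for g g'
    proof -
      have "\<rho> (\<lambda>x. ennreal ((1 - 1/2) * g x + 1/2 * g' x)) \<le> 1"
        using that by (intro convex) (auto simp: K_def)
      moreover have "(g x + g' x) / 2 \<le> f x" for x
      proof -
        have "g x \<le> f x" "g' x \<le> f x" using that by (auto simp: K_def)
        then show ?thesis by simp
      qed
      ultimately show ?thesis using that by (auto simp: K_def add_divide_distrib)
    qed
    show "g \<in> K" if G: "\<And>k::nat. G k \<in> K" and g: "g \<in> borel_measurable lebesgue"
      "\<And>x. 0 \<le> g x \<and> g x \<le> f x" "AE x in lebesgue. (\<lambda>k. G k x) \<longlonglongrightarrow> g x" for G g
    proof -
      have "\<rho> (\<lambda>x. ennreal (g x)) \<le> 1"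
      proof (rule bfn_Fatou[OF bfn])
        show "(\<lambda>x. ennreal (G k x)) \<in> borel_measurable lebesgue" for k using G by (simp add: K_def)
        show "AE x in lebesgue. (\<lambda>k. ennreal (G k x)) \<longlonglongrightarrow> ennreal (g x)"
          using g(3) by eventually_elim (rule tendsto_ennrealI)
      qed (use G g in \<open>auto simp: K_def\<close>)
      with g show ?thesis by (simp add: K_def)
    qed
  qed (auto simp: K_def)
  have g0m: "g0 \<in> borel_measurable lebesgue" and g0b: "\<And>x. 0 \<le> g0 x \<and> g0 x \<le> f x"
    and g0n: "\<rho> (\<lambda>x. ennreal (g0 x)) \<le> 1"
    using g0K by (auto simp: K_def)
  define h where "h x = f x - g0 x" for x
  have hm: "h \<in> borel_measurable lebesgue" unfolding h_def[abs_def] using fm g0m by simp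
  have hb: "0 \<le> h x \<and> h x \<le> f x" for x using g0b[of x] by (auto simp: h_def)
  note prod = integrable_mult_square_bound[OF f2 hm hb]
  have h2: "integrable lebesgue (\<lambda>x. (h x)\<^sup>2)"
    using prod[OF hm, of 1] hb by (simp add: power2_eq_square)
  have hg0: "integrable lebesgue (\<lambda>x. h x * g0 x)" using prod[OF g0m, of 1] g0b by auto
  define d where "d = (\<integral>x. (h x)\<^sup>2 \<partial>lebesgue)"
  define A where "A = (\<integral>x. h x * g0 x \<partial>lebesgue)"
  have A0: "0 \<le> A" unfolding A_def using hb g0b by (intro Bochner_Integration.integral_nonneg) auto
  have d0: "0 < d"
    unfolding d_def
  proof (rule integral_square_pos[OF h2])
    show "\<not> (AE x in lebesgue. h x = 0)"
    proof
      assume "AE x in lebesgue. h x = 0"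
      then have "AE x in lebesgue. ennreal (f x) \<le> ennreal (g0 x)"
        by eventually_elim (simp add: h_def)
      then have "\<rho> (\<lambda>x. ennreal (f x)) \<le> \<rho> (\<lambda>x. ennreal (g0 x))"
        using fm g0m by (intro bfn_mono_AE[OF bfn]) auto
      with g0n gt show False by (meson leD order_trans)
    qed
  qed
  have bounded_test: "(\<integral>x. h x * g x \<partial>lebesgue) \<le> A"
    if gm: "g \<in> borel_measurable lebesgue" and gb: "\<And>x. 0 \<le> g x \<and> g x \<le> c * f x"
      and gn: "\<rho> (\<lambda>x. ennreal (g x)) \<le> 1" for g c
    unfolding A_def h_def
  proof (rule L2_projection_variational[OF fm f2 g0m g0b gm gb])
    fix t :: real assume t: "0 < t" "t \<le> 1"
    let ?u = "\<lambda>x. (1 - t) * g0 x + t * g x"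
    have um: "?u \<in> borel_measurable lebesgue" using gm g0m by simp
    have u0: "0 \<le> ?u x" for x using t g0b[of x] gb[of x] by simp
    have un: "\<rho> (\<lambda>x. ennreal (?u x)) \<le> 1"
      using t g0b gb gn g0n g0m gm by (intro convex) auto
    have ub: "?u x \<le> (1 + \<bar>c\<bar>) * f x" for x
    proof -
      have "(1 - t) * g0 x \<le> 1 * f x" using t g0b[of x] by (intro mult_mono) auto
      moreover have "t * g x \<le> 1 * (\<bar>c\<bar> * f x)"
      proof (intro mult_mono)
        have "c * f x \<le> \<bar>c\<bar> * f x" using f0[of x] by (intro mult_right_mono) auto
        then show "g x \<le> \<bar>c\<bar> * f x" using gb[of x] by linarith
      qed (use t gb in auto)
      ultimately show ?thesis by (simp add: distrib_right)
    qed
    \<comment> \<open>The convex combination may exceed \<open>f\<close> and so leave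
      \<open>K\<close>. Cutting it off at \<open>f\<close> returns it to \<open>K\<close> and only
      decreases the distance to \<open>f\<close>, so minimality carries over to the uncut
      function.\<close>
    have "(\<lambda>x. min (f x) (?u x)) \<in> K"
    proof -
      have "\<rho> (\<lambda>x. ennreal (min (f x) (?u x))) \<le> \<rho> (\<lambda>x. ennreal (?u x))"
        using fm um by (intro bfn_mono[OF bfn]) (auto intro!: ennreal_leI)
      then show ?thesis using un u0 f0 fm um by (auto simp: K_def)
    qed
    from g0min[OF this]
    have "(\<integral>x. (f x - g0 x)\<^sup>2 \<partial>lebesgue) \<le> (\<integral>x. (f x - min (f x) (?u x))\<^sup>2 \<partial>lebesgue)" .
    also have "\<dots> \<le> (\<integral>x. (f x - ?u x)\<^sup>2 \<partial>lebesgue)"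
    proof (rule integral_mono)
      show "integrable lebesgue (\<lambda>x. (f x - min (f x) (?u x))\<^sup>2)"
        using fm um u0 f0
        by (intro integrable_square_bound[OF f2, of _ 1]) (auto simp: min_def)
      show "integrable lebesgue (\<lambda>x. (f x - ?u x)\<^sup>2)"
      proof (intro integrable_square_bound[OF f2, of _ "2 + \<bar>c\<bar>"])
        show "\<bar>f x - ?u x\<bar> \<le> (2 + \<bar>c\<bar>) * \<bar>f x\<bar>" for x
          using u0[of x] ub[of x] f0[of x] by (simp add: abs_le_iff distrib_right)
      qed (use fm um in simp)
      show "(f x - min (f x) (?u x))\<^sup>2 \<le> (f x - ?u x)\<^sup>2" for x
        by (auto simp: min_def)
    qed
    finally show "(\<integral>x. (f x - g0 x)\<^sup>2 \<partial>lebesgue) \<le> (\<integral>x. (f x - ?u x)\<^sup>2 \<partial>lebesgue)" .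
  qed
  have hA: "(\<integral>\<^sup>+x. ennreal (h x) * ennreal (g x) \<partial>lebesgue) \<le> ennreal A"
    if gm: "g \<in> borel_measurable lebesgue" and ge0: "\<And>x. 0 \<le> g x"
      and gn: "\<rho> (\<lambda>x. ennreal (g x)) \<le> 1" for g
  proof -
    \<comment> \<open>These truncations increase to \<open>g\<close> wherever \<open>f\<close> is
      positive; elsewhere \<open>h\<close> vanishes, so the products with \<open>h\<close> converge
      everywhere.\<close>
    define u where "u k x = min (g x) (real k * f x)" for k x
    have um: "u k \<in> borel_measurable lebesgue" for k
      unfolding u_def[abs_def] using gm fm by simp
    have ub: "0 \<le> u k x \<and> u k x \<le> real k * f x" for k x
      using ge0[of x] f0[of x] by (simp add: u_def)
    have "\<rho> (\<lambda>x. ennreal (u k x)) \<le> 1" for k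
    proof -
      have "\<rho> (\<lambda>x. ennreal (u k x)) \<le> \<rho> (\<lambda>x. ennreal (g x))"
      proof (rule bfn_mono[OF bfn])
        show "ennreal (u k x) \<le> ennreal (g x)" for x by (intro ennreal_leI) (simp add: u_def)
      qed (use um gm in auto)
      with gn show ?thesis by simp
    qed
    then have "(\<integral>x. h x * u k x \<partial>lebesgue) \<le> A" for k
      by (intro bounded_test[OF um ub])
    moreover have "(\<integral>\<^sup>+x. ennreal (h x * u k x) \<partial>lebesgue) = ennreal (\<integral>x. h x * u k x \<partial>lebesgue)" for k
      using prod[OF um ub] hb ub by (intro nn_integral_eq_integral) auto
    ultimately have le: "(\<integral>\<^sup>+x. ennreal (h x * u k x) \<partial>lebesgue) \<le> ennreal A" for k
      by (simp add: ennreal_leI)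
    have pt: "(SUP k. ennreal (h x * u k x)) = ennreal (h x) * ennreal (g x)" for x
    proof (cases "f x = 0")
      case True
      then have "h x = 0" using hb[of x] by simp
      then show ?thesis by simp
    next
      case False
      then have fp: "0 < f x" using f0[of x] by simp
      obtain N :: nat where N: "g x / f x < real N" using reals_Archimedean2 by blast
      show ?thesis
      proof (rule antisym)
        show "(SUP k. ennreal (h x * u k x)) \<le> ennreal (h x) * ennreal (g x)"
          using hb ge0 by (intro SUP_least) (auto simp: u_def ennreal_mult[symmetric] intro!: ennreal_leI mult_left_mono)
        have "u N x = g x" using N fp by (simp add: u_def field_simps)
        then have "ennreal (h x) * ennreal (g x) = ennreal (h x * u N x)"
          using hb ge0 by (simp add: ennreal_mult)
        then show "ennreal (h x) * ennreal (g x) \<le> (SUP k. ennreal (h x * u k x))"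
          by (metis SUP_upper UNIV_I)
      qed
    qed
    have "(\<integral>\<^sup>+x. ennreal (h x) * ennreal (g x) \<partial>lebesgue) = (\<integral>\<^sup>+x. (SUP k. ennreal (h x * u k x)) \<partial>lebesgue)"
      by (simp add: pt)
    also have "\<dots> = (SUP k. (\<integral>\<^sup>+x. ennreal (h x * u k x) \<partial>lebesgue))"
    proof (rule nn_integral_monotone_convergence_SUP)
      show "incseq (\<lambda>k x. ennreal (h x * u k x))"
      proof (intro monoI le_funI ennreal_leI mult_left_mono)
        fix k l :: nat and x :: "real ^ 'n" assume "k \<le> l"
        then have "real k * f x \<le> real l * f x" using f0[of x] by (intro mult_right_mono) auto
        then show "u k x \<le> u l x" by (auto simp: u_def min_def)
      qed (use hb in auto)
      show "(\<lambda>x. ennreal (h x * u k x)) \<in> borel_measurable lebesgue" for k using hm um by simp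
    qed
    also have "\<dots> \<le> ennreal A" using le by (intro SUP_least) auto
    finally show ?thesis .
  qed
  \<comment> \<open>The threshold \<open>A + d / 2\<close> separates \<open>A\<close> from
    \<open>A + d\<close> and is positive even if \<open>A\<close> is zero.\<close>
  define s where "s = 1 / (A + d / 2)"
  have s0: "0 < s" using A0 d0 by (simp add: s_def)
  show thesis
  proof (rule that[of "\<lambda>x. s * h x"])
    show "(\<lambda>x. s * h x) \<in> borel_measurable lebesgue" using hm by simp
    show "0 \<le> s * h x" for x using s0 hb[of x] by simp
    show "associate_norm \<rho> (\<lambda>x. ennreal (s * h x)) \<le> 1"
    proof (rule associate_norm_leI)
      fix g :: "real ^ 'n \<Rightarrow> real"
      assume g: "g \<in> borel_measurable lebesgue" "\<And>x. 0 \<le> g x" "\<rho> (\<lambda>x. ennreal (g x)) \<le> 1"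
      have "(\<integral>\<^sup>+x. ennreal (s * h x) * ennreal (g x) \<partial>lebesgue)
        = (\<integral>\<^sup>+x. ennreal s * (ennreal (h x) * ennreal (g x)) \<partial>lebesgue)"
        using s0 hb by (simp add: ennreal_mult mult.assoc)
      also have "\<dots> = ennreal s * (\<integral>\<^sup>+x. ennreal (h x) * ennreal (g x) \<partial>lebesgue)"
        using g hm by (intro nn_integral_cmult) auto
      also have "\<dots> \<le> ennreal s * ennreal A" using hA[OF g] by (intro mult_left_mono) auto
      also have "\<dots> = ennreal (s * A)" using s0 A0 by (simp add: ennreal_mult)
      also have "\<dots> \<le> 1"
      proof -
        have "s * A \<le> 1" using A0 d0 by (simp add: s_def field_simps)
        then show ?thesis by simp
      qed
      finally show "(\<integral>\<^sup>+x. ennreal (s * h x) * ennreal (g x) \<partial>lebesgue) \<le> 1" .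
    qed
    have "(\<integral>\<^sup>+x. ennreal (f x) * ennreal (s * h x) \<partial>lebesgue)
      = (\<integral>\<^sup>+x. ennreal (s * ((h x)\<^sup>2 + h x * g0 x)) \<partial>lebesgue)"
      using f0 s0 hb by (intro nn_integral_cong)
        (auto simp: ennreal_mult[symmetric] h_def power2_eq_square algebra_simps intro!: arg_cong[of _ _ ennreal])
    also have "\<dots> = ennreal (\<integral>x. s * ((h x)\<^sup>2 + h x * g0 x) \<partial>lebesgue)"
      using h2 hg0 s0 hb g0b by (intro nn_integral_eq_integral) auto
    also have "(\<integral>x. s * ((h x)\<^sup>2 + h x * g0 x) \<partial>lebesgue) = s * (d + A)"
      using h2 hg0 by (simp add: d_def A_def)
    finally have eq: "(\<integral>\<^sup>+x. ennreal (f x) * ennreal (s * h x) \<partial>lebesgue) = ennreal (s * (d + A))" .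
    have "1 < s * (d + A)" using A0 d0 by (simp add: s_def field_simps)
    then show "1 < (\<integral>\<^sup>+x. ennreal (f x) * ennreal (s * h x) \<partial>lebesgue)"
      unfolding eq by (simp add: ennreal_1[symmetric] ennreal_less_iff del: ennreal_1)
  qed
qed

text \<open>The half of the Lorentz--Luxemburg theorem $X'' = X$ that needs a separation argument.\<close>

lemma bfn_le_by_duality:
  fixes \<rho> :: "(real ^ 'n \<Rightarrow> ennreal) \<Rightarrow> ennreal" and f :: "real ^ 'n \<Rightarrow> real"
  assumes bfn: "banach_function_norm \<rho>"
    and fm: "f \<in> borel_measurable lebesgue" and f0: "\<And>x. 0 \<le> f x"
    and f2: "integrable lebesgue (\<lambda>x. (f x)\<^sup>2)"
    and dual: "\<And>h. h \<in> borel_measurable lebesgue \<Longrightarrow> (\<And>x. 0 \<le> h x) \<Longrightarrow>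
      associate_norm \<rho> (\<lambda>x. ennreal (h x)) \<le> 1 \<Longrightarrow>
      (\<integral>\<^sup>+x. ennreal (f x) * ennreal (h x) \<partial>lebesgue) \<le> B"
  shows "\<rho> (\<lambda>x. ennreal (f x)) \<le> B"
proof (rule ccontr)
  assume "\<not> \<rho> (\<lambda>x. ennreal (f x)) \<le> B"
  then have "B < \<rho> (\<lambda>x. ennreal (f x))" by simp
  \<comment> \<open>A finite positive level strictly in between: \<open>B\<close> may be zero and
    the norm of \<open>f\<close> infinite, so neither can serve as the scaling factor.\<close>
  then obtain c where c: "B < c" "c < \<rho> (\<lambda>x. ennreal (f x))" using dense by blast
  obtain b where b0: "0 \<le> b" "c = ennreal b" using c(2) by (cases c) auto
  then have b: "0 < b" "c = ennreal b" using c(1) by (cases "b = 0"; simp)+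
  let ?f = "\<lambda>x. 1 / b * f x"
  have fmE: "(\<lambda>x. ennreal (f x)) \<in> borel_measurable lebesgue" using fm by simp
  have sc: "ennreal (?f x) = ennreal (1 / b) * ennreal (f x)" for x
    using b f0[of x] by (intro ennreal_mult) auto
  have inv: "ennreal (1 / b) * ennreal b = 1" using b by (simp flip: ennreal_mult)
  have "1 < \<rho> (\<lambda>x. ennreal (?f x))"
  proof -
    have "ennreal (1 / b) * ennreal b < ennreal (1 / b) * \<rho> (\<lambda>x. ennreal (f x))"
      using b c by (intro ennreal_mult_strict_left_mono) auto
    then show ?thesis unfolding sc using inv bfn_scale[OF bfn fmE, of "1/b"] b by simp
  qed
  then obtain h where h: "h \<in> borel_measurable lebesgue" "\<And>x. 0 \<le> h x"
    "associate_norm \<rho> (\<lambda>x. ennreal (h x)) \<le> 1"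
    "1 < (\<integral>\<^sup>+x. ennreal (?f x) * ennreal (h x) \<partial>lebesgue)"
  proof (rule norming_functional_exists[OF bfn, rotated -2])
    show "integrable lebesgue (\<lambda>x. (?f x)\<^sup>2)"
      using f2 by (simp only: power_mult_distrib integrable_mult_right)
  qed (use b f0 fm in auto)
  have "(\<integral>\<^sup>+x. ennreal (?f x) * ennreal (h x) \<partial>lebesgue)
    = ennreal (1 / b) * (\<integral>\<^sup>+x. ennreal (f x) * ennreal (h x) \<partial>lebesgue)"
    unfolding sc mult.assoc using fm h by (intro nn_integral_cmult) auto
  also have "\<dots> \<le> ennreal (1 / b) * ennreal b"
    using dual[OF h(1-3)] c b by (intro mult_left_mono) auto
  finally show False using h(4) inv by simp
qed

section \<open>Dyadic grids\<close>

lemma two_powi_le_iff: "(2 powi k :: real) \<le> 2 powi j \<longleftrightarrow> k \<le> j"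
  using power_int_increasing[of k j "2::real"] power_int_strict_increasing[of j k "2::real"]
  by force

lemma cube_of_side_nonempty: "cube_of_side l Q \<Longrightarrow> Q \<noteq> {}"
  using cube_nonempty by (auto simp: cube_of_side_iff)

context
  fixes D :: "(real ^ 'n) set set"
  assumes D: "dyadic_grid D"
begin

lemma dyadic_grid_side:
  assumes "Q \<in> D" obtains k :: int where "cube_of_side (2 powi k) Q"
  using D assms unfolding dyadic_grid_def by blast

lemma dyadic_grid_is_cube: "Q \<in> D \<Longrightarrow> is_cube Q"
  using dyadic_grid_side is_cube_def by metis

lemma dyadic_grid_lmeasurable: "Q \<in> D \<Longrightarrow> Q \<in> lmeasurable"
  using dyadic_grid_is_cube is_cube_lmeasurable by blast

lemma dyadic_grid_sets: "Q \<in> D \<Longrightarrow> Q \<in> sets lebesgue"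
  using dyadic_grid_lmeasurable by blast

lemma dyadic_grid_measure_pos: "Q \<in> D \<Longrightarrow> 0 < measure lebesgue Q"
  using dyadic_grid_is_cube is_cube_measure_pos by blast

lemma dyadic_grid_nested: "Q \<in> D \<Longrightarrow> R \<in> D \<Longrightarrow> Q \<inter> R \<noteq> {} \<Longrightarrow> Q \<subseteq> R \<or> R \<subseteq> Q"
  using D unfolding dyadic_grid_def by blast

lemma dyadic_grid_partition:
  fixes k :: int
  shows "partition_on UNIV {Q \<in> D. cube_of_side (2 powi k) Q}"
  using D unfolding dyadic_grid_def by blast

lemma dyadic_grid_cover:
  fixes k :: int
  obtains Q where "Q \<in> D" "cube_of_side (2 powi k) Q" "x \<in> Q"
  using partition_onD1[OF dyadic_grid_partition[of k]] by blast

lemma dyadic_grid_same_level: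
  fixes k :: int
  assumes "Q \<in> D" "R \<in> D" "cube_of_side (2 powi k) Q" "cube_of_side (2 powi k) R" "Q \<inter> R \<noteq> {}"
  shows "Q = R"
  using disjointD[OF partition_onD2[OF dyadic_grid_partition[of k]], of Q R] assms by blast

lemma dyadic_grid_subset:
  assumes QR: "Q \<in> D" "R \<in> D" "Q \<inter> R \<noteq> {}" and le: "measure lebesgue Q \<le> measure lebesgue R"
  shows "Q \<subseteq> R"
proof -
  obtain k m :: int where km: "cube_of_side (2 powi k) Q" "cube_of_side (2 powi m) R"
    using dyadic_grid_side QR by metis
  consider "Q \<subseteq> R" | "R \<subseteq> Q" using dyadic_grid_nested[OF QR] by blast
  then show ?thesis
  proof cases
    case 2
    then have "measure lebesgue R \<le> measure lebesgue Q"
      using km cube_of_side_lmeasurable by (intro measure_mono_fmeasurable) auto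
    with le have "(2 powi k :: real) ^ CARD('n) = (2 powi m) ^ CARD('n)"
      using km by (simp add: cube_of_side_measure)
    then have "(2 powi k :: real) = 2 powi m" by (subst (asm) power_eq_iff_eq_base) auto
    then show ?thesis using dyadic_grid_same_level[OF QR(1,2), of m] km QR(3) by simp
  qed
qed

text \<open>The parent is the cube of the next level through a point of \<open>Q\<close>. It stays
  inside \<open>R\<close> because levels are integers: a cube of the grid strictly larger than
  \<open>Q\<close> has at least the level of the parent.\<close>

lemma dyadic_grid_parent:
  assumes QR: "Q \<in> D" "R \<in> D" "Q \<subset> R"
  obtains P where "P \<in> D" "Q \<subseteq> P" "P \<subseteq> R" "P \<noteq> Q"
    "measure lebesgue P = 2 ^ CARD('n) * measure lebesgue Q"
proof -
  obtain k m :: int where km: "cube_of_side (2 powi k) Q" "cube_of_side (2 powi m) R"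
    using dyadic_grid_side QR by metis
  obtain x where x: "x \<in> Q" using cube_of_side_nonempty[OF km(1)] by blast
  obtain P where P: "P \<in> D" "cube_of_side (2 powi (k + 1)) P" "x \<in> P"
    using dyadic_grid_cover[of "k + 1" x] by blast
  have mP: "measure lebesgue P = 2 ^ CARD('n) * measure lebesgue Q"
    using cube_of_side_measure[OF P(2)] cube_of_side_measure[OF km(1)]
    by (simp add: power_int_add power_mult_distrib)
  have mQ: "0 < measure lebesgue Q" using dyadic_grid_is_cube[OF QR(1)] by (rule is_cube_measure_pos)
  have one: "(1::real) < 2 ^ CARD('n)" by simp
  have lt: "measure lebesgue Q < measure lebesgue P"
    using mult_strict_right_mono[OF one mQ] by (simp add: mP)
  then have PQ: "P \<noteq> Q" by blast
  have QP: "Q \<subseteq> P"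
    using lt x P(3) by (intro dyadic_grid_subset[OF QR(1) P(1)]) auto
  have "k < m"
  proof (rule ccontr)
    assume "\<not> k < m"
    then have "(2 powi m :: real) \<le> 2 powi k" by (intro power_int_increasing) auto
    then have "measure lebesgue R \<le> measure lebesgue Q"
      using km by (simp add: cube_of_side_measure power_mono)
    then have "R \<subseteq> Q" using QR x by (intro dyadic_grid_subset[OF QR(2,1)]) auto
    with QR show False by blast
  qed
  then have "(2 powi (k + 1) :: real) \<le> 2 powi m" by (intro power_int_increasing) auto
  then have "measure lebesgue P \<le> measure lebesgue R"
    using km P by (simp add: cube_of_side_measure power_mono)
  then have "P \<subseteq> R" using P QR x by (intro dyadic_grid_subset[OF P(1) QR(2)]) auto
  with P QP PQ mP show ?thesis using that by blast
qed

text \<open>All these cubes contain a fixed point of \<open>C\<close>, each level has only one such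
  cube, and the levels lie between those of \<open>C\<close> and \<open>Q\<close>.\<close>

lemma dyadic_grid_finite_between:
  assumes CQ: "C \<in> D" "Q \<in> D"
  shows "finite {P \<in> D. C \<subseteq> P \<and> P \<subseteq> Q}"
proof -
  obtain k m :: int where km: "cube_of_side (2 powi k) C" "cube_of_side (2 powi m) Q"
    using dyadic_grid_side CQ by metis
  obtain x where x: "x \<in> C" using cube_of_side_nonempty[OF km(1)] by blast
  have "{P \<in> D. C \<subseteq> P \<and> P \<subseteq> Q} \<subseteq>
    (\<Union>j\<in>{k..m}. {P \<in> D. cube_of_side (2 powi j) P \<and> x \<in> P})"
  proof
    fix P assume "P \<in> {P \<in> D. C \<subseteq> P \<and> P \<subseteq> Q}"
    then have P: "P \<in> D" "C \<subseteq> P" "P \<subseteq> Q" by auto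
    obtain j :: int where j: "cube_of_side (2 powi j) P" using dyadic_grid_side P by metis
    have "measure lebesgue C \<le> measure lebesgue P" "measure lebesgue P \<le> measure lebesgue Q"
      using km j P cube_of_side_lmeasurable by (auto intro!: measure_mono_fmeasurable)
    then have "(2 powi k :: real) \<le> 2 powi j" "(2 powi j :: real) \<le> 2 powi m"
      using km j by (simp_all add: cube_of_side_measure power_mono_iff)
    then have "k \<le> j" "j \<le> m" by (simp_all add: two_powi_le_iff)
    then show "P \<in> (\<Union>j\<in>{k..m}. {P \<in> D. cube_of_side (2 powi j) P \<and> x \<in> P})"
      using P j x by auto
  qed
  moreover have "finite {P \<in> D. cube_of_side (2 powi j) P \<and> x \<in> P}" for j :: int
  proof -
    obtain P where P: "P \<in> D" "cube_of_side (2 powi j) P" "x \<in> P"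
      using dyadic_grid_cover[of j x] by blast
    have "{P \<in> D. cube_of_side (2 powi j) P \<and> x \<in> P} \<subseteq> {P}"
      using dyadic_grid_same_level[of _ P j] P by blast
    then show ?thesis by (rule finite_subset) simp
  qed
  ultimately show ?thesis by (meson finite_UN_I finite_atLeastAtMost_int finite_subset)
qed

text \<open>A cube is determined by its level and by any of its points, and the point can be taken
  from a countable dense set because the cube has nonempty interior.\<close>

lemma dyadic_grid_countable: "countable D"
proof -
  obtain A :: "(real ^ 'n) set" where A: "countable A"
    "\<And>X. open X \<Longrightarrow> X \<noteq> {} \<Longrightarrow> \<exists>d\<in>A. d \<in> X"
    using countable_dense_setE by metis
  have "D \<subseteq> (\<lambda>(k::int, d). THE Q. Q \<in> D \<and> cube_of_side (2 powi k) Q \<and> d \<in> Q) ` (UNIV \<times> A)"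
  proof
    fix Q assume Q: "Q \<in> D"
    obtain k :: int where k: "cube_of_side (2 powi k) Q" using dyadic_grid_side Q by metis
    then obtain a where a: "Q = cube a (2 powi k)" by (auto simp: cube_of_side_iff)
    let ?B = "box a (a + (\<chi> i. 2 powi k))"
    have "?B \<noteq> {}" by (simp add: interval_ne_empty_cart(2))
    then obtain d where d: "d \<in> A" "d \<in> ?B" using A(2)[of ?B] open_box by blast
    then have "d \<in> Q" by (auto simp: a cube_def mem_box_cart less_imp_le)
    then have "(THE Q. Q \<in> D \<and> cube_of_side (2 powi k) Q \<and> d \<in> Q) = Q"
      using Q k dyadic_grid_same_level[of _ Q k] by (intro the_equality) blast+
    then show "Q \<in> (\<lambda>(k::int, d). THE Q. Q \<in> D \<and> cube_of_side (2 powi k) Q \<and> d \<in> Q) ` (UNIV \<times> A)"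
      using d by (intro image_eqI[of _ _ "(k, d)"]) auto
  qed
  then show ?thesis using A(1) by (meson countable_SIGMA countable_image countableI_type countable_subset)
qed

lemma dyadic_grid_small_cube:
  assumes Q: "Q \<in> D" "x \<in> Q" and U: "open U" "x \<in> U"
  obtains P where "P \<in> D" "x \<in> P" "P \<subseteq> Q" "P \<subseteq> U"
proof -
  obtain k :: int where k: "cube_of_side (2 powi k) Q" using dyadic_grid_side Q by metis
  obtain e where e: "0 < e" "ball x e \<subseteq> U" using U openE by blast
  \<comment> \<open>The factor \<open>CARD('n)\<close> arises from bounding the Euclidean norm by
    the sum of the coordinates.\<close>
  obtain j :: nat where j: "(1/2) ^ j < e / real CARD('n) / 2 powi k"
    using e real_arch_pow_inv[of "e / real CARD('n) / 2 powi k" "1/2"] by auto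
  define m where "m = k - int j"
  have pm: "(2 powi m :: real) = 2 powi k * (1/2) ^ j"
    by (simp add: m_def power_int_diff power_one_over)
  have lt: "real CARD('n) * 2 powi m < e"
    using j by (simp add: pm field_simps)
  obtain P where P: "P \<in> D" "cube_of_side (2 powi m) P" "x \<in> P"
    using dyadic_grid_cover[of m x] by blast
  have "(2 powi m :: real) \<le> 2 powi k" unfolding m_def by (intro power_int_increasing) auto
  then have "measure lebesgue P \<le> measure lebesgue Q"
    using P k by (simp add: cube_of_side_measure power_mono)
  then have PQ: "P \<subseteq> Q" using P Q by (intro dyadic_grid_subset) auto
  have "P \<subseteq> ball x e"
  proof
    fix y assume y: "y \<in> P"
    obtain a where a: "P = cube a (2 powi m)" using P by (auto simp: cube_of_side_iff)
    have "\<bar>(x - y) $ i\<bar> \<le> 2 powi m" for i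
    proof -
      have "a $ i \<le> x $ i \<and> x $ i < a $ i + 2 powi m" "a $ i \<le> y $ i \<and> y $ i < a $ i + 2 powi m"
        using P(3) y unfolding a cube_def by blast+
      then show ?thesis by simp linarith
    qed
    then have "(\<Sum>i\<in>UNIV. \<bar>(x - y) $ i\<bar>) \<le> (\<Sum>i\<in>(UNIV :: 'n set). 2 powi m)" by (intro sum_mono)
    then have "norm (x - y) \<le> real CARD('n) * 2 powi m"
      using norm_le_l1_cart[of "x - y"] by simp
    with lt show "y \<in> ball x e" by (simp add: dist_norm)
  qed
  with that P PQ e show ?thesis by blast
qed

end

section \<open>Decay of dyadic weights\<close>

text \<open>Here \<open>\<nu>\<close> stands for the measure with density \<open>w\<close>, and \<open>doubling\<close> is the integrated form of the
  \<open>A\<^sub>1\<close> condition \<open>\<langle>w\<rangle>\<^sub>Q \<le> K w\<close> a.e. on \<open>Q\<close>.\<close>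

locale dyadic_A1 =
  fixes D :: "(real ^ 'n) set set" and \<nu> :: "(real ^ 'n) measure" and K :: real
  assumes D: "dyadic_grid D" and sets_nu: "sets \<nu> = sets lebesgue" and K: "1 \<le> K"
    and doubling: "\<And>Q E. is_cube Q \<Longrightarrow> E \<in> sets lebesgue \<Longrightarrow> E \<subseteq> Q \<Longrightarrow>
      ennreal (measure lebesgue E) * emeasure \<nu> Q \<le> ennreal (K * measure lebesgue Q) * emeasure \<nu> E"
    and null: "\<And>E. E \<in> null_sets lebesgue \<Longrightarrow> emeasure \<nu> E = 0"
begin

definition \<theta> :: real where "\<theta> = 1 / (2 * 2 ^ CARD('n))"
text \<open>At least half of a cube carries at least the fraction \<open>1 / (2 * K)\<close> of its
  weight by \<open>doubling\<close>; \<open>\<gamma>\<close> bounds what is left for the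
  complement.\<close>

definition \<gamma> :: real where "\<gamma> = 1 - 1 / (2 * K)"

lemma \<theta>: "0 < \<theta>" "\<theta> < 1"
proof -
  have "(1::real) \<le> 2 ^ CARD('n)" by simp
  then have "(1::real) < 2 * 2 ^ CARD('n)" by linarith
  then show "0 < \<theta>" "\<theta> < 1" by (simp_all add: \<theta>_def)
qed

lemma \<gamma>: "0 < \<gamma>" "\<gamma> < 1"
  using K by (simp_all add: \<gamma>_def field_simps)

text \<open>\<open>doubling\<close> bounds the weight of subsets from below, so it is applied to the
  complement \<open>P - G\<close>, which fills at least half of \<open>P\<close>. Subtraction takes
  place in the reals, once an infinite weight of \<open>P\<close> has been dealt with.\<close>

lemma weight_half_cube:
  assumes P: "P \<in> D" and G: "G \<in> sets lebesgue"
    and half: "measure lebesgue (G \<inter> P) \<le> measure lebesgue P / 2"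
  shows "emeasure \<nu> (G \<inter> P) \<le> ennreal \<gamma> * emeasure \<nu> P"
proof -
  let ?p = "measure lebesgue P"
  have p: "0 < ?p" by (rule dyadic_grid_measure_pos[OF D P])
  have GP: "G \<inter> P \<in> sets lebesgue" "P - G \<in> sets lebesgue" using G dyadic_grid_sets[OF D P] by auto
  have split: "emeasure \<nu> P = emeasure \<nu> (G \<inter> P) + emeasure \<nu> (P - G)"
    using GP by (subst plus_emeasure) (auto simp: sets_nu intro!: arg_cong[of _ _ "emeasure \<nu>"])
  have "measure lebesgue (P - G) = ?p - measure lebesgue (G \<inter> P)"
  proof -
    have "P - G = P - (G \<inter> P)" by blast
    moreover have "measure lebesgue (P - (G \<inter> P)) = ?p - measure lebesgue (G \<inter> P)"
      using GP(1) dyadic_grid_lmeasurable[OF D P]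
      by (intro measurable_measure_Diff) (auto simp: fmeasurable_Int_fmeasurable)
    ultimately show ?thesis by simp
  qed
  then have "?p / 2 \<le> measure lebesgue (P - G)" using half by simp
  then have "ennreal (?p / 2) * emeasure \<nu> P \<le> ennreal (measure lebesgue (P - G)) * emeasure \<nu> P"
    by (intro mult_right_mono ennreal_leI) auto
  also have "\<dots> \<le> ennreal (K * ?p) * emeasure \<nu> (P - G)"
    using GP by (intro doubling dyadic_grid_is_cube[OF D P]) auto
  finally have le: "ennreal (?p / 2) * emeasure \<nu> P \<le> ennreal (K * ?p) * emeasure \<nu> (P - G)" .
  show ?thesis
  proof (cases "emeasure \<nu> P = \<infinity>")
    case True
    then show ?thesis using \<gamma> by (simp add: ennreal_mult_top)
  next
    case False
    then obtain a where a: "0 \<le> a" "emeasure \<nu> (G \<inter> P) = ennreal a"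
      using split by (cases "emeasure \<nu> (G \<inter> P)") auto
    obtain b where b: "0 \<le> b" "emeasure \<nu> (P - G) = ennreal b"
      using split False by (cases "emeasure \<nu> (P - G)") auto
    have ab: "emeasure \<nu> P = ennreal (a + b)" using a b split by simp
    have "ennreal (?p / 2 * (a + b)) \<le> ennreal (K * ?p * b)"
    proof -
      have "ennreal (?p / 2 * (a + b)) = ennreal (?p / 2) * emeasure \<nu> P"
        unfolding ab using p a b by (intro ennreal_mult) auto
      moreover have "ennreal (K * ?p * b) = ennreal (K * ?p) * emeasure \<nu> (P - G)"
        unfolding b(2) using p K b by (intro ennreal_mult) auto
      ultimately show ?thesis using le by simp
    qed
    then have "?p / 2 * (a + b) \<le> K * ?p * b" using p K b by (subst (asm) ennreal_le_iff) auto
    then have "?p * (a + b) \<le> ?p * (2 * K * b)" by (simp add: mult_ac)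
    then have "a + b \<le> 2 * K * b" using p by simp
    then have "a \<le> \<gamma> * (a + b)" using K by (simp add: \<gamma>_def field_simps)
    then have "ennreal a \<le> ennreal (\<gamma> * (a + b))" by (rule ennreal_leI)
    also have "\<dots> = ennreal \<gamma> * ennreal (a + b)"
      using \<gamma> a b by (intro ennreal_mult) auto
    finally show ?thesis using a ab by simp
  qed
qed

text \<open>The stopping cubes are the maximal cubes of density greater than \<open>\<theta>\<close>. Their parents have density at
  most \<open>\<theta> = 2\<^sup>-\<^sup>n\<^sup>-\<^sup>1\<close>, so the set fills at most half of each stopping cube.\<close>

lemma stopping_step:
  assumes Q: "Q \<in> D" and C: "finite \<C>" "\<C> \<subseteq> {P \<in> D. P \<subseteq> Q}"
    and small: "measure lebesgue (\<Union>\<C>) \<le> \<theta> * measure lebesgue Q"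
  obtains \<P> where "finite \<P>" "\<P> \<subseteq> {P \<in> D. P \<subseteq> Q}"
    "measure lebesgue (\<Union>\<P>) \<le> measure lebesgue (\<Union>\<C>) / \<theta>"
    "emeasure \<nu> (\<Union>\<C>) \<le> ennreal \<gamma> * emeasure \<nu> (\<Union>\<P>)"
proof -
  define G where "G = \<Union>\<C>"
  have Gl: "G \<in> lmeasurable" unfolding G_def using C dyadic_grid_lmeasurable[OF D]
    by (intro fmeasurable.finite_Union) auto
  have Gs: "G \<in> sets lebesgue" using Gl by blast
  have GI: "G \<inter> P \<in> lmeasurable" if "P \<in> D" for P
    using Gl dyadic_grid_sets[OF D that] by (rule fmeasurable_Int_fmeasurable)
  \<comment> \<open>The candidates for the stopping cube above \<open>C\<close>. The cube
    \<open>C\<close> is one of them, having density one, and there are finitely many, so a maximal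
    one exists.\<close>
  define A where "A C = {P \<in> D. C \<subseteq> P \<and> P \<subseteq> Q \<and> \<theta> * measure lebesgue P < measure lebesgue (G \<inter> P)}" for C
  have "\<exists>P\<in>A C. \<forall>R\<in>A C. P \<subseteq> R \<longrightarrow> P = R" if "C \<in> \<C>" for C
  proof -
    have CD: "C \<in> D" "C \<subseteq> Q" using C that by auto
    have "G \<inter> C = C" using that by (auto simp: G_def)
    then have "C \<in> A C" using CD dyadic_grid_measure_pos[OF D CD(1)] \<theta> by (simp add: A_def)
    moreover have "finite (A C)"
      using dyadic_grid_finite_between[OF D CD(1) Q] by (rule rev_finite_subset) (auto simp: A_def)
    ultimately show ?thesis using finite_has_maximal2[of "A C" C] by blast
  qed
  then obtain s where sA: "\<And>C. C \<in> \<C> \<Longrightarrow> s C \<in> A C"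
    and smax: "\<And>C R. C \<in> \<C> \<Longrightarrow> R \<in> A C \<Longrightarrow> s C \<subseteq> R \<Longrightarrow> s C = R" by metis
  define \<P> where "\<P> = s ` \<C>"
  have P: "P \<in> D" "P \<subseteq> Q" "\<theta> * measure lebesgue P < measure lebesgue (G \<inter> P)" if "P \<in> \<P>" for P
    using that sA by (auto simp: \<P>_def A_def)
  have GP: "G \<subseteq> \<Union>\<P>" using sA by (auto simp: G_def \<P>_def A_def)
  have disj: "disjoint \<P>"
  proof (rule disjointI)
    \<comment> \<open>If \<open>s C\<close> lies in \<open>s C'\<close>, the latter contains
      \<open>C\<close> as well and is a candidate for \<open>C\<close>, so maximality of
      \<open>s C\<close> forces equality.\<close>
    have *: "s C = s C'" if "C \<in> \<C>" "C' \<in> \<C>" "s C \<subseteq> s C'" for C C'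
      using smax[of C "s C'"] sA[OF that(1)] sA[OF that(2)] that by (auto simp: A_def)
    fix R R' assume R: "R \<in> \<P>" "R' \<in> \<P>" "R \<noteq> R'"
    show "R \<inter> R' = {}"
    proof (rule ccontr)
      assume "R \<inter> R' \<noteq> {}"
      then have "R \<subseteq> R' \<or> R' \<subseteq> R" using dyadic_grid_nested[OF D] P(1) R by blast
      then show False using * R by (auto simp: \<P>_def)
    qed
  qed
  have half: "measure lebesgue (G \<inter> P) \<le> measure lebesgue P / 2" if PP: "P \<in> \<P>" for P
  proof -
    obtain C where C: "C \<in> \<C>" "P = s C" using PP by (auto simp: \<P>_def)
    have "measure lebesgue (G \<inter> Q) \<le> measure lebesgue G"
      using Gl GI[OF Q] by (intro measure_mono_fmeasurable) auto
    \<comment> \<open>The density of \<open>G\<close> in \<open>Q\<close> itself is at most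
      \<open>\<theta>\<close>, so no stopping cube is \<open>Q\<close> and each has its parent
      inside \<open>Q\<close>.\<close>
    then have "P \<noteq> Q" using P(3)[OF PP] small by (auto simp: G_def)
    then have "P \<subset> Q" using P(2)[OF PP] by blast
    from dyadic_grid_parent[OF D P(1)[OF PP] Q this]
    obtain R where R: "R \<in> D" "P \<subseteq> R" "R \<subseteq> Q" "R \<noteq> P"
      "measure lebesgue R = 2 ^ CARD('n) * measure lebesgue P" .
    have "measure lebesgue (G \<inter> P) \<le> measure lebesgue (G \<inter> R)"
      using GI[OF P(1)[OF PP]] GI[OF R(1)] R(2) by (intro measure_mono_fmeasurable) auto
    moreover have "R \<notin> A C" using smax[OF C(1), of R] R C by blast
    moreover have "C \<subseteq> R" using sA[OF C(1)] R C by (auto simp: A_def)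
    ultimately have "measure lebesgue (G \<inter> P) \<le> \<theta> * measure lebesgue R"
      using R by (auto simp: A_def)
    also have "\<dots> = measure lebesgue P / 2" by (simp add: R(5) \<theta>_def)
    finally show ?thesis .
  qed
  have fin: "finite \<P>" using C by (simp add: \<P>_def)
  have meas: "measure lebesgue (\<Union>\<P>) \<le> measure lebesgue G / \<theta>"
  proof -
    have "\<theta> * measure lebesgue (\<Union>\<P>) = (\<Sum>P\<in>\<P>. \<theta> * measure lebesgue P)"
      using fin disj P(1) dyadic_grid_lmeasurable[OF D]
      by (subst measure_Union') (auto simp: sum_distrib_left disjoint_def pairwise_def disjnt_def)
    also have "\<dots> \<le> (\<Sum>P\<in>\<P>. measure lebesgue (G \<inter> P))"
      using P(3) by (intro sum_mono less_imp_le) auto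
    also have "\<dots> = measure lebesgue (\<Union>P\<in>\<P>. G \<inter> P)"
      using fin disj P(1) GI
      by (intro measure_UNION'[symmetric]) (auto simp: disjoint_def pairwise_def disjnt_def)
    also have "(\<Union>P\<in>\<P>. G \<inter> P) = G" using GP by blast
    finally show ?thesis using \<theta> by (simp add: field_simps)
  qed
  have "emeasure \<nu> G \<le> ennreal \<gamma> * emeasure \<nu> (\<Union>\<P>)"
  proof -
    have "emeasure \<nu> G = emeasure \<nu> (\<Union>P\<in>\<P>. G \<inter> P)" using GP by (metis Int_absorb2 Int_Union)
    also have "\<dots> = (\<Sum>P\<in>\<P>. emeasure \<nu> (G \<inter> P))"
      using fin disj P(1) GI
      by (intro sum_emeasure[symmetric])
        (auto simp: disjoint_def disjoint_family_on_def sets_nu)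
    also have "\<dots> \<le> (\<Sum>P\<in>\<P>. ennreal \<gamma> * emeasure \<nu> P)"
      using half P(1) Gs by (intro sum_mono weight_half_cube) auto
    also have "\<dots> = ennreal \<gamma> * (\<Sum>P\<in>\<P>. emeasure \<nu> P)" by (simp add: sum_distrib_left)
    also have "(\<Sum>P\<in>\<P>. emeasure \<nu> P) = emeasure \<nu> (\<Union>P\<in>\<P>. P)"
      using fin disj P(1) dyadic_grid_sets[OF D]
      by (intro sum_emeasure) (auto simp: disjoint_def disjoint_family_on_def sets_nu)
    finally show ?thesis by simp
  qed
  then show ?thesis using that[of \<P>] fin meas P by (auto simp: G_def)
qed

text \<open>Each stopping step enlarges the measure by at most \<open>1 / \<theta>\<close> and gains
  a factor \<open>\<gamma>\<close> in weight. A relative measure of \<open>\<theta> ^ m\<close>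
  therefore allows \<open>m\<close> steps before the union can fill \<open>Q\<close>.\<close>

lemma decay_finite_union:
  assumes Q: "Q \<in> D" and C: "finite \<C>" "\<C> \<subseteq> {P \<in> D. P \<subseteq> Q}"
    and small: "measure lebesgue (\<Union>\<C>) \<le> \<theta> ^ m * measure lebesgue Q"
  shows "emeasure \<nu> (\<Union>\<C>) \<le> ennreal (\<gamma> ^ m) * emeasure \<nu> Q"
  using C small
proof (induction m arbitrary: \<C>)
  case 0
  then have "emeasure \<nu> (\<Union>\<C>) \<le> emeasure \<nu> Q"
    using dyadic_grid_sets[OF D Q] by (intro emeasure_mono) (auto simp: sets_nu)
  then show ?case by simp
next
  case (Suc m)
  have "\<theta> ^ Suc m \<le> \<theta>" using \<theta> by (simp add: mult_left_le power_le_one)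
  then have "\<theta> ^ Suc m * measure lebesgue Q \<le> \<theta> * measure lebesgue Q"
    by (intro mult_right_mono) auto
  with Suc.prems(3) have "measure lebesgue (\<Union>\<C>) \<le> \<theta> * measure lebesgue Q" by linarith
  then obtain \<P> where P: "finite \<P>" "\<P> \<subseteq> {P \<in> D. P \<subseteq> Q}"
    "measure lebesgue (\<Union>\<P>) \<le> measure lebesgue (\<Union>\<C>) / \<theta>"
    "emeasure \<nu> (\<Union>\<C>) \<le> ennreal \<gamma> * emeasure \<nu> (\<Union>\<P>)"
    using stopping_step[OF Q Suc.prems(1,2)] by blast
  have "measure lebesgue (\<Union>\<C>) / \<theta> \<le> \<theta> ^ m * measure lebesgue Q"
    using Suc.prems(3) \<theta> by (simp add: field_simps)
  then have "emeasure \<nu> (\<Union>\<P>) \<le> ennreal (\<gamma> ^ m) * emeasure \<nu> Q"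
    using P(3) by (intro Suc.IH P) linarith
  then have "ennreal \<gamma> * emeasure \<nu> (\<Union>\<P>) \<le> ennreal \<gamma> * (ennreal (\<gamma> ^ m) * emeasure \<nu> Q)"
    by (intro mult_left_mono) auto
  with P(4) show ?case using \<gamma> by (simp add: ennreal_mult mult.assoc)
qed

text \<open>The trace of an open set on \<open>Q\<close> is a countable union of dyadic subcubes,
  which finite unions exhaust from below. No constant is lost in the limit.\<close>

lemma decay_open:
  assumes Q: "Q \<in> D" and U: "open U"
    and small: "measure lebesgue (U \<inter> Q) \<le> \<theta> ^ m * measure lebesgue Q"
  shows "emeasure \<nu> (U \<inter> Q) \<le> ennreal (\<gamma> ^ m) * emeasure \<nu> Q"
proof -
  define \<U> where "\<U> = {P \<in> D. P \<subseteq> U \<inter> Q}"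
  have UQ: "\<Union>\<U> = U \<inter> Q"
  proof
    show "U \<inter> Q \<subseteq> \<Union>\<U>"
    proof
      fix x assume "x \<in> U \<inter> Q"
      then obtain P where "P \<in> D" "x \<in> P" "P \<subseteq> Q" "P \<subseteq> U"
        using dyadic_grid_small_cube[OF D Q _ U] by blast
      then show "x \<in> \<Union>\<U>" by (auto simp: \<U>_def)
    qed
  qed (auto simp: \<U>_def)
  show ?thesis
  proof (cases "\<U> = {}")
    case True
    then show ?thesis using UQ by simp
  next
    case False
    have cnt: "countable \<U>"
      using dyadic_grid_countable[OF D] by (rule countable_subset[rotated]) (auto simp: \<U>_def)
    define F where "F k = from_nat_into \<U> ` {..<k}" for k :: nat
    have F: "finite (F k)" "F k \<subseteq> \<U>" for k
      using from_nat_into[OF False] by (auto simp: F_def)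
    have Fs: "\<Union>(F k) \<in> sets lebesgue" for k
      using F[of k] dyadic_grid_sets[OF D] by (intro sets.finite_Union) (auto simp: \<U>_def)
    have "(\<Union>k. \<Union>(F k)) = \<Union>(range (from_nat_into \<U>))" by (auto simp: F_def)
    then have eq: "(\<Union>k. \<Union>(F k)) = U \<inter> Q"
      using range_from_nat_into[OF False cnt] UQ by simp
    have "emeasure \<nu> (\<Union>k. \<Union>(F k)) = (SUP k. emeasure \<nu> (\<Union>(F k)))"
    proof (rule SUP_emeasure_incseq[symmetric])
      show "range (\<lambda>k. \<Union>(F k)) \<subseteq> sets \<nu>" using Fs by (auto simp: sets_nu)
      show "incseq (\<lambda>k. \<Union>(F k))"
        by (intro monoI Union_mono) (auto simp: F_def)
    qed
    also have "\<dots> \<le> ennreal (\<gamma> ^ m) * emeasure \<nu> Q"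
    proof (rule SUP_least)
      fix k
      have "measure lebesgue (\<Union>(F k)) \<le> measure lebesgue (U \<inter> Q)"
        using Fs F[of k] UQ U dyadic_grid_lmeasurable[OF D Q]
        by (intro measure_mono_fmeasurable) (auto intro: fmeasurable_Int_fmeasurable simp: Int_commute)
      with small show "emeasure \<nu> (\<Union>(F k)) \<le> ennreal (\<gamma> ^ m) * emeasure \<nu> Q"
        using F[of k] by (intro decay_finite_union[OF Q]) (auto simp: \<U>_def)
    qed
    finally show ?thesis by (simp only: eq)
  qed
qed

text \<open>Outer regularity replaces \<open>G\<close> by an open superset; the strict inequality
  provides the slack \<open>e\<close> for the excess measure.\<close>

lemma decay_measurable:
  assumes Q: "Q \<in> D" and G: "G \<in> sets lebesgue" "G \<subseteq> Q"
    and small: "measure lebesgue G < \<theta> ^ m * measure lebesgue Q"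
  shows "emeasure \<nu> G \<le> ennreal (\<gamma> ^ m) * emeasure \<nu> Q"
proof -
  have Gl: "G \<in> lmeasurable" using G dyadic_grid_lmeasurable[OF D Q] fmeasurableI2 by blast
  define e where "e = \<theta> ^ m * measure lebesgue Q - measure lebesgue G"
  have "0 < e" using small by (simp add: e_def)
  then obtain U where U: "open U" "G \<subseteq> U" "U - G \<in> lmeasurable"
    "emeasure lebesgue (U - G) < ennreal e"
    using sets_lebesgue_outer_open[OF G(1)] by metis
  have "measure lebesgue (U - G) < e"
    using U(3,4) \<open>0 < e\<close> by (simp add: emeasure_eq_measure2 ennreal_less_iff)
  have U': "U \<in> lmeasurable"
  proof -
    have "U = G \<union> (U - G)" using U(2) by blast
    then show ?thesis using Gl U(3) by (metis fmeasurable.Un)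
  qed
  have "measure lebesgue (U \<inter> Q) \<le> measure lebesgue (G \<union> (U - G))"
    using U' U dyadic_grid_sets[OF D Q] by (intro measure_mono_fmeasurable) (auto simp: Un_absorb1)
  also have "\<dots> \<le> measure lebesgue G + measure lebesgue (U - G)"
    using Gl U by (intro measure_Un_le) auto
  finally have "measure lebesgue (U \<inter> Q) \<le> \<theta> ^ m * measure lebesgue Q"
    using \<open>measure lebesgue (U - G) < e\<close> by (simp add: e_def)
  then have "emeasure \<nu> (U \<inter> Q) \<le> ennreal (\<gamma> ^ m) * emeasure \<nu> Q" by (rule decay_open[OF Q U(1)])
  moreover have "emeasure \<nu> G \<le> emeasure \<nu> (U \<inter> Q)"
    using U U' G dyadic_grid_sets[OF D Q] by (intro emeasure_mono) (auto simp: sets_nu)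
  ultimately show ?thesis by (rule order_trans[rotated])
qed

text \<open>With relative measure \<open>t\<close> between \<open>\<theta> ^ Suc m\<close> and
  \<open>\<theta> ^ m\<close>, the weight decays like \<open>\<gamma> ^ m\<close>, and
  \<open>\<gamma>\<close> is \<open>\<theta>\<close> to the power
  \<open>log \<theta> \<gamma>\<close>. The one missing power of \<open>\<gamma>\<close> becomes the
  constant \<open>1 / \<gamma>\<close>.\<close>

lemma decay_power:
  assumes Q: "Q \<in> D" and G: "G \<in> sets lebesgue" "G \<subseteq> Q"
  shows "emeasure \<nu> G \<le>
    ennreal (1 / \<gamma> * (measure lebesgue G / measure lebesgue Q) powr log \<theta> \<gamma>) * emeasure \<nu> Q"
proof -
  let ?q = "measure lebesgue Q"
  define t where "t = measure lebesgue G / ?q"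
  have q: "0 < ?q" by (rule dyadic_grid_measure_pos[OF D Q])
  have Gl: "G \<in> lmeasurable" using G dyadic_grid_lmeasurable[OF D Q] fmeasurableI2 by blast
  have "measure lebesgue G \<le> ?q"
    using G dyadic_grid_lmeasurable[OF D Q] by (intro measure_mono_fmeasurable) auto
  then have t: "0 \<le> t" "t \<le> 1" using q by (auto simp: t_def)
  \<comment> \<open>For \<open>t = 0\<close> no such \<open>m\<close> exists, and
    \<open>null\<close> is used instead; for \<open>t = 1\<close> the strict bound
    \<open>t < \<theta> ^ m\<close> fails already for \<open>m = 0\<close>, but the claim is
    trivial.\<close>
  consider "t = 0" | "t = 1" | "0 < t" "t < 1" using t by linarith
  then have "emeasure \<nu> G \<le> ennreal (1 / \<gamma> * t powr log \<theta> \<gamma>) * emeasure \<nu> Q"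
  proof cases
    case 1
    then have "measure lebesgue G = 0" using q by (simp add: t_def)
    then have "G \<in> null_sets lebesgue" using Gl G
      by (intro null_setsI) (auto simp: emeasure_eq_measure2)
    then show ?thesis by (simp add: null)
  next
    case 2
    have "emeasure \<nu> G \<le> 1 * emeasure \<nu> Q"
      using G dyadic_grid_sets[OF D Q] by (auto intro!: emeasure_mono simp: sets_nu)
    also have "\<dots> \<le> ennreal (1 / \<gamma>) * emeasure \<nu> Q"
      using \<gamma> by (intro mult_right_mono) (auto simp: ennreal_1[symmetric] simp del: ennreal_1 intro!: ennreal_leI)
    finally show ?thesis using 2 by simp
  next
    case 3
    define m where "m = (LEAST j. \<theta> ^ Suc j \<le> t)"
    obtain j where "\<theta> ^ j < t" using real_arch_pow_inv[OF 3(1) \<theta>(2)] by blast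
    moreover have "\<theta> ^ Suc j \<le> \<theta> ^ j" using \<theta> by (intro power_decreasing) auto
    ultimately have "\<theta> ^ Suc j \<le> t" by linarith
    then have m1: "\<theta> ^ Suc m \<le> t" unfolding m_def by (rule LeastI)
    have m2: "t < \<theta> ^ m"
    proof (cases m)
      case 0
      then show ?thesis using 3 by simp
    next
      case (Suc i)
      then have "\<not> \<theta> ^ Suc i \<le> t" using not_less_Least[of i "\<lambda>j. \<theta> ^ Suc j \<le> t"] by (simp add: m_def)
      then show ?thesis using Suc by simp
    qed
    have "measure lebesgue G < \<theta> ^ m * ?q" using m2 q by (simp add: t_def field_simps)
    then have le: "emeasure \<nu> G \<le> ennreal (\<gamma> ^ m) * emeasure \<nu> Q" by (rule decay_measurable[OF Q G])
    have \<delta>: "0 \<le> log \<theta> \<gamma>" using \<theta> \<gamma> by (simp add: log_def divide_nonpos_neg)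
    have "\<gamma> ^ Suc m = (\<theta> powr log \<theta> \<gamma>) ^ Suc m"
      using \<theta> \<gamma> by (subst powr_log_cancel) auto
    also have "\<dots> = (\<theta> ^ Suc m) powr log \<theta> \<gamma>"
      using \<theta> by (simp add: powr_realpow[symmetric] powr_powr mult.commute del: power_Suc)
    also have "\<dots> \<le> t powr log \<theta> \<gamma>" using m1 \<theta> \<delta> by (intro powr_mono2) auto
    finally have "\<gamma> ^ m \<le> 1 / \<gamma> * t powr log \<theta> \<gamma>" using \<gamma> by (simp add: field_simps)
    then have "ennreal (\<gamma> ^ m) * emeasure \<nu> Q \<le> ennreal (1 / \<gamma> * t powr log \<theta> \<gamma>) * emeasure \<nu> Q"
      by (intro mult_right_mono ennreal_leI) auto
    with le show ?thesis by (rule order_trans)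
  qed
  then show ?thesis by (simp add: t_def)
qed

end

section \<open>Maximal operator and majorants\<close>

lemma ennreal_divide_pos_real: "0 < r \<Longrightarrow> x / ennreal r = ennreal (1 / r) * x"
  by (simp add: divide_ennreal_def inverse_ennreal inverse_eq_divide mult.commute)

lemma average_eq:
  assumes "is_cube Q"
  shows "x / emeasure lebesgue Q = ennreal (1 / measure lebesgue Q) * x"
  unfolding is_cube_emeasure[OF assms]
  by (rule ennreal_divide_pos_real[OF is_cube_measure_pos[OF assms]])

lemma maximal_op_ge_average:
  assumes "is_cube Q" "x \<in> Q"
  shows "ennreal (1 / measure lebesgue Q) * (\<integral>\<^sup>+y\<in>Q. ennreal \<bar>f y\<bar> \<partial>lebesgue) \<le> maximal_op f x"
proof -
  have "(\<integral>\<^sup>+y\<in>Q. ennreal \<bar>f y\<bar> \<partial>lebesgue) / emeasure lebesgue Q \<le> maximal_op f x"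
    unfolding maximal_op_def using assms by (intro SUP_upper) auto
  then show ?thesis by (simp only: average_eq[OF assms(1)])
qed

lemma less_maximal_op_iff:
  "t < maximal_op f x \<longleftrightarrow> (\<exists>Q. is_cube Q \<and> x \<in> Q \<and>
    t < ennreal (1 / measure lebesgue Q) * (\<integral>\<^sup>+y\<in>Q. ennreal \<bar>f y\<bar> \<partial>lebesgue))"
proof -
  have "t < maximal_op f x \<longleftrightarrow> (\<exists>Q. is_cube Q \<and> x \<in> Q \<and>
    t < (\<integral>\<^sup>+y\<in>Q. ennreal \<bar>f y\<bar> \<partial>lebesgue) / emeasure lebesgue Q)"
    unfolding maximal_op_def less_SUP_iff by auto
  also have "\<dots> \<longleftrightarrow> (\<exists>Q. is_cube Q \<and> x \<in> Q \<and>
    t < ennreal (1 / measure lebesgue Q) * (\<integral>\<^sup>+y\<in>Q. ennreal \<bar>f y\<bar> \<partial>lebesgue))"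
    by (intro ex_cong1) (auto simp: average_eq)
  finally show ?thesis .
qed

text \<open>A half-open cube is not a neighbourhood of its points. Enlarging \<open>Q\<close> by a
  small \<open>e\<close> on every side gives a cube \<open>R\<close> whose average still exceeds
  \<open>t\<close>, and the open box inside \<open>R\<close> contains \<open>Q\<close>.
  Measurability of the maximal function follows.\<close>

lemma maximal_op_lower_semicontinuous:
  fixes f :: "real ^ 'n \<Rightarrow> real"
  shows "open {x. t < maximal_op f x}"
proof (subst open_subopen, intro ballI)
  fix x assume "x \<in> {x. t < maximal_op f x}"
  then obtain Q where Q: "is_cube Q" "x \<in> Q"
    "t < ennreal (1 / measure lebesgue Q) * (\<integral>\<^sup>+y\<in>Q. ennreal \<bar>f y\<bar> \<partial>lebesgue)"
    by (auto simp: less_maximal_op_iff)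
  then obtain a l where al: "0 < l" "Q = cube a l" by (auto simp: is_cube_def cube_of_side_iff)
  define I where "I = (\<integral>\<^sup>+y\<in>Q. ennreal \<bar>f y\<bar> \<partial>lebesgue)"
  have tI: "t < ennreal (1 / l ^ CARD('n)) * I"
    using Q(3) al by (simp add: I_def measure_cube)
  \<comment> \<open>If \<open>I\<close> is infinite any enlargement works; otherwise the normalising
    factor is continuous in \<open>e\<close> at zero.\<close>
  have "\<exists>e>0. t < ennreal (1 / (l + 2 * e) ^ CARD('n)) * I"
  proof (cases I)
    case top
    have "t < top" using tI by (rule less_le_trans) simp
    then show ?thesis using al top by (intro exI[of _ 1]) (auto simp: ennreal_mult_top)
  next
    case (real r)
    have lim: "((\<lambda>e. ennreal (1 / (l + 2 * e) ^ CARD('n) * r)) \<longlongrightarrow> ennreal (1 / (l + 2 * 0) ^ CARD('n) * r)) (at_right 0)"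
      using al by (intro tendsto_intros) auto
    have mult: "ennreal (1 / s ^ CARD('n)) * I = ennreal (1 / s ^ CARD('n) * r)" if "0 < s" for s
      using that real by (simp only: ennreal_mult zero_le_divide_1_iff zero_le_power less_imp_le)
    have "\<forall>\<^sub>F e in at_right 0. t < ennreal (1 / (l + 2 * e) ^ CARD('n) * r)"
      using tI al by (intro order_tendstoD(1)[OF lim]) (simp only: mult mult_zero_right add_0_right)
    moreover have "\<forall>\<^sub>F e in at_right 0. (0::real) < e" by (rule eventually_at_right_less)
    ultimately have "\<forall>\<^sub>F e in at_right 0. 0 < e \<and> t < ennreal (1 / (l + 2 * e) ^ CARD('n) * r)"
      by eventually_elim simp
    from eventually_happens'[OF _ this]
    obtain e where e: "0 < e" "t < ennreal (1 / (l + 2 * e) ^ CARD('n) * r)" by auto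
    then show ?thesis using mult[of "l + 2 * e"] al by auto
  qed
  then obtain e where e: "0 < e" "t < ennreal (1 / (l + 2 * e) ^ CARD('n)) * I" by blast
  define b where "b = a - (\<chi> i. e)"
  define R where "R = cube b (l + 2 * e)"
  define U where "U = box b (b + (\<chi> i. l + 2 * e))"
  have R: "is_cube R" using al e by (auto simp: is_cube_def cube_of_side_iff R_def intro!: exI[of _ "l + 2 * e"])
  have UR: "U \<subseteq> R" by (auto simp: U_def R_def cube_def mem_box_cart less_imp_le)
  have QU: "Q \<subseteq> U"
  proof
    fix y assume "y \<in> Q"
    then have "a $ i \<le> y $ i \<and> y $ i < a $ i + l" for i unfolding al(2) cube_def by blast
    then have "a $ i - e < y $ i \<and> y $ i < a $ i - e + (l + 2 * e)" for i
      using e(1) by (smt (verit))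
    then show "y \<in> U" by (simp add: U_def b_def mem_box_cart)
  qed
  have "I \<le> (\<integral>\<^sup>+y\<in>R. ennreal \<bar>f y\<bar> \<partial>lebesgue)"
    unfolding I_def using QU UR by (intro nn_integral_mono mult_left_mono) (auto simp: indicator_def)
  then have "t < ennreal (1 / (l + 2 * e) ^ CARD('n)) * (\<integral>\<^sup>+y\<in>R. ennreal \<bar>f y\<bar> \<partial>lebesgue)"
    using e(2) by (meson less_le_trans mult_left_mono zero_le)
  then have tR: "t < ennreal (1 / measure lebesgue R) * (\<integral>\<^sup>+y\<in>R. ennreal \<bar>f y\<bar> \<partial>lebesgue)"
    using al e by (simp add: R_def measure_cube)
  have "U \<subseteq> {x. t < maximal_op f x}"
    using less_le_trans[OF tR maximal_op_ge_average[OF R]] UR by auto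
  then show "\<exists>T. open T \<and> x \<in> T \<and> T \<subseteq> {x. t < maximal_op f x}"
    using QU Q(2) by (intro exI[of _ U]) (auto simp: U_def open_box)
qed

lemma borel_measurable_maximal_op: "maximal_op f \<in> borel_measurable lebesgue"
proof (rule borel_measurableI_greater)
  fix t :: ennreal
  have "{x. t < maximal_op f x} \<in> sets borel"
    by (rule borel_open[OF maximal_op_lower_semicontinuous])
  then show "{x \<in> space lebesgue. t < maximal_op f x} \<in> sets lebesgue"
    by (simp add: sets_completionI_sets)
qed

section \<open>Finite combinations of indicators\<close>

lemma borel_measurable_sum_indicator:
  fixes \<alpha> :: "'b \<Rightarrow> real"
  assumes "\<And>Q. Q \<in> S \<Longrightarrow> A Q \<in> sets M"
  shows "(\<lambda>x. \<Sum>Q\<in>S. \<alpha> Q * indicator (A Q) x) \<in> borel_measurable M"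
  using assms
  by (intro borel_measurable_sum borel_measurable_times borel_measurable_const borel_measurable_indicator)

lemma ennreal_sum_indicator:
  assumes "\<And>Q. Q \<in> S \<Longrightarrow> 0 \<le> \<alpha> Q"
  shows "ennreal (\<Sum>Q\<in>S. \<alpha> Q * indicator (A Q) x) = (\<Sum>Q\<in>S. ennreal (\<alpha> Q) * indicator (A Q) x)"
proof -
  have "ennreal (\<Sum>Q\<in>S. \<alpha> Q * indicator (A Q) x) = (\<Sum>Q\<in>S. ennreal (\<alpha> Q * indicator (A Q) x))"
    using assms by (intro sum_ennreal[symmetric]) (auto simp: indicator_def)
  then show ?thesis by (auto simp: indicator_def intro!: sum.cong)
qed

lemma nn_integral_sum_indicator:
  assumes "finite S" "\<And>Q. Q \<in> S \<Longrightarrow> 0 \<le> \<alpha> Q" "\<And>Q. Q \<in> S \<Longrightarrow> A Q \<in> sets M" "w \<in> borel_measurable M"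
  shows "(\<integral>\<^sup>+x. ennreal (\<Sum>Q\<in>S. \<alpha> Q * indicator (A Q) x) * w x \<partial>M)
    = (\<Sum>Q\<in>S. ennreal (\<alpha> Q) * (\<integral>\<^sup>+x\<in>A Q. w x \<partial>M))"
proof -
  have "ennreal (\<Sum>Q\<in>S. \<alpha> Q * indicator (A Q) x) * w x
    = (\<Sum>Q\<in>S. ennreal (\<alpha> Q) * (w x * indicator (A Q) x))" for x
  proof -
    have "ennreal (\<Sum>Q\<in>S. \<alpha> Q * indicator (A Q) x) = (\<Sum>Q\<in>S. ennreal (\<alpha> Q) * indicator (A Q) x)"
      using assms(2) by (rule ennreal_sum_indicator)
    then show ?thesis
      by (simp add: sum_distrib_left sum_distrib_right mult_ac)
  qed
  then have "(\<integral>\<^sup>+x. ennreal (\<Sum>Q\<in>S. \<alpha> Q * indicator (A Q) x) * w x \<partial>M)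
    = (\<integral>\<^sup>+x. (\<Sum>Q\<in>S. ennreal (\<alpha> Q) * (w x * indicator (A Q) x)) \<partial>M)"
    by simp
  also have "\<dots> = (\<Sum>Q\<in>S. (\<integral>\<^sup>+x. ennreal (\<alpha> Q) * (w x * indicator (A Q) x) \<partial>M))"
    using assms by (intro nn_integral_sum) auto
  also have "\<dots> = (\<Sum>Q\<in>S. ennreal (\<alpha> Q) * (\<integral>\<^sup>+x\<in>A Q. w x \<partial>M))"
    using assms by (intro sum.cong nn_integral_cmult) auto
  finally show ?thesis .
qed

lemma bfn_sum_indicator_finite:
  assumes bfn: "banach_function_norm \<rho>" and "finite S" "\<And>Q. Q \<in> S \<Longrightarrow> 0 \<le> \<alpha> Q"
    "\<And>Q. Q \<in> S \<Longrightarrow> A Q \<in> sets lebesgue" "\<And>Q. Q \<in> S \<Longrightarrow> bounded (A Q)"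
  shows "\<rho> (\<lambda>x. ennreal (\<Sum>Q\<in>S. \<alpha> Q * indicator (A Q) x)) < \<infinity>"
proof -
  have eq: "ennreal (\<Sum>Q\<in>S. \<alpha> Q * indicator (A Q) x) = (\<Sum>Q\<in>S. ennreal (\<alpha> Q) * indicator (A Q) x)" for x
    using assms(3) by (rule ennreal_sum_indicator)
  have "\<rho> (\<lambda>x. \<Sum>Q\<in>S. ennreal (\<alpha> Q) * indicator (A Q) x) \<le> (\<Sum>Q\<in>S. \<rho> (\<lambda>x. ennreal (\<alpha> Q) * indicator (A Q) x))"
    using assms by (intro bfn_sum[OF bfn]) auto
  also have "\<dots> = (\<Sum>Q\<in>S. ennreal (\<alpha> Q) * \<rho> (indicator (A Q)))"
    using assms by (intro sum.cong bfn_scale[OF bfn]) auto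
  also have "\<dots> < \<infinity>"
    using assms bfn_indicator_finite[OF bfn] by (auto simp: ennreal_mult_less_top)
  finally show ?thesis by (simp only: eq)
qed

text \<open>The Rubio de Francia algorithm \<open>w = \<Sum>\<^sub>k (2C)\<^sup>-\<^sup>k M\<^sup>k h\<close>.\<close>

lemma A1_majorant_exists:
  fixes \<rho> :: "(real ^ 'n \<Rightarrow> ennreal) \<Rightarrow> ennreal" and h :: "real ^ 'n \<Rightarrow> real"
  assumes bfn: "banach_function_norm \<rho>" and C: "0 < C"
    and M: "\<And>f. f \<in> bfs (associate_norm \<rho>) \<Longrightarrow>
      associate_norm \<rho> (maximal_op f) \<le> ennreal C * bfs_norm (associate_norm \<rho>) f"
    and hm: "h \<in> borel_measurable lebesgue" and h0: "\<And>x. 0 \<le> h x"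
    and hn: "associate_norm \<rho> (\<lambda>x. ennreal (h x)) \<le> 1"
  obtains w where "w \<in> borel_measurable lebesgue" "\<forall>x. ennreal (h x) \<le> w x"
    "associate_norm \<rho> w \<le> 2"
    "\<forall>Q E. is_cube Q \<longrightarrow> E \<in> sets lebesgue \<longrightarrow> E \<subseteq> Q \<longrightarrow>
      ennreal (measure lebesgue E) * (\<integral>\<^sup>+x\<in>Q. w x \<partial>lebesgue)
        \<le> ennreal (2 * C * measure lebesgue Q) * (\<integral>\<^sup>+x\<in>E. w x \<partial>lebesgue)"
proof -
  let ?N = "associate_norm \<rho>"
  \<comment> \<open>The operator acts on real-valued functions, so every iterate passes through
    \<open>enn2real\<close>, which sends infinity to zero. The norm bounds below show that this
    happens only on a null set.\<close>
  define H where "H k = ((\<lambda>f x. enn2real (maximal_op f x)) ^^ k) h" for k :: nat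
  have H0: "H 0 = h" and HS: "H (Suc k) = (\<lambda>x. enn2real (maximal_op (H k) x))" for k
    by (simp_all add: H_def)
  have Hpos: "0 \<le> H k x" for k x using h0 by (cases k) (auto simp: H0 HS)
  have Hm: "H k \<in> borel_measurable lebesgue" for k
    by (cases k) (simp_all only: H0 HS hm borel_measurable_enn2real borel_measurable_maximal_op)
  have Hn: "?N (\<lambda>x. ennreal (H k x)) \<le> ennreal (C ^ k)" 
    and Mn: "?N (maximal_op (H k)) \<le> ennreal (C ^ Suc k)" for k
  proof -
    have step: "?N (maximal_op (H k)) \<le> ennreal (C ^ Suc k)"
      if le: "?N (\<lambda>x. ennreal (H k x)) \<le> ennreal (C ^ k)" for k
    proof -
      have eq: "bfs_norm ?N (H k) = ?N (\<lambda>x. ennreal (H k x))"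
        using Hpos by (simp add: bfs_norm_def)
      have "H k \<in> bfs ?N" using Hm le eq by (auto simp: bfs_def intro: le_less_trans)
      then have "?N (maximal_op (H k)) \<le> ennreal C * ?N (\<lambda>x. ennreal (H k x))" using M eq by metis
      also have "\<dots> \<le> ennreal C * ennreal (C ^ k)" using le by (intro mult_left_mono) auto
      finally show ?thesis using C by (simp flip: ennreal_mult)
    qed
    show H: "?N (\<lambda>x. ennreal (H k x)) \<le> ennreal (C ^ k)"
    proof (induction k)
      case 0
      then show ?case using hn by (simp add: H0)
    next
      case (Suc k)
      have "?N (\<lambda>x. ennreal (H (Suc k) x)) \<le> ?N (maximal_op (H k))"
        by (intro associate_norm_mono) (simp add: HS ennreal_enn2real_if)
      with step[OF Suc] show ?case by (rule order_trans[rotated])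
    qed
    show "?N (maximal_op (H k)) \<le> ennreal (C ^ Suc k)" by (rule step[OF H])
  qed
  have "AE x in lebesgue. maximal_op (H k) x \<noteq> \<infinity>" for k
    using le_less_trans[OF Mn[of k]]
    by (intro associate_norm_finite_AE[OF bfn] borel_measurable_maximal_op) auto
  then have AE: "AE x in lebesgue. \<forall>k. ennreal (H (Suc k) x) = maximal_op (H k) x"
    unfolding AE_all_countable by (simp add: HS ennreal_enn2real_if top.not_eq_extremum)
  \<comment> \<open>The \<open>k\<close>-th iterate has norm at most \<open>C ^ k\<close>, so this
    ratio leaves the geometric series with sum two.\<close>
  define r where "r = 1 / (2 * C)"
  have r: "0 < r" using C by (simp add: r_def)
  define w where "w x = (\<Sum>k. ennreal (r ^ k) * ennreal (H k x))" for x
  have wm: "w \<in> borel_measurable lebesgue"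
    unfolding w_def[abs_def] using Hm by measurable
  have hw: "ennreal (h x) \<le> w x" for x
  proof -
    have "(\<Sum>k\<in>{0}. ennreal (r ^ k) * ennreal (H k x)) \<le> w x"
      unfolding w_def by (intro sum_le_suminf) auto
    then show ?thesis by (simp add: H0)
  qed
  have int_w: "(\<integral>\<^sup>+x. w x * u x \<partial>lebesgue) = (\<Sum>k. ennreal (r ^ k) * (\<integral>\<^sup>+x. ennreal (H k x) * u x \<partial>lebesgue))"
    if "u \<in> borel_measurable lebesgue" for u
  proof -
    have "(\<integral>\<^sup>+x. w x * u x \<partial>lebesgue) = (\<integral>\<^sup>+x. (\<Sum>k. ennreal (r ^ k) * (ennreal (H k x) * u x)) \<partial>lebesgue)"
      by (simp add: w_def mult.assoc flip: ennreal_suminf_multc)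
    also have "\<dots> = (\<Sum>k. (\<integral>\<^sup>+x. ennreal (r ^ k) * (ennreal (H k x) * u x) \<partial>lebesgue))"
      using Hm that by (intro nn_integral_suminf) auto
    also have "\<dots> = (\<Sum>k. ennreal (r ^ k) * (\<integral>\<^sup>+x. ennreal (H k x) * u x \<partial>lebesgue))"
      using Hm that by (intro suminf_cong nn_integral_cmult) auto
    finally show ?thesis .
  qed
  have wn: "?N w \<le> 2"
  proof (rule associate_norm_leI)
    fix g :: "real ^ 'n \<Rightarrow> real"
    assume g: "g \<in> borel_measurable lebesgue" "\<And>x. 0 \<le> g x" "\<rho> (\<lambda>x. ennreal (g x)) \<le> 1"
    have "(\<integral>\<^sup>+x. w x * ennreal (g x) \<partial>lebesgue)
      = (\<Sum>k. ennreal (r ^ k) * (\<integral>\<^sup>+x. ennreal (H k x) * ennreal (g x) \<partial>lebesgue))"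
      using g by (intro int_w) auto
    also have "\<dots> \<le> (\<Sum>k. ennreal ((1/2) ^ k))"
    proof (intro suminf_le allI)
      fix k
      have "(\<integral>\<^sup>+x. ennreal (H k x) * ennreal (g x) \<partial>lebesgue) \<le> ?N (\<lambda>x. ennreal (H k x)) * \<rho> (\<lambda>x. ennreal (g x))"
        using g Hm le_less_trans[OF g(3)] by (intro associate_norm_Hoelder[OF bfn]) auto
      also have "\<dots> \<le> ennreal (C ^ k) * 1" using Hn g by (intro mult_mono) auto
      finally have "ennreal (r ^ k) * (\<integral>\<^sup>+x. ennreal (H k x) * ennreal (g x) \<partial>lebesgue) \<le> ennreal (r ^ k) * ennreal (C ^ k)"
        by (intro mult_left_mono) auto
      also have "\<dots> = ennreal ((r * C) ^ k)" using r C by (simp add: power_mult_distrib ennreal_mult)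
      also have "r * C = 1/2" using C by (simp add: r_def)
      finally show "ennreal (r ^ k) * (\<integral>\<^sup>+x. ennreal (H k x) * ennreal (g x) \<partial>lebesgue) \<le> ennreal ((1/2) ^ k)" .
    qed auto
    also have "\<dots> = ennreal (\<Sum>k. (1/2) ^ k)" by (intro suminf_ennreal2 summable_geometric) auto
    also have "\<dots> = 2" by (simp add: suminf_geometric)
    finally show "(\<integral>\<^sup>+x. w x * ennreal (g x) \<partial>lebesgue) \<le> 2" .
  qed
  have A1: "ennreal (measure lebesgue E) * (\<integral>\<^sup>+x\<in>Q. w x \<partial>lebesgue)
      \<le> ennreal (2 * C * measure lebesgue Q) * (\<integral>\<^sup>+x\<in>E. w x \<partial>lebesgue)"
    if Q: "is_cube Q" and E: "E \<in> sets lebesgue" "E \<subseteq> Q" for Q E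
  proof -
    let ?q = "measure lebesgue Q"
    have q: "0 < ?q" by (rule is_cube_measure_pos[OF Q])
    let ?W = "\<integral>\<^sup>+x\<in>Q. w x \<partial>lebesgue"
    \<comment> \<open>The pointwise \<open>A\<^sub>1\<close> condition: the average of the
      \<open>k\<close>-th iterate over \<open>Q\<close> is at most the next iterate at
      \<open>x\<close>. The shift of the series by one index costs \<open>1 / r = 2 * C\<close>.
      Integration over \<open>E\<close> gives the required form.\<close>
    have pt: "AE x in lebesgue. x \<in> Q \<longrightarrow> ?W \<le> ennreal (2 * C * ?q) * w x"
      using AE
    proof eventually_elim
      case (elim x)
      show ?case
      proof
        assume x: "x \<in> Q"
        have "?W = (\<Sum>k. ennreal (r ^ k) * (\<integral>\<^sup>+x\<in>Q. ennreal (H k x) \<partial>lebesgue))"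
          using is_cube_sets[OF Q] by (intro int_w) auto
        also have "\<dots> \<le> (\<Sum>k. ennreal (2 * C * ?q) * (ennreal (r ^ Suc k) * ennreal (H (Suc k) x)))"
        proof (intro suminf_le allI)
          fix k
          let ?I = "\<integral>\<^sup>+x\<in>Q. ennreal (H k x) \<partial>lebesgue"
          have "ennreal (1 / ?q) * ?I \<le> ennreal (H (Suc k) x)"
            using maximal_op_ge_average[OF Q x, of "H k"] elim Hpos by simp
          then have "ennreal ?q * (ennreal (1 / ?q) * ?I) \<le> ennreal ?q * ennreal (H (Suc k) x)"
            by (intro mult_left_mono) auto
          moreover have "ennreal ?q * ennreal (1 / ?q) = 1" using q by (simp flip: ennreal_mult)
          ultimately have "?I \<le> ennreal ?q * ennreal (H (Suc k) x)"
            by (simp add: mult.assoc[symmetric])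
          then have "ennreal (r ^ k) * ?I \<le> ennreal (r ^ k) * (ennreal ?q * ennreal (H (Suc k) x))"
            by (intro mult_left_mono) auto
          also have "\<dots> = ennreal (r ^ k * ?q) * ennreal (H (Suc k) x)"
            using r q by (simp add: ennreal_mult mult.assoc)
          also have "r ^ k * ?q = (2 * C * ?q) * r ^ Suc k" using C by (simp add: r_def)
          also have "ennreal ((2 * C * ?q) * r ^ Suc k) = ennreal (2 * C * ?q) * ennreal (r ^ Suc k)"
            using r q C by (intro ennreal_mult) auto
          finally show "ennreal (r ^ k) * ?I
            \<le> ennreal (2 * C * ?q) * (ennreal (r ^ Suc k) * ennreal (H (Suc k) x))"
            by (simp only: mult.assoc)
        qed auto
        also have "\<dots> = ennreal (2 * C * ?q) * (\<Sum>k. ennreal (r ^ Suc k) * ennreal (H (Suc k) x))"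
          by (rule ennreal_suminf_cmult)
        also have "\<dots> \<le> ennreal (2 * C * ?q) * w x"
        proof (intro mult_left_mono)
          have "w x = ennreal (r ^ 0) * ennreal (H 0 x) + (\<Sum>k. ennreal (r ^ Suc k) * ennreal (H (Suc k) x))"
            unfolding w_def using suminf_offset[of "\<lambda>k. ennreal (r ^ k) * ennreal (H k x)" 1] by simp
          then show "(\<Sum>k. ennreal (r ^ Suc k) * ennreal (H (Suc k) x)) \<le> w x" by simp
        qed simp
        finally show "?W \<le> ennreal (2 * C * ?q) * w x" .
      qed
    qed
    have El: "E \<in> lmeasurable" using E is_cube_lmeasurable[OF Q] fmeasurableI2 by blast
    have "ennreal (measure lebesgue E) * ?W = (\<integral>\<^sup>+x. ?W * indicator E x \<partial>lebesgue)"
      using E by (subst nn_integral_cmult_indicator) (auto simp: emeasure_eq_measure2[OF El] mult.commute)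
    also have "\<dots> \<le> (\<integral>\<^sup>+x. ennreal (2 * C * ?q) * (w x * indicator E x) \<partial>lebesgue)"
      using pt E(2) by (intro nn_integral_mono_AE) (auto elim!: eventually_mono simp: indicator_def)
    also have "\<dots> = ennreal (2 * C * ?q) * (\<integral>\<^sup>+x\<in>E. w x \<partial>lebesgue)"
      using wm E by (intro nn_integral_cmult) auto
    finally show ?thesis .
  qed
  show ?thesis using hw A1 by (intro that[OF wm _ wn]) auto
qed

text \<open>In the final constant \<open>2 / \<gamma>\<close>, the 2 bounds the norm of the majorant
  and \<open>1 / \<gamma>\<close> comes from the decay of its weight.\<close>

lemma associate_maximal_bound_imp_decay:
  fixes \<rho> :: "(real ^ 'n \<Rightarrow> ennreal) \<Rightarrow> ennreal"
  assumes bfn: "banach_function_norm \<rho>" and M: "maximal_op_bounded_on (associate_norm \<rho>)"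
  obtains c \<delta> :: real where "0 < c" "0 < \<delta>"
    "\<And>D S \<alpha> G. dyadic_grid D \<Longrightarrow> S \<subseteq> D \<Longrightarrow> finite S \<Longrightarrow>
      (\<And>Q. Q \<in> S \<Longrightarrow> 0 \<le> \<alpha> Q) \<Longrightarrow> (\<And>Q. Q \<in> S \<Longrightarrow> G Q \<in> sets lebesgue \<and> G Q \<subseteq> Q) \<Longrightarrow>
      \<rho> (\<lambda>x. ennreal (\<Sum>Q\<in>S. \<alpha> Q * indicator (G Q) x)) \<le>
        ennreal (c * (MAX Q\<in>S. measure lebesgue (G Q) / measure lebesgue Q) powr \<delta>) *
        \<rho> (\<lambda>x. ennreal (\<Sum>Q\<in>S. \<alpha> Q * indicator Q x))"
proof -
  obtain C0 :: real where C0: "0 < C0" "\<And>f. f \<in> bfs (associate_norm \<rho>) \<Longrightarrow>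
      associate_norm \<rho> (maximal_op f) \<le> ennreal C0 * bfs_norm (associate_norm \<rho>) f"
    using M unfolding maximal_op_bounded_on_def by blast
  \<comment> \<open>Enlarging the bound to at least one makes \<open>2 * C\<close> an admissible
    \<open>A\<^sub>1\<close> constant, with \<open>\<gamma>\<close> positive.\<close>
  define C where "C = max 1 C0"
  have C: "1 \<le> C" by (simp add: C_def)
  then have C_pos: "0 < C" by simp
  have CM: "associate_norm \<rho> (maximal_op f) \<le> ennreal C * bfs_norm (associate_norm \<rho>) f"
    if "f \<in> bfs (associate_norm \<rho>)" for f
  proof -
    have "ennreal C0 * bfs_norm (associate_norm \<rho>) f \<le> ennreal C * bfs_norm (associate_norm \<rho>) f"
      by (intro mult_right_mono ennreal_leI) (auto simp: C_def)
    with C0(2)[OF that] show ?thesis by (rule order_trans)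
  qed
  \<comment> \<open>The values that the decay of dyadic weights yields for the
    \<open>A\<^sub>1\<close> constant \<open>2 * C\<close>. They are fixed here because they must
    not depend on the grid, the family or the weight, which enter later.\<close>
  define \<gamma> where "\<gamma> = 1 - 1 / (2 * (2 * C))"
  define \<theta> :: real where "\<theta> = 1 / (2 * 2 ^ CARD('n))"
  define \<delta> where "\<delta> = log \<theta> \<gamma>"
  have \<gamma>: "0 < \<gamma>" "\<gamma> < 1" using C by (simp_all add: \<gamma>_def field_simps)
  have "(1::real) \<le> 2 ^ CARD('n)" by simp
  then have "(1::real) < 2 * 2 ^ CARD('n)" by linarith
  then have \<theta>: "0 < \<theta>" "\<theta> < 1" by (simp_all add: \<theta>_def)
  have \<delta>: "0 < \<delta>" using \<theta> \<gamma> by (simp add: \<delta>_def log_def divide_neg_neg)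
  have "\<rho> (\<lambda>x. ennreal (\<Sum>Q\<in>S. \<alpha> Q * indicator (G Q) x)) \<le>
        ennreal (2 / \<gamma> * (MAX Q\<in>S. measure lebesgue (G Q) / measure lebesgue Q) powr \<delta>) *
        \<rho> (\<lambda>x. ennreal (\<Sum>Q\<in>S. \<alpha> Q * indicator Q x))"
    if D: "dyadic_grid D" and S: "S \<subseteq> D" "finite S" and \<alpha>: "\<And>Q. Q \<in> S \<Longrightarrow> 0 \<le> \<alpha> Q"
      and G: "\<And>Q. Q \<in> S \<Longrightarrow> G Q \<in> sets lebesgue \<and> G Q \<subseteq> Q" for D S \<alpha> G
  proof (rule bfn_le_by_duality[OF bfn])
    let ?F = "\<lambda>x. \<Sum>Q\<in>S. \<alpha> Q * indicator (G Q) x"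
    let ?\<phi> = "\<lambda>x. \<Sum>Q\<in>S. \<alpha> Q * indicator Q x"
    define \<Lambda> where "\<Lambda> = (MAX Q\<in>S. measure lebesgue (G Q) / measure lebesgue Q)"
    have cube: "is_cube Q" if "Q \<in> S" for Q
      using that S dyadic_grid_is_cube[OF D] by blast
    note cube_sets = is_cube_sets[OF cube] and cube_bounded = is_cube_bounded[OF cube]
    show "?F \<in> borel_measurable lebesgue" using G by (intro borel_measurable_sum_indicator) auto
    show F0: "0 \<le> ?F x" for x using \<alpha> by (intro sum_nonneg) (auto simp: indicator_def)
    \<comment> \<open>The sum is bounded by the total of the coefficients and supported in the
      finite union of the cubes.\<close>
    show "integrable lebesgue (\<lambda>x. (?F x)\<^sup>2)"
    proof (rule integrable_square_bound)
      have US: "\<Union>S \<in> lmeasurable"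
        using S is_cube_lmeasurable[OF cube] by (intro fmeasurable.finite_Union) auto
      then have "integrable lebesgue (indicator (\<Union>S) :: _ \<Rightarrow> real)"
        by (intro integrable_real_indicator) (auto simp: fmeasurable_def)
      moreover have "(\<lambda>x. (indicator (\<Union>S) x :: real)\<^sup>2) = indicator (\<Union>S)"
        by (auto simp: indicator_def)
      ultimately show "integrable lebesgue (\<lambda>x. (indicator (\<Union>S) x :: real)\<^sup>2)"
        by simp
      show "?F \<in> borel_measurable lebesgue" using G by (intro borel_measurable_sum_indicator) auto
      show "\<bar>?F x\<bar> \<le> (\<Sum>Q\<in>S. \<alpha> Q) * \<bar>indicator (\<Union>S) x\<bar>" for x
      proof -
        have "?F x \<le> (\<Sum>Q\<in>S. \<alpha> Q * indicator (\<Union>S) x)"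
          using \<alpha> G by (intro sum_mono mult_left_mono) (auto simp: indicator_def)
        then show ?thesis using F0[of x] by (simp add: sum_distrib_right)
      qed
    qed
    fix h :: "real ^ 'n \<Rightarrow> real"
    assume h: "h \<in> borel_measurable lebesgue" "\<And>x. 0 \<le> h x"
      "associate_norm \<rho> (\<lambda>x. ennreal (h x)) \<le> 1"
    obtain w where w: "w \<in> borel_measurable lebesgue" "\<forall>x. ennreal (h x) \<le> w x"
      "associate_norm \<rho> w \<le> 2"
      "\<forall>Q E. is_cube Q \<longrightarrow> E \<in> sets lebesgue \<longrightarrow> E \<subseteq> Q \<longrightarrow>
      ennreal (measure lebesgue E) * (\<integral>\<^sup>+x\<in>Q. w x \<partial>lebesgue)
        \<le> ennreal (2 * C * measure lebesgue Q) * (\<integral>\<^sup>+x\<in>E. w x \<partial>lebesgue)"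
      by (rule A1_majorant_exists[OF bfn C_pos CM h])
    have em: "emeasure (density lebesgue w) E = (\<integral>\<^sup>+x\<in>E. w x \<partial>lebesgue)" if "E \<in> sets lebesgue" for E
      using w that by (intro emeasure_density) auto
    interpret A: dyadic_A1 D "density lebesgue w" "2 * C"
    proof
      show "sets (density lebesgue w) = sets lebesgue" by simp
      show "ennreal (measure lebesgue E) * emeasure (density lebesgue w) Q
          \<le> ennreal (2 * C * measure lebesgue Q) * emeasure (density lebesgue w) E"
        if "is_cube Q" "E \<in> sets lebesgue" "E \<subseteq> Q" for Q E
        using w(4)[rule_format, OF that] that is_cube_sets[OF that(1)] by (simp add: em)
      show "emeasure (density lebesgue w) E = 0" if "E \<in> null_sets lebesgue" for E
        using that by (subst em) (auto intro: nn_integral_null_set)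
    qed (use D C in auto)
    have decay: "(\<integral>\<^sup>+x\<in>G Q. w x \<partial>lebesgue) \<le> ennreal (1 / \<gamma> * \<Lambda> powr \<delta>) * (\<integral>\<^sup>+x\<in>Q. w x \<partial>lebesgue)"
      if Q: "Q \<in> S" for Q
    proof -
      have QD: "Q \<in> D" using S Q by blast
      have "(\<integral>\<^sup>+x\<in>G Q. w x \<partial>lebesgue) \<le>
        ennreal (1 / \<gamma> * (measure lebesgue (G Q) / measure lebesgue Q) powr \<delta>) * (\<integral>\<^sup>+x\<in>Q. w x \<partial>lebesgue)"
        using A.decay_power[OF QD, of "G Q"] G[OF Q] cube_sets[OF Q]
        by (simp add: em \<gamma>_def \<theta>_def \<delta>_def A.\<gamma>_def A.\<theta>_def)
      also have "\<dots> \<le> ennreal (1 / \<gamma> * \<Lambda> powr \<delta>) * (\<integral>\<^sup>+x\<in>Q. w x \<partial>lebesgue)"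
      proof (intro mult_right_mono ennreal_leI mult_left_mono powr_mono2)
        show "measure lebesgue (G Q) / measure lebesgue Q \<le> \<Lambda>"
          unfolding \<Lambda>_def using S Q by (intro Max_ge) auto
      qed (use \<gamma> \<delta> in auto)
      finally show ?thesis .
    qed
    have "(\<integral>\<^sup>+x. ennreal (?F x) * ennreal (h x) \<partial>lebesgue) \<le> (\<integral>\<^sup>+x. ennreal (?F x) * w x \<partial>lebesgue)"
      using w(2) by (intro nn_integral_mono mult_left_mono) auto
    also have "\<dots> = (\<Sum>Q\<in>S. ennreal (\<alpha> Q) * (\<integral>\<^sup>+x\<in>G Q. w x \<partial>lebesgue))"
      using S \<alpha> G w by (intro nn_integral_sum_indicator) auto
    also have "\<dots> \<le> (\<Sum>Q\<in>S. ennreal (\<alpha> Q) * (ennreal (1 / \<gamma> * \<Lambda> powr \<delta>) * (\<integral>\<^sup>+x\<in>Q. w x \<partial>lebesgue)))"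
      using decay by (intro sum_mono mult_left_mono) auto
    also have "\<dots> = ennreal (1 / \<gamma> * \<Lambda> powr \<delta>) * (\<Sum>Q\<in>S. ennreal (\<alpha> Q) * (\<integral>\<^sup>+x\<in>Q. w x \<partial>lebesgue))"
      unfolding sum_distrib_left by (intro sum.cong) (auto simp: mult_ac)
    also have "(\<Sum>Q\<in>S. ennreal (\<alpha> Q) * (\<integral>\<^sup>+x\<in>Q. w x \<partial>lebesgue)) = (\<integral>\<^sup>+x. w x * ennreal (?\<phi> x) \<partial>lebesgue)"
      using S \<alpha> w cube_sets
      by (subst nn_integral_sum_indicator[symmetric]) (auto simp: mult.commute)
    also have "\<dots> \<le> associate_norm \<rho> w * \<rho> (\<lambda>x. ennreal (?\<phi> x))"
    proof (rule associate_norm_Hoelder[OF bfn])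
      show "?\<phi> \<in> borel_measurable lebesgue" using cube_sets by (intro borel_measurable_sum_indicator) auto
      show "0 \<le> ?\<phi> x" for x using \<alpha> by (intro sum_nonneg) (auto simp: indicator_def)
      show "\<rho> (\<lambda>x. ennreal (?\<phi> x)) < \<infinity>"
        using S \<alpha> cube_sets cube_bounded by (intro bfn_sum_indicator_finite[OF bfn]) auto
    qed (rule w)
    also have "\<dots> \<le> 2 * \<rho> (\<lambda>x. ennreal (?\<phi> x))" using w(3) by (intro mult_right_mono) auto
    finally have "(\<integral>\<^sup>+x. ennreal (?F x) * ennreal (h x) \<partial>lebesgue)
      \<le> ennreal (1 / \<gamma> * \<Lambda> powr \<delta>) * (2 * \<rho> (\<lambda>x. ennreal (?\<phi> x)))"
      by (simp add: mult_left_mono)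
    also have "\<dots> = ennreal (2 / \<gamma> * \<Lambda> powr \<delta>) * \<rho> (\<lambda>x. ennreal (?\<phi> x))"
    proof -
      have "ennreal (2 / \<gamma> * \<Lambda> powr \<delta>) = ennreal (1 / \<gamma> * \<Lambda> powr \<delta> * 2)" by (simp add: mult.commute)
      also have "\<dots> = ennreal (1 / \<gamma> * \<Lambda> powr \<delta>) * ennreal 2" using \<gamma> by (intro ennreal_mult) auto
      finally show ?thesis by (simp add: mult.assoc)
    qed
    finally show "(\<integral>\<^sup>+x. ennreal (?F x) * ennreal (h x) \<partial>lebesgue)
      \<le> ennreal (2 / \<gamma> * (MAX Q\<in>S. measure lebesgue (G Q) / measure lebesgue Q) powr \<delta>) * \<rho> (\<lambda>x. ennreal (?\<phi> x))"
      by (simp only: \<Lambda>_def)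
  qed
  then show ?thesis using that[of "2 / \<gamma>" \<delta>] \<gamma> \<delta> by (simp only: zero_less_divide_iff zero_less_numeral simp_thms)
qed

section \<open>Principal cubes\<close>

text \<open>Here \<open>u Q\<close> stands for \<open>\<integral>\<^sub>Q \<bar>f\<bar>\<close>.\<close>

locale principal_cubes =
  fixes D F :: "(real ^ 'n) set set" and u :: "(real ^ 'n) set \<Rightarrow> real" and a :: real
  assumes D: "dyadic_grid D" and F: "finite F" "F \<subseteq> D" and a: "1 < a"
    and u_nonneg: "\<And>Q. 0 \<le> u Q"
    and u_sum: "\<And>\<P> Q. finite \<P> \<Longrightarrow> disjoint \<P> \<Longrightarrow> Q \<in> D \<Longrightarrow> \<P> \<subseteq> {P \<in> D. P \<subseteq> Q} \<Longrightarrow> sum u \<P> \<le> u Q"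
begin

definition avg :: "(real ^ 'n) set \<Rightarrow> real" where
  "avg Q = u Q / measure lebesgue Q"

definition maxi :: "(real ^ 'n) set set \<Rightarrow> (real ^ 'n) set set" where
  "maxi A = {Q \<in> A. \<forall>R\<in>A. Q \<subseteq> R \<longrightarrow> R = Q}"

definition ch :: "(real ^ 'n) set \<Rightarrow> (real ^ 'n) set set" where
  "ch Q = maxi {P \<in> F. P \<subseteq> Q \<and> a * avg Q < avg P}"

primrec gen :: "nat \<Rightarrow> (real ^ 'n) set set" where
  "gen 0 = maxi F"
| "gen (Suc k) = (\<Union>Q\<in>gen k. ch Q)"

definition V :: "nat \<Rightarrow> (real ^ 'n) set" where
  "V k = \<Union>(gen k)"

definition principal :: "(real ^ 'n) set set" where
  "principal = (\<Union>k. gen k)"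

definition rank :: "(real ^ 'n) set \<Rightarrow> nat" where
  "rank Q = (THE k. Q \<in> gen k)"

text \<open>The part of \<open>Q\<close> covered by its descendants \<open>l\<close> generations
  below but not by those one generation further; \<open>cell 0 Q\<close> is the part outside the
  children.\<close>

definition cell :: "nat \<Rightarrow> (real ^ 'n) set \<Rightarrow> (real ^ 'n) set" where
  "cell l Q = Q \<inter> (V (rank Q + l) - V (rank Q + Suc l))"

lemma grid_nonempty: "Q \<in> D \<Longrightarrow> Q \<noteq> {}"
  using dyadic_grid_measure_pos[OF D] by force

lemma avg_nonneg: "0 \<le> avg Q"
  by (simp add: avg_def u_nonneg)

lemma avg_le: "avg Q \<le> a * avg Q"
  using mult_right_mono[OF less_imp_le[OF a] avg_nonneg[of Q]] by simp

lemma maxi_subset: "maxi A \<subseteq> A"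
  by (auto simp: maxi_def)

lemma maxi_disjoint:
  assumes "A \<subseteq> D" "P \<in> maxi A" "Q \<in> maxi A" "P \<inter> Q \<noteq> {}"
  shows "P = Q"
proof -
  have "P \<subseteq> Q \<or> Q \<subseteq> P"
    using assms maxi_subset by (intro dyadic_grid_nested[OF D]) auto
  then show ?thesis using assms by (auto simp: maxi_def)
qed

lemma maxi_cover:
  assumes "finite A" "Q \<in> A"
  obtains R where "R \<in> maxi A" "Q \<subseteq> R"
  using finite_has_maximal2[OF assms] by (auto simp: maxi_def)

lemma ch_D:
  assumes "P \<in> ch Q" shows "P \<in> F" "P \<subseteq> Q" "a * avg Q < avg P" "P \<noteq> Q"
proof -
  show *: "P \<in> F" "P \<subseteq> Q" "a * avg Q < avg P" using assms maxi_subset by (auto simp: ch_def)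
  show "P \<noteq> Q" using *(3) avg_le[of Q] by auto
qed

lemma ch_disjoint: "P \<in> ch Q \<Longrightarrow> P' \<in> ch Q \<Longrightarrow> P \<inter> P' \<noteq> {} \<Longrightarrow> P = P'"
  using F(2) by (intro maxi_disjoint[of "{P \<in> F. P \<subseteq> Q \<and> a * avg Q < avg P}"]) (auto simp: ch_def)

lemma gen_subset: "gen k \<subseteq> F"
  using ch_D(1) maxi_subset by (cases k) auto

lemma gen_disjoint: "P \<in> gen k \<Longrightarrow> Q \<in> gen k \<Longrightarrow> P \<inter> Q \<noteq> {} \<Longrightarrow> P = Q"
proof (induction k arbitrary: P Q)
  case 0
  then show ?case using maxi_disjoint[OF F(2)] by auto
next
  case (Suc k)
  then obtain P' Q' where PQ: "P' \<in> gen k" "Q' \<in> gen k" "P \<in> ch P'" "Q \<in> ch Q'" by auto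
  then have "P' \<inter> Q' \<noteq> {}" using Suc.prems(3) ch_D(2) by blast
  then have "P' = Q'" using Suc.IH PQ by blast
  then show ?case using PQ Suc.prems(3) ch_disjoint by blast
qed

lemma V_Suc_subset: "V (Suc k) \<subseteq> V k"
  using ch_D(2) by (fastforce simp: V_def)

lemma V_antimono: "j \<le> k \<Longrightarrow> V k \<subseteq> V j"
  using V_Suc_subset by (rule lift_Suc_antimono_le)

lemma gen_descendant:
  "Q \<in> gen j \<Longrightarrow> P \<in> gen (j + l) \<Longrightarrow> P \<inter> Q \<noteq> {} \<Longrightarrow> P \<subseteq> Q"
proof (induction l arbitrary: P)
  case 0
  then show ?case using gen_disjoint by auto
next
  case (Suc l)
  then obtain R where R: "R \<in> gen (j + l)" "P \<in> ch R" by auto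
  then have "P \<subseteq> R" using ch_D(2) by blast
  moreover have "R \<subseteq> Q" using Suc R calculation by blast
  ultimately show ?case by blast
qed

lemma gen_unique_less: "Q \<in> gen j \<Longrightarrow> Q \<in> gen k \<Longrightarrow> \<not> j < k"
proof
  assume Q: "Q \<in> gen j" "Q \<in> gen k" and "j < k"
  then obtain l where l: "k = Suc (j + l)" using less_iff_Suc_add by auto
  then obtain R where R: "R \<in> gen (j + l)" "Q \<in> ch R" using Q by auto
  have "Q \<noteq> {}" using Q(1) gen_subset F grid_nonempty by blast
  then have "R \<subseteq> Q" using gen_descendant[OF Q(1) R(1)] ch_D(2)[OF R(2)] by blast
  then show False using ch_D(2,4)[OF R(2)] by blast
qed

lemma gen_unique: "Q \<in> gen j \<Longrightarrow> Q \<in> gen k \<Longrightarrow> j = k"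
  using gen_unique_less by (meson linorder_neqE_nat)

lemma rank_eq: "Q \<in> gen k \<Longrightarrow> rank Q = k"
  unfolding rank_def using gen_unique by blast

lemma principal_rank: "Q \<in> principal \<Longrightarrow> Q \<in> gen (rank Q)"
  using rank_eq by (auto simp: principal_def)

lemma principal_subset: "principal \<subseteq> F"
  using gen_subset by (auto simp: principal_def)

lemma gen_finite: "finite (gen k)"
  using gen_subset F(1) by (rule finite_subset)

lemma V_sets: "V k \<in> sets lebesgue"
  unfolding V_def using gen_finite gen_subset F dyadic_grid_lmeasurable[OF D]
  by (intro sets.finite_Union) blast+

text \<open>A cube belongs to at most one generation, so infinitely many nonempty generations would
  give infinitely many cubes in the finite family \<open>F\<close>.\<close>

lemma gen_terminates: obtains N where "V N = {}"
proof -
  have "\<exists>N. gen N = {}"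
  proof (rule ccontr)
    assume "\<nexists>N. gen N = {}"
    then have "\<forall>k. \<exists>Q. Q \<in> gen k" by blast
    then obtain q where q: "\<And>k. q k \<in> gen k" by metis
    have "inj q" using gen_unique q by (metis injI)
    moreover have "range q \<subseteq> F" using q gen_subset by blast
    ultimately show False using F finite_subset range_inj_infinite by blast
  qed
  then show ?thesis using that by (auto simp: V_def)
qed

text \<open>Each child satisfies \<open>a * avg Q * \<bar>P\<bar> \<le> u P\<close>, and the
  disjoint children have total \<open>u\<close> at most \<open>u Q = avg Q * \<bar>Q\<bar>\<close>.
  Cancelling \<open>avg Q\<close> requires it to be nonzero; if it is zero there are no
  children.\<close>

lemma sum_ch_measure:
  assumes Q: "Q \<in> D"
  shows "(\<Sum>P\<in>ch Q. measure lebesgue P) \<le> measure lebesgue Q / a"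
proof -
  let ?q = "measure lebesgue Q"
  have q: "0 < ?q" by (rule dyadic_grid_measure_pos[OF D Q])
  have chF: "ch Q \<subseteq> F" using ch_D(1) by blast
  have fin: "finite (ch Q)" using chF F(1) by (rule finite_subset)
  have uP: "a * avg Q * measure lebesgue P \<le> u P" if "P \<in> ch Q" for P
  proof -
    have "0 < measure lebesgue P" using that chF F dyadic_grid_measure_pos[OF D] by blast
    then show ?thesis using ch_D(3)[OF that] by (simp add: avg_def[of P] field_simps)
  qed
  have "a * avg Q * (\<Sum>P\<in>ch Q. measure lebesgue P) \<le> (\<Sum>P\<in>ch Q. u P)"
    unfolding sum_distrib_left using uP by (rule sum_mono)
  also have "\<dots> \<le> u Q"
  proof (intro u_sum fin Q disjointI)
    show "P \<inter> P' = {}" if "P \<in> ch Q" "P' \<in> ch Q" "P \<noteq> P'" for P P'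
      using ch_disjoint that by blast
    show "ch Q \<subseteq> {P \<in> D. P \<subseteq> Q}" using chF F ch_D(2) by blast
  qed
  also have "\<dots> = avg Q * ?q" using q by (simp add: avg_def)
  finally have le: "avg Q * (a * (\<Sum>P\<in>ch Q. measure lebesgue P)) \<le> avg Q * ?q"
    by (simp add: mult_ac)
  show ?thesis
  proof (cases "avg Q = 0")
    case True
    have "ch Q = {}"
    proof (rule ccontr)
      assume "ch Q \<noteq> {}"
      then obtain P where P: "P \<in> ch Q" by blast
      have "sum u {P} \<le> u Q"
        using P Q chF F ch_D(2)[OF P] by (intro u_sum) auto
      moreover have "u Q = 0" using True q by (simp add: avg_def)
      ultimately have "avg P = 0" using u_nonneg[of P] by (simp add: avg_def)
      with ch_D(3)[OF P] True show False by simp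
    qed
    then show ?thesis using q a by simp
  next
    case False
    then have "0 < avg Q" using avg_nonneg[of Q] by simp
    with le show ?thesis using a by (simp add: field_simps)
  qed
qed

text \<open>The first generation is peeled off: below \<open>Q\<close>, the set
  \<open>V (j + Suc l)\<close> splits over the children, each of which sees it only \<open>l\<close>
  generations further down.\<close>

lemma descendants_measure:
  "Q \<in> gen j \<Longrightarrow> measure lebesgue (Q \<inter> V (j + l)) \<le> (1 / a) ^ l * measure lebesgue Q"
proof (induction l arbitrary: Q j)
  case 0
  have "Q \<in> lmeasurable" using 0 gen_subset F dyadic_grid_lmeasurable[OF D] by blast
  then show ?case using V_sets by (auto intro!: measure_mono_fmeasurable)
next
  case (Suc l)
  have QD: "Q \<in> D" using Suc.prems gen_subset F by blast
  have chF: "ch Q \<subseteq> F" using ch_D(1) by blast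
  have fin: "finite (ch Q)" using chF F(1) by (rule finite_subset)
  have ch_gen: "P \<in> gen (Suc j)" if "P \<in> ch Q" for P using that Suc.prems by auto
  have eq: "Q \<inter> V (j + Suc l) = (\<Union>P\<in>ch Q. P \<inter> V (Suc j + l))"
  proof
    show "Q \<inter> V (j + Suc l) \<subseteq> (\<Union>P\<in>ch Q. P \<inter> V (Suc j + l))"
    proof
      fix x assume x: "x \<in> Q \<inter> V (j + Suc l)"
      then have "x \<in> V (Suc j)" using V_antimono[of "Suc j" "j + Suc l"] by auto
      then obtain R P where RP: "R \<in> gen j" "P \<in> ch R" "x \<in> P" by (auto simp: V_def)
      then have "x \<in> R" using ch_D(2) by blast
      then have "R = Q" using gen_disjoint[OF RP(1) Suc.prems] x by blast
      then show "x \<in> (\<Union>P\<in>ch Q. P \<inter> V (Suc j + l))" using RP x by auto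
    qed
    show "(\<Union>P\<in>ch Q. P \<inter> V (Suc j + l)) \<subseteq> Q \<inter> V (j + Suc l)"
      using ch_D(2) by auto
  qed
  have "measure lebesgue (Q \<inter> V (j + Suc l)) \<le> (\<Sum>P\<in>ch Q. measure lebesgue (P \<inter> V (Suc j + l)))"
    unfolding eq
  proof (rule measure_UNION_le[OF fin])
    fix P assume "P \<in> ch Q"
    then show "P \<inter> V (Suc j + l) \<in> sets lebesgue"
      using chF F V_sets dyadic_grid_lmeasurable[OF D, of P] by (intro sets.Int) auto
  qed
  also have "\<dots> \<le> (\<Sum>P\<in>ch Q. (1 / a) ^ l * measure lebesgue P)"
    using Suc.IH[OF ch_gen] by (intro sum_mono) simp
  also have "\<dots> = (1 / a) ^ l * (\<Sum>P\<in>ch Q. measure lebesgue P)" by (simp add: sum_distrib_left)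
  also have "\<dots> \<le> (1 / a) ^ l * (measure lebesgue Q / a)"
    using a by (intro mult_left_mono sum_ch_measure QD) auto
  finally show ?case by simp
qed

lemma cell_sets: "Q \<in> principal \<Longrightarrow> cell l Q \<in> sets lebesgue"
  unfolding cell_def using principal_subset F V_sets dyadic_grid_lmeasurable[OF D]
  by (intro sets.Int sets.Diff) blast+

lemma cell_subset: "cell l Q \<subseteq> Q"
  by (auto simp: cell_def)

lemma cell_measure:
  assumes Q: "Q \<in> principal"
  shows "measure lebesgue (cell l Q) \<le> (1 / a) ^ l * measure lebesgue Q"
proof -
  have Ql: "Q \<in> lmeasurable" using Q principal_subset F dyadic_grid_lmeasurable[OF D] by blast
  have "measure lebesgue (cell l Q) \<le> measure lebesgue (Q \<inter> V (rank Q + l))"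
    using cell_sets[OF Q] fmeasurable_Int_fmeasurable[OF Ql V_sets]
    by (intro measure_mono_fmeasurable) (auto simp: cell_def)
  with descendants_measure[OF principal_rank[OF Q], of l] show ?thesis by linarith
qed

text \<open>Cubes of equal rank are disjoint already. For different ranks the differences of
  consecutive sets \<open>V\<close> are disjoint, since the \<open>V k\<close> decrease; this is why
  \<open>l\<close> is counted from the rank of the cube.\<close>

lemma cell_disjoint: "disjoint_family_on (cell l) principal"
  unfolding disjoint_family_on_def
proof (intro ballI impI)
  fix P Q assume PQ: "P \<in> principal" "Q \<in> principal" "P \<noteq> Q"
  show "cell l P \<inter> cell l Q = {}"
  proof (cases "rank P = rank Q")
    case True
    then have "P \<inter> Q = {}" using PQ principal_rank gen_disjoint by metis
    then show ?thesis using cell_subset by blast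
  next
    case False
    then have "rank P + Suc l \<le> rank Q + l \<or> rank Q + Suc l \<le> rank P + l" by linarith
    then have "V (rank Q + l) \<subseteq> V (rank P + Suc l) \<or> V (rank P + l) \<subseteq> V (rank Q + Suc l)"
      using V_antimono by blast
    then show ?thesis unfolding cell_def by blast
  qed
qed

lemma cell_sparse:
  assumes Q: "Q \<in> principal"
  shows "(1 - 1 / a) * measure lebesgue Q \<le> measure lebesgue (cell 0 Q)"
proof -
  have Ql: "Q \<in> lmeasurable" using Q principal_subset F dyadic_grid_lmeasurable[OF D] by blast
  have "Q \<subseteq> V (rank Q)" using principal_rank[OF Q] by (auto simp: V_def)
  then have "cell 0 Q = Q - Q \<inter> V (rank Q + 1)" by (auto simp: cell_def)
  moreover have "measure lebesgue (Q - Q \<inter> V (rank Q + 1)) = measure lebesgue Q - measure lebesgue (Q \<inter> V (rank Q + 1))"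
    using Ql V_sets fmeasurable_Int_fmeasurable[OF Ql V_sets]
    by (intro measurable_measure_Diff) auto
  ultimately show ?thesis
    using descendants_measure[OF principal_rank[OF Q], of 1] by (simp add: left_diff_distrib)
qed

text \<open>The differences telescope, and the sets \<open>V\<close> are empty from index
  \<open>N\<close> on, so the same number of layers serves for every cube.\<close>

lemma cell_decomposition:
  assumes Q: "Q \<in> principal" and N: "V N = {}"
  shows "indicator Q x = (\<Sum>l<N. indicator (cell l Q) x :: real)"
proof -
  let ?g = "\<lambda>l. - (indicator (Q \<inter> V (rank Q + l)) x :: real)"
  have "indicator (cell l Q) x = ?g (Suc l) - ?g l" for l
    using V_Suc_subset[of "rank Q + l"] by (auto simp: cell_def indicator_def)
  then have "(\<Sum>l<N. indicator (cell l Q) x :: real) = ?g N - ?g 0"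
    using sum_lessThan_telescope[of ?g N] by simp
  moreover have "V (rank Q + N) = {}" using V_antimono[of N "rank Q + N"] N by simp
  moreover have "Q \<inter> V (rank Q) = Q" using principal_rank[OF Q] by (auto simp: V_def)
  ultimately show ?thesis by simp
qed

text \<open>Let \<open>Q\<close> be a child of \<open>P\<close>. A cube \<open>R\<close> strictly
  between them has \<open>avg R \<le> a * avg P\<close>, since otherwise \<open>Q\<close> would not
  be maximal; for \<open>R\<close> containing \<open>P\<close> the same bound is the induction
  hypothesis. Finally \<open>a * avg P < avg Q\<close>.\<close>

lemma avg_ancestor:
  "Q \<in> gen k \<Longrightarrow> R \<in> F \<Longrightarrow> Q \<subseteq> R \<Longrightarrow> avg R \<le> a * avg Q"
proof (induction k arbitrary: Q)
  case 0
  then have "R = Q" by (auto simp: maxi_def)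
  then show ?case using avg_le by simp
next
  case (Suc k)
  then obtain P where P: "P \<in> gen k" "Q \<in> ch P" by auto
  note Q = ch_D[OF P(2)]
  have "Q \<noteq> {}" using Q(1) F grid_nonempty by blast
  then have "R \<inter> P \<noteq> {}" using Suc.prems(3) Q(2) by blast
  moreover have "R \<in> D" "P \<in> D" using Suc.prems P gen_subset F by blast+
  ultimately consider "P \<subseteq> R" | "R \<subseteq> P" using dyadic_grid_nested[OF D] by blast
  then have "avg R \<le> a * avg P \<or> R = Q"
  proof cases
    case 1
    then show ?thesis using Suc.IH[OF P(1)] Suc.prems by blast
  next
    case 2
    then show ?thesis using P(2) Suc.prems by (auto simp: ch_def maxi_def)
  qed
  then show ?case
  proof
    assume "avg R \<le> a * avg P"
    then show ?thesis using Q(3) avg_le[of Q] by linarith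
  qed (simp add: avg_le)
qed

text \<open>Linearisation of the maximal operator: \<open>Q\<close> is the cube containing
  \<open>x\<close> in the last generation that reaches \<open>x\<close>. A cube \<open>R\<close>
  inside \<open>Q\<close> with a larger average than allowed would lie in a child of
  \<open>Q\<close>, contradicting that choice; cubes around \<open>Q\<close> are controlled by
  \<open>avg_ancestor\<close>.\<close>

lemma avg_dominated:
  assumes R: "R \<in> F" "x \<in> R"
  obtains Q where "Q \<in> principal" "x \<in> cell 0 Q" "avg R \<le> a * avg Q"
proof -
  obtain N where N: "V N = {}" by (rule gen_terminates)
  obtain P where "P \<in> maxi F" "R \<subseteq> P" using maxi_cover[OF F(1) R(1)] by blast
  then have x0: "x \<in> V 0" using R by (auto simp: V_def)
  have "\<exists>k. x \<in> V k \<and> x \<notin> V (Suc k)"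
  proof (rule ccontr)
    assume "\<nexists>k. x \<in> V k \<and> x \<notin> V (Suc k)"
    then have "x \<in> V k" for k using x0 by (induction k) auto
    with N show False by blast
  qed
  then obtain k where k: "x \<in> V k" "x \<notin> V (Suc k)" by blast
  then obtain Q where Q: "Q \<in> gen k" "x \<in> Q" by (auto simp: V_def)
  have cell: "x \<in> cell 0 Q" using k Q rank_eq[OF Q(1)] by (simp add: cell_def)
  have "R \<in> D" "Q \<in> D" using R Q gen_subset F by blast+
  then consider "Q \<subseteq> R" | "R \<subseteq> Q" using dyadic_grid_nested[OF D] R Q by blast
  then have "avg R \<le> a * avg Q"
  proof cases
    case 1
    then show ?thesis using avg_ancestor Q R by blast
  next
    case 2
    show ?thesis
    proof (rule ccontr)
      assume "\<not> avg R \<le> a * avg Q"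
      then have "R \<in> {P \<in> F. P \<subseteq> Q \<and> a * avg Q < avg P}" using R 2 by simp
      then obtain P where "P \<in> ch Q" "R \<subseteq> P"
        unfolding ch_def using maxi_cover[of "{P \<in> F. P \<subseteq> Q \<and> a * avg Q < avg P}" R] F by auto
      then have "x \<in> V (Suc k)" using Q R by (auto simp: V_def)
      with k show False by blast
    qed
  qed
  then show ?thesis using that Q cell by (auto simp: principal_def)
qed

end

section \<open>The one-third trick\<close>

text \<open>The one-third trick: the grid \<open>third_grid A\<close> at level \<open>k\<close> has its endpoints in
  \<open>2\<^sup>k (\<int> + (-1)\<^sup>k / 3)\<close> in the coordinates belonging to \<open>A\<close>, and in \<open>2\<^sup>k \<int>\<close> in the others.
  The alternating sign makes consecutive levels nested.\<close>

definition third :: "'n set \<Rightarrow> int \<Rightarrow> 'n \<Rightarrow> real" where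
  "third A k i = (if i \<in> A then (if even k then 1/3 else - 1/3) else 0)"

text \<open>Cells are encoded as the fibres of this index map, so that each level is visibly a
  partition and nestedness becomes a statement about floors.\<close>

definition grid_index :: "'n set \<Rightarrow> int \<Rightarrow> real ^ 'n \<Rightarrow> 'n \<Rightarrow> int" where
  "grid_index A k x i = \<lfloor>x $ i / 2 powi k - third A k i\<rfloor>"

definition third_cell :: "'n set \<Rightarrow> int \<Rightarrow> ('n \<Rightarrow> int) \<Rightarrow> (real ^ 'n) set" where
  "third_cell A k m = {x. grid_index A k x = m}"

definition third_grid :: "'n set \<Rightarrow> (real ^ 'n) set set" where
  "third_grid A = (\<Union>k. range (third_cell A k))"

lemma third_cell_eq_cube:
  "third_cell A k m = cube (\<chi> i. 2 powi k * (m i + third A k i)) (2 powi k)"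
proof -
  have "\<lfloor>x / 2 powi k - s\<rfloor> = m \<longleftrightarrow> 2 powi k * (m + s) \<le> x \<and> x < 2 powi k * (m + s) + 2 powi k"
    for x s :: real and m :: int
    by (simp add: floor_eq_iff field_simps)
  then show ?thesis
    by (auto simp: third_cell_def cube_def grid_index_def fun_eq_iff)
qed

lemma third_cell_side: "cube_of_side (2 powi k) (third_cell A k m)"
  by (auto simp: cube_of_side_iff third_cell_eq_cube)

text \<open>The alternating sign makes the shift minus twice the next shift an integer
  \<open>c\<close>, since 1/3 + 2/3 = 1. The next index is thus \<open>(m + c) div 2\<close> for the
  current index \<open>m\<close>.\<close>

lemma grid_index_Suc:
  assumes "grid_index A k x = grid_index A k y"
  shows "grid_index A (k + 1) x = grid_index A (k + 1) y"
proof
  fix i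
  define c :: int where "c = (if i \<in> A then (if even k then 1 else - 1) else 0)"
  have c: "of_int c = third A k i - 2 * third A (k + 1) i" by (simp add: c_def third_def)
  have "grid_index A (k + 1) z i = (grid_index A k z i + c) div 2" for z
  proof -
    have eq: "z $ i / 2 powi (k + 1) - third A (k + 1) i
      = (z $ i / 2 powi k - third A k i + of_int c) / of_int 2"
      by (simp add: c power_int_add field_simps)
    have "grid_index A (k + 1) z i = \<lfloor>z $ i / 2 powi k - third A k i + of_int c\<rfloor> div 2"
      unfolding grid_index_def eq by (rule floor_divide_real_eq_div) simp
    then show ?thesis by (simp add: grid_index_def)
  qed
  then show "grid_index A (k + 1) x i = grid_index A (k + 1) y i" using assms by simp
qed

lemma grid_index_mono:
  assumes "grid_index A k x = grid_index A k y" "k \<le> l"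
  shows "grid_index A l x = grid_index A l y"
  using assms(2,1) by (induction l rule: int_ge_induct) (auto intro: grid_index_Suc)

lemma dyadic_grid_third_grid: "dyadic_grid (third_grid A :: (real ^ 'n) set set)"
  unfolding dyadic_grid_def
proof (intro conjI ballI allI)
  show "\<exists>k::int. cube_of_side (2 powi k) Q" if "Q \<in> third_grid A" for Q :: "(real ^ 'n) set"
    using that third_cell_side by (auto simp: third_grid_def)
  have sub: "third_cell A k m \<subseteq> third_cell A l n"
    if "k \<le> l" "third_cell A k m \<inter> third_cell A l n \<noteq> {}" for k l m n
    using that grid_index_mono by (fastforce simp: third_cell_def)
  show "Q \<inter> R \<in> {Q, R, {}}" if QR: "Q \<in> third_grid A" "R \<in> third_grid A" for Q R :: "(real ^ 'n) set"
  proof -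
    obtain k m where "Q = third_cell A k m"
      using QR(1) unfolding third_grid_def by blast
    moreover obtain l n where "R = third_cell A l n"
      using QR(2) unfolding third_grid_def by blast
    ultimately have "Q \<inter> R = {} \<or> Q \<subseteq> R \<or> R \<subseteq> Q"
      using sub[of k l m n] sub[of l k n m] linear[of k l] by blast
    then show ?thesis by blast
  qed
  fix k :: int
  \<comment> \<open>A set has only one side length as a cube, so the cells of other levels cannot
    occur here.\<close>
  have eq: "{Q \<in> third_grid A. cube_of_side (2 powi k) Q} = range (third_cell A k)"
  proof
    show "range (third_cell A k) \<subseteq> {Q \<in> third_grid A. cube_of_side (2 powi k) Q}"
      using third_cell_side by (auto simp: third_grid_def)
    show "{Q \<in> third_grid A. cube_of_side (2 powi k) Q} \<subseteq> range (third_cell A k)"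
    proof
      fix Q assume "Q \<in> {Q \<in> third_grid A. cube_of_side (2 powi k) Q}"
      then obtain j m where Q: "Q = third_cell A j m" "cube_of_side (2 powi k) Q"
        by (auto simp: third_grid_def)
      have "(2 powi j :: real) = 2 powi k"
        using cube_of_side_unique[OF _ Q(2)] third_cell_side Q(1) by blast
      then have "j = k" using two_powi_le_iff[of j k] two_powi_le_iff[of k j] by simp
      then show "Q \<in> range (third_cell A k)" using Q by blast
    qed
  qed
  show "partition_on UNIV {Q \<in> third_grid A. cube_of_side (2 powi k) Q}"
    unfolding eq
  proof (rule partition_onI)
    show "\<Union>(range (third_cell A k)) = UNIV" by (auto simp: third_cell_def)
    show "{} \<notin> range (third_cell A k)"
      using cube_of_side_nonempty[OF third_cell_side] by blast
    show "disjnt p q" if "p \<in> range (third_cell A k)" "q \<in> range (third_cell A k)" "p \<noteq> q" for p q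
      using that by (auto simp: third_cell_def disjnt_def)
  qed
qed

text \<open>An interval of length at most 1/3 with an integer \<open>N\<close> strictly between its
  ends stays strictly within distance 1/3 of \<open>N\<close>, and so meets no endpoint of the grid
  shifted by 1/3 in either direction.\<close>

lemma floor_shift_by_third:
  fixes t h y s :: real
  assumes h: "h \<le> 1/3" and s: "s = 1/3 \<or> s = - 1/3" and cross: "of_int \<lfloor>t\<rfloor> + 1 < t + h"
    and y: "t \<le> y" "y < t + h"
  shows "\<lfloor>y - s\<rfloor> = \<lfloor>t - s\<rfloor>"
proof -
  define N where "N = \<lfloor>t\<rfloor> + 1"
  have N: "t < of_int N" "of_int N < t + h" using cross by (simp_all add: N_def)
  from s show ?thesis
  proof
    assume s: "s = 1/3"
    have "\<lfloor>y - s\<rfloor> = N - 1" "\<lfloor>t - s\<rfloor> = N - 1"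
      using N y h by (simp_all add: s floor_eq_iff)
    then show ?thesis by simp
  next
    assume s: "s = - 1/3"
    have "\<lfloor>y - s\<rfloor> = N" "\<lfloor>t - s\<rfloor> = N"
      using N y h by (simp_all add: s floor_eq_iff)
    then show ?thesis by simp
  qed
qed

lemma cube_in_third_grid:
  fixes Q :: "(real ^ 'n) set"
  assumes "is_cube Q"
  obtains A R where "R \<in> third_grid A" "Q \<subseteq> R"
    "measure lebesgue R \<le> 6 ^ CARD('n) * measure lebesgue Q"
proof -
  obtain a l where l: "0 < l" and Q: "Q = cube a l"
    using assms by (auto simp: is_cube_def cube_of_side_iff)
  \<comment> \<open>Rounding up gives \<open>3 * l \<le> L < 6 * l\<close>: the cube is at most a
    third of a cell, and the cell at most six times the cube in each direction.\<close>
  define k where "k = \<lceil>log 2 (3 * l)\<rceil>"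
  define L :: real where "L = 2 powi k"
  have L: "L = 2 powr k" by (simp add: L_def powr_real_of_int')
  have L0: "0 < L" by (simp add: L_def)
  have "log 2 (3 * l) \<le> k" "k < log 2 (3 * l) + 1" unfolding k_def by linarith+
  then have "2 powr (log 2 (3 * l)) \<le> L" "L < 2 powr (log 2 (3 * l) + 1)"
    unfolding L by simp_all
  then have L1: "3 * l \<le> L" and L2: "L < 6 * l"
    using l by (simp_all add: powr_add)
  \<comment> \<open>The coordinates in which the cube crosses an endpoint of the unshifted grid. The
    inequality is strict because a half-open cube may end at such a point without leaving the
    cell.\<close>
  define A where "A = {i. of_int (\<lfloor>a $ i / L\<rfloor> + 1) < (a $ i + l) / L}"
  define R where "R = third_cell A k (grid_index A k a)"
  have R: "R \<in> third_grid A" by (auto simp: R_def third_grid_def)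
  have "Q \<subseteq> R"
  proof
    fix y assume "y \<in> Q"
    have "grid_index A k y i = grid_index A k a i" for i
    proof -
      have y: "a $ i \<le> y $ i" "y $ i < a $ i + l" using \<open>y \<in> Q\<close> unfolding Q cube_def by blast+
      have y': "a $ i / L \<le> y $ i / L" "y $ i / L < a $ i / L + l / L"
        using y L0 by (simp_all add: divide_right_mono divide_strict_right_mono flip: add_divide_distrib)
      show ?thesis
      proof (cases "i \<in> A")
        case True
        then have cross: "of_int \<lfloor>a $ i / L\<rfloor> + 1 < a $ i / L + l / L"
          by (simp add: A_def add_divide_distrib)
        have "l / L \<le> 1/3" using L1 L0 by (simp add: field_simps)
        from floor_shift_by_third[OF this _ cross y', of "third A k i"]
        show ?thesis using True by (simp add: grid_index_def third_def L_def)
      next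
        case False
        then have "a $ i / L + l / L \<le> of_int \<lfloor>a $ i / L\<rfloor> + 1"
          by (simp add: A_def add_divide_distrib)
        then have "\<lfloor>y $ i / L\<rfloor> = \<lfloor>a $ i / L\<rfloor>" using y' unfolding floor_eq_iff by linarith
        then show ?thesis using False by (simp add: grid_index_def third_def L_def)
      qed
    qed
    then show "y \<in> R" by (auto simp: R_def third_cell_def)
  qed
  moreover have "measure lebesgue R \<le> 6 ^ CARD('n) * measure lebesgue Q"
  proof -
    have "measure lebesgue R = L ^ CARD('n)"
      unfolding R_def L_def by (rule cube_of_side_measure[OF third_cell_side])
    also have "\<dots> \<le> (6 * l) ^ CARD('n)" using L0 L2 by (intro power_mono) auto
    finally show ?thesis using l by (simp add: Q measure_cube power_mult_distrib)
  qed
  ultimately show ?thesis using that R by blast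
qed

section \<open>Maximal operators over arbitrary families of cubes\<close>

definition grid_maximal_op :: "(real ^ 'n) set set \<Rightarrow> (real ^ 'n \<Rightarrow> real) \<Rightarrow> real ^ 'n \<Rightarrow> ennreal" where
  "grid_maximal_op D f x = (SUP Q \<in> {Q \<in> D. x \<in> Q}.
     ennreal (1 / measure lebesgue Q) * (\<integral>\<^sup>+y\<in>Q. ennreal \<bar>f y\<bar> \<partial>lebesgue))"

text \<open>The suitable grid varies with \<open>Q\<close>, so all shifted grids are summed. A
  containing cell has at most \<open>6 ^ CARD('n)\<close> times the measure, which bounds the loss
  in the average.\<close>

lemma maximal_op_le_grid_maximal_op:
  fixes f :: "real ^ 'n \<Rightarrow> real"
  shows "maximal_op f x \<le> (\<Sum>A\<in>UNIV. ennreal (6 ^ CARD('n)) * grid_maximal_op (third_grid A) f x)"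
  unfolding maximal_op_def
proof (rule SUP_least)
  fix Q assume "Q \<in> {Q :: (real ^ 'n) set. is_cube Q \<and> x \<in> Q}"
  then have Q: "is_cube Q" "x \<in> Q" by auto
  obtain A R where R: "R \<in> third_grid A" "Q \<subseteq> R"
    "measure lebesgue R \<le> 6 ^ CARD('n) * measure lebesgue Q"
    using cube_in_third_grid[OF Q(1)] by blast
  have "is_cube R" using R(1) third_cell_side by (auto simp: third_grid_def is_cube_def)
  then have pos: "0 < measure lebesgue R" by (rule is_cube_measure_pos)
  have "1 / measure lebesgue Q \<le> 6 ^ CARD('n) * (1 / measure lebesgue R)"
    using R(3) pos is_cube_measure_pos[OF Q(1)] by (simp add: field_simps)
  then have "ennreal (1 / measure lebesgue Q) \<le> ennreal (6 ^ CARD('n)) * ennreal (1 / measure lebesgue R)"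
    by (subst ennreal_mult[symmetric]) (auto intro: ennreal_leI)
  moreover have "(\<integral>\<^sup>+y\<in>Q. ennreal \<bar>f y\<bar> \<partial>lebesgue) \<le> (\<integral>\<^sup>+y\<in>R. ennreal \<bar>f y\<bar> \<partial>lebesgue)"
    using R(2) by (intro nn_integral_mono mult_left_mono) (auto simp: indicator_def)
  ultimately have "ennreal (1 / measure lebesgue Q) * (\<integral>\<^sup>+y\<in>Q. ennreal \<bar>f y\<bar> \<partial>lebesgue)
    \<le> ennreal (6 ^ CARD('n)) * ennreal (1 / measure lebesgue R) * (\<integral>\<^sup>+y\<in>R. ennreal \<bar>f y\<bar> \<partial>lebesgue)"
    by (intro mult_mono) auto
  also have "\<dots> \<le> ennreal (6 ^ CARD('n)) * grid_maximal_op (third_grid A) f x"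
    unfolding mult.assoc grid_maximal_op_def using R Q
    by (intro mult_left_mono SUP_upper) auto
  also have "\<dots> \<le> (\<Sum>A\<in>UNIV. ennreal (6 ^ CARD('n)) * grid_maximal_op (third_grid A) f x)"
    by (rule member_le_sum) auto
  finally show "(\<integral>\<^sup>+y\<in>Q. ennreal \<bar>f y\<bar> \<partial>lebesgue) / emeasure lebesgue Q
    \<le> (\<Sum>A\<in>UNIV. ennreal (6 ^ CARD('n)) * grid_maximal_op (third_grid A) f x)"
    unfolding average_eq[OF Q(1)] .
qed

section \<open>Boundedness on the associate space\<close>

lemma bfs_norm_sum_indicator:
  assumes "\<And>Q. Q \<in> S \<Longrightarrow> 0 \<le> \<alpha> Q"
  shows "bfs_norm \<rho> (\<lambda>x. \<Sum>Q\<in>S. \<alpha> Q * indicator (A Q) x) =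
    \<rho> (\<lambda>x. ennreal (\<Sum>Q\<in>S. \<alpha> Q * indicator (A Q) x))"
proof -
  have "0 \<le> (\<Sum>Q\<in>S. \<alpha> Q * indicator (A Q) x)" for x
    using assms by (intro sum_nonneg) (auto simp: indicator_def)
  then show ?thesis by (simp add: bfs_norm_def)
qed

text \<open>With indicators the index set no longer depends on \<open>x\<close>, so the operator
  becomes a supremum of measurable functions and respects unions of families.\<close>

lemma grid_maximal_op_eq:
  "grid_maximal_op D f x = (SUP Q\<in>D.
     ennreal (1 / measure lebesgue Q) * (\<integral>\<^sup>+y\<in>Q. ennreal \<bar>f y\<bar> \<partial>lebesgue) * indicator Q x)"
  (is "_ = (SUP Q\<in>D. ?c Q * indicator Q x)")
  unfolding grid_maximal_op_def
proof (rule antisym)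
  show "(SUP Q\<in>{Q \<in> D. x \<in> Q}. ?c Q) \<le> (SUP Q\<in>D. ?c Q * indicator Q x)"
  proof (rule SUP_least)
    fix Q assume "Q \<in> {Q \<in> D. x \<in> Q}"
    then show "?c Q \<le> (SUP Q\<in>D. ?c Q * indicator Q x)"
      by (intro SUP_upper2[of Q]) auto
  qed
  show "(SUP Q\<in>D. ?c Q * indicator Q x) \<le> (SUP Q\<in>{Q \<in> D. x \<in> Q}. ?c Q)"
  proof (rule SUP_least)
    fix Q assume "Q \<in> D"
    then show "?c Q * indicator Q x \<le> (SUP Q\<in>{Q \<in> D. x \<in> Q}. ?c Q)"
      by (cases "x \<in> Q") (auto intro: SUP_upper2[of Q])
  qed
qed

lemma borel_measurable_grid_maximal_op:
  assumes "countable D" "D \<subseteq> sets lebesgue"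
  shows "grid_maximal_op D f \<in> borel_measurable lebesgue"
  unfolding grid_maximal_op_eq[abs_def]
  using assms by (intro borel_measurable_SUP borel_measurable_times_ennreal borel_measurable_indicator) auto

text \<open>The \<open>l\<close>-th cells contribute \<open>c a\<^sup>-\<^sup>l\<^sup>\<delta>\<close> times the full norm, so for large \<open>a\<close> the terms with
  \<open>l \<ge> 1\<close> are absorbed and only the pairwise disjoint cells with \<open>l = 0\<close> remain.\<close>

lemma sum_cubes_absorption:
  fixes \<rho> :: "(real ^ 'n \<Rightarrow> ennreal) \<Rightarrow> ennreal"
  assumes bfn: "banach_function_norm \<rho>" and S: "finite S" "\<And>Q. Q \<in> S \<Longrightarrow> is_cube Q"
    and \<alpha>: "\<And>Q. Q \<in> S \<Longrightarrow> 0 \<le> \<alpha> Q" and c: "0 < c"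
    and G: "\<And>l Q. Q \<in> S \<Longrightarrow> G l Q \<in> sets lebesgue"
    and split: "\<And>Q x. Q \<in> S \<Longrightarrow> indicator Q x = (\<Sum>l<N::nat. indicator (G l Q) x :: real)"
    and decay: "\<And>l. \<rho> (\<lambda>x. ennreal (\<Sum>Q\<in>S. \<alpha> Q * indicator (G l Q) x)) \<le>
        ennreal (c * r ^ l) * \<rho> (\<lambda>x. ennreal (\<Sum>Q\<in>S. \<alpha> Q * indicator Q x))"
    and r: "0 < r" "r \<le> 1/2" "c * r \<le> 1/4"
  shows "\<rho> (\<lambda>x. ennreal (\<Sum>Q\<in>S. \<alpha> Q * indicator Q x)) \<le>
    2 * \<rho> (\<lambda>x. ennreal (\<Sum>Q\<in>S. \<alpha> Q * indicator (G 0 Q) x))"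
proof -
  let ?\<phi> = "\<lambda>x. \<Sum>Q\<in>S. \<alpha> Q * indicator Q x"
  let ?\<phi>l = "\<lambda>l x. \<Sum>Q\<in>S. \<alpha> Q * indicator (G l Q) x"
  note cube_sets = is_cube_sets[OF S(2)] and cube_bounded = is_cube_bounded[OF S(2)]
  have fin: "\<rho> (\<lambda>x. ennreal (?\<phi> x)) < \<infinity>"
    using S(1) \<alpha> cube_sets cube_bounded by (intro bfn_sum_indicator_finite[OF bfn]) auto
  then obtain p where p: "0 \<le> p" "\<rho> (\<lambda>x. ennreal (?\<phi> x)) = ennreal p"
    by (cases "\<rho> (\<lambda>x. ennreal (?\<phi> x))") auto
  have l0: "0 \<le> ?\<phi>l l x" for l x using \<alpha> by (intro sum_nonneg) (auto simp: indicator_def)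
  have "?\<phi> x = (\<Sum>l<N. ?\<phi>l l x)" for x
    using split by (subst sum.swap) (simp add: sum_distrib_left[symmetric])
  then have eq: "ennreal (?\<phi> x) = (\<Sum>l<N. ennreal (?\<phi>l l x))" for x
    using l0 by (simp add: sum_ennreal)
  have m: "(\<lambda>x. ennreal (?\<phi>l l x)) \<in> borel_measurable lebesgue" for l
    using G by (intro measurable_compose[OF _ measurable_ennreal] borel_measurable_sum_indicator) auto
  let ?p0 = "\<rho> (\<lambda>x. ennreal (?\<phi>l 0 x))"
  have "ennreal p \<le> (\<Sum>l<N. \<rho> (\<lambda>x. ennreal (?\<phi>l l x)))"
    unfolding p(2)[symmetric] eq using m by (intro bfn_sum[OF bfn]) auto
  \<comment> \<open>One extra term ensures that there is a term \<open>l = 0\<close> to split off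
    even if \<open>N\<close> is zero.\<close>
  also have "\<dots> \<le> (\<Sum>l<Suc N. \<rho> (\<lambda>x. ennreal (?\<phi>l l x)))"
    by (intro sum_mono2) auto
  also have "\<dots> = ?p0 + (\<Sum>l<N. \<rho> (\<lambda>x. ennreal (?\<phi>l (Suc l) x)))"
    by (rule sum.lessThan_Suc_shift)
  also have "\<dots> \<le> ?p0 + (\<Sum>l<N. ennreal (c * r ^ Suc l * p))"
  proof (intro add_left_mono sum_mono)
    fix l
    have "ennreal (c * r ^ Suc l) * ennreal p = ennreal (c * r ^ Suc l * p)"
      using c r p by (intro ennreal_mult[symmetric]) auto
    then show "\<rho> (\<lambda>x. ennreal (?\<phi>l (Suc l) x)) \<le> ennreal (c * r ^ Suc l * p)"
      using decay[of "Suc l"] p(2) by simp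
  qed
  also have "(\<Sum>l<N. ennreal (c * r ^ Suc l * p)) = ennreal (\<Sum>l<N. c * r ^ Suc l * p)"
    using c r p by (intro sum_ennreal) auto
  \<comment> \<open>The geometric sum is at most 2 since \<open>r \<le> 1/2\<close>, and
    \<open>c * r \<le> 1/4\<close> reduces the tail to half of \<open>p\<close>, which can be
    subtracted because \<open>p\<close> is finite.\<close>
  also have "?p0 + \<dots> \<le> ?p0 + ennreal (p / 2)"
  proof (intro add_left_mono ennreal_leI)
    have "(\<Sum>l<N. r ^ l) \<le> (\<Sum>l. r ^ l)"
      using r by (intro sum_le_suminf summable_geometric) auto
    also have "\<dots> = 1 / (1 - r)" using r by (intro suminf_geometric) auto
    also have "\<dots> \<le> 2" using r by (simp add: field_simps)
    finally have "(c * r * p) * (\<Sum>l<N. r ^ l) \<le> (c * r * p) * 2"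
      using c r p by (intro mult_left_mono) auto
    also have "\<dots> = (c * r) * (p * 2)" by simp
    also have "\<dots> \<le> 1/4 * (p * 2)" using r p by (intro mult_right_mono) auto
    also have "(c * r * p) * (\<Sum>l<N. r ^ l) = (\<Sum>l<N. c * r ^ Suc l * p)"
      by (simp add: sum_distrib_left mult_ac)
    finally show "(\<Sum>l<N. c * r ^ Suc l * p) \<le> p / 2" by simp
  qed
  finally have le: "ennreal p \<le> ?p0 + ennreal (p / 2)" .
  show ?thesis
  proof (cases ?p0)
    case (real q)
    then have "ennreal p \<le> ennreal (q + p / 2)" using le p by simp
    then have "p \<le> q + p / 2" using real p by (subst (asm) ennreal_le_iff) auto
    then have "p \<le> 2 * q" by simp
    then have "ennreal p \<le> ennreal (2 * q)" by (rule ennreal_leI)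
    then show ?thesis using real p by (simp add: ennreal_mult)
  qed (simp add: ennreal_mult_top)
qed

text \<open>Linearisation bounds the pairing with \<open>g\<close> by \<open>a\<close> times the
  integral of \<open>\<bar>f\<bar>\<close> against the sum of \<open>\<alpha> Q\<close> times the
  indicator of \<open>Q\<close>. By Hoelder's inequality only the norm of that sum matters;
  absorption and the bound for \<open>M g\<close> make it at most \<open>2 * C\<close>.\<close>

lemma finite_grid_maximal_bound:
  fixes \<rho> :: "(real ^ 'n \<Rightarrow> ennreal) \<Rightarrow> ennreal" and f g :: "real ^ 'n \<Rightarrow> real"
  assumes bfn: "banach_function_norm \<rho>" and D: "dyadic_grid D" and F: "finite F" "F \<subseteq> D"
    and a: "1 < a" "\<eta> \<le> 1 - 1 / a" and C: "0 < C" and c: "0 < c" and \<delta>: "0 < \<delta>"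
    and r: "(1 / a) powr \<delta> \<le> 1/2" "c * (1 / a) powr \<delta> \<le> 1/4"
    and M: "\<And>f. f \<in> bfs \<rho> \<Longrightarrow> \<rho> (maximal_op f) \<le> ennreal C * bfs_norm \<rho> f"
    and decay: "\<And>S \<alpha> G. S \<subseteq> D \<Longrightarrow> finite S \<Longrightarrow> S \<noteq> {} \<Longrightarrow> sparse_family \<eta> S \<Longrightarrow>
      (\<And>Q. Q \<in> S \<Longrightarrow> 0 \<le> \<alpha> Q) \<Longrightarrow> (\<And>Q. Q \<in> S \<Longrightarrow> G Q \<in> sets lebesgue \<and> G Q \<subseteq> Q) \<Longrightarrow>
      disjoint_family_on G S \<Longrightarrow>
      \<rho> (\<lambda>x. ennreal (\<Sum>Q\<in>S. \<alpha> Q * indicator (G Q) x)) \<le>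
        ennreal (c * (MAX Q\<in>S. measure lebesgue (G Q) / measure lebesgue Q) powr \<delta>) *
        \<rho> (\<lambda>x. ennreal (\<Sum>Q\<in>S. \<alpha> Q * indicator Q x))"
    and f: "f \<in> bfs (associate_norm \<rho>)"
    and g: "g \<in> borel_measurable lebesgue" "\<And>x. 0 \<le> g x" "\<rho> (\<lambda>x. ennreal (g x)) \<le> 1"
  shows "(\<integral>\<^sup>+x. grid_maximal_op F f x * ennreal (g x) \<partial>lebesgue)
    \<le> ennreal (2 * a * C) * bfs_norm (associate_norm \<rho>) f"
proof -
  have fm: "(\<lambda>x. ennreal \<bar>f x\<bar>) \<in> borel_measurable lebesgue"
    and fn: "associate_norm \<rho> (\<lambda>x. ennreal \<bar>f x\<bar>) < \<infinity>"
    using f by (auto simp: bfs_def bfs_norm_def)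
  have gm: "(\<lambda>x. ennreal (g x)) \<in> borel_measurable lebesgue" using g by simp
  have gfin: "\<rho> (\<lambda>x. ennreal (g x)) < \<infinity>" using g(3) by (rule le_less_trans) simp
  have cube: "is_cube Q" if "Q \<in> D" for Q using dyadic_grid_is_cube[OF D that] .
  note cube_sets = is_cube_sets[OF cube] and cube_bounded = is_cube_bounded[OF cube]
    and cube_pos = is_cube_measure_pos[OF cube]
  have fint: "(\<integral>\<^sup>+y\<in>Q. ennreal \<bar>f y\<bar> \<partial>lebesgue) < \<infinity>" if "Q \<in> D" for Q
    by (rule associate_norm_locally_integrable[OF bfn fm fn cube_sets[OF that] cube_bounded[OF that]])
  have gint: "(\<integral>\<^sup>+y\<in>Q. ennreal (g y) \<partial>lebesgue) < \<infinity>" if Q: "Q \<in> D" for Q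
  proof -
    obtain b where b: "b < \<infinity>"
      "\<And>f. f \<in> borel_measurable lebesgue \<Longrightarrow> (\<integral>\<^sup>+x\<in>Q. f x \<partial>lebesgue) \<le> b * \<rho> f"
      using bfn_locally_integrable[OF bfn cube_sets[OF Q] cube_bounded[OF Q]] by metis
    have "(\<integral>\<^sup>+y\<in>Q. ennreal (g y) \<partial>lebesgue) \<le> b * \<rho> (\<lambda>x. ennreal (g x))" by (rule b(2)[OF gm])
    also have "\<dots> < \<infinity>" using b gfin by (simp add: ennreal_mult_less_top)
    finally show ?thesis .
  qed
  define \<mu> where "\<mu> = density lebesgue (\<lambda>x. ennreal \<bar>f x\<bar>)"
  define u where "u Q = measure \<mu> Q" for Q
  have em: "emeasure \<mu> Q = (\<integral>\<^sup>+y\<in>Q. ennreal \<bar>f y\<bar> \<partial>lebesgue)" if "Q \<in> D" for Q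
    unfolding \<mu>_def using fm cube_sets[OF that] by (rule emeasure_density)
  have \<mu>fin: "Q \<in> fmeasurable \<mu>" if "Q \<in> D" for Q
    using em[OF that] fint[OF that] cube_sets[OF that] by (auto simp: fmeasurable_def \<mu>_def)
  have u: "(\<integral>\<^sup>+y\<in>Q. ennreal \<bar>f y\<bar> \<partial>lebesgue) = ennreal (u Q)" if "Q \<in> D" for Q
    using em[OF that] emeasure_eq_measure2[OF \<mu>fin[OF that]] by (simp add: u_def)
  interpret P: principal_cubes D F u a
  proof
    show "sum u \<P> \<le> u Q" if P: "finite \<P>" "disjoint \<P>" "Q \<in> D" "\<P> \<subseteq> {P \<in> D. P \<subseteq> Q}" for \<P> Q
    proof -
      have "sum u \<P> = measure \<mu> (\<Union>\<P>)"
        unfolding u_def using P \<mu>fin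
        by (subst measure_Union') (auto simp: disjoint_def pairwise_def disjnt_def)
      also have "\<dots> \<le> u Q"
        unfolding u_def using P \<mu>fin
        by (intro measure_mono_fmeasurable) (auto intro!: sets.finite_Union)
      finally show ?thesis .
    qed
  qed (use D F a in \<open>auto simp: u_def\<close>)
  define S where "S = P.principal"
  have SF: "S \<subseteq> F" using P.principal_subset by (simp add: S_def)
  then have SD: "S \<subseteq> D" and Sfin: "finite S" using F finite_subset by auto
  have cell: "P.cell l Q \<in> sets lebesgue" "P.cell l Q \<subseteq> Q"
    "measure lebesgue (P.cell l Q) \<le> (1 / a) ^ l * measure lebesgue Q" if "Q \<in> S" for l Q
    using that P.cell_sets P.cell_subset P.cell_measure by (auto simp: S_def)
  have cell_int: "(\<integral>\<^sup>+y\<in>P.cell 0 Q. ennreal (g y) \<partial>lebesgue) \<le> (\<integral>\<^sup>+y\<in>Q. ennreal (g y) \<partial>lebesgue)"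
    if "Q \<in> S" for Q
    using cell(2)[OF that, of 0] by (intro nn_integral_mono mult_left_mono) (auto simp: indicator_def)
  \<comment> \<open>These coefficients transfer the average from \<open>f\<close> to
    \<open>g\<close>. The integral is finite because a function of finite norm is locally
    integrable, so \<open>enn2real\<close> loses nothing.\<close>
  define \<alpha> where "\<alpha> Q = enn2real (\<integral>\<^sup>+y\<in>P.cell 0 Q. ennreal (g y) \<partial>lebesgue) / measure lebesgue Q" for Q
  have \<alpha>0: "0 \<le> \<alpha> Q" for Q by (simp add: \<alpha>_def)
  have \<alpha>: "(\<integral>\<^sup>+y\<in>P.cell 0 Q. ennreal (g y) \<partial>lebesgue) = ennreal (\<alpha> Q * measure lebesgue Q)"
    if Q: "Q \<in> S" for Q
  proof -
    have QD: "Q \<in> D" using Q SD by blast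
    have "(\<integral>\<^sup>+y\<in>P.cell 0 Q. ennreal (g y) \<partial>lebesgue) < \<infinity>"
      using cell_int[OF Q] gint[OF QD] by (rule le_less_trans)
    then show ?thesis using cube_pos[OF QD] by (simp add: \<alpha>_def)
  qed
  let ?\<phi> = "\<lambda>x. \<Sum>Q\<in>S. \<alpha> Q * indicator Q x"
  let ?\<phi>l = "\<lambda>l x. \<Sum>Q\<in>S. \<alpha> Q * indicator (P.cell l Q) x"
  have disj: "disjoint_family_on (P.cell l) S" for l using P.cell_disjoint by (simp add: S_def)
  obtain N where N: "P.V N = {}" by (rule P.gen_terminates)
  \<comment> \<open>The empty family is separated, since the maximum over the empty set has no
    specified value.\<close>
  have main: "\<rho> (\<lambda>x. ennreal (?\<phi> x)) \<le> 2 * \<rho> (\<lambda>x. ennreal (?\<phi>l 0 x))"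
  proof (cases "S = {}")
    case True
    have "\<rho> (\<lambda>x. 0) = 0" by (subst bfn_zero_iff[OF bfn]) auto
    then show ?thesis using True by simp
  next
    case False
    show ?thesis
    proof (rule sum_cubes_absorption[OF bfn Sfin])
      show "is_cube Q" if "Q \<in> S" for Q using cube that SD by blast
      show "P.cell l Q \<in> sets lebesgue" if "Q \<in> S" for l Q using cell that by blast
      show "indicator Q x = (\<Sum>l<N. indicator (P.cell l Q) x :: real)" if "Q \<in> S" for Q x
        using P.cell_decomposition[OF _ N] that by (simp add: S_def)
      have sparse: "sparse_family \<eta> S"
        unfolding sparse_family_def
      proof (intro exI[of _ "P.cell 0"] conjI ballI disj)
        fix Q assume Q: "Q \<in> S"
        have "\<eta> * measure lebesgue Q \<le> (1 - 1 / a) * measure lebesgue Q"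
          using a by (intro mult_right_mono) auto
        also have "\<dots> \<le> measure lebesgue (P.cell 0 Q)" using P.cell_sparse Q by (simp add: S_def)
        finally show "\<eta> * measure lebesgue Q \<le> measure lebesgue (P.cell 0 Q)" .
      qed (use cell in auto)
      show "\<rho> (\<lambda>x. ennreal (?\<phi>l l x)) \<le> ennreal (c * ((1 / a) powr \<delta>) ^ l) * \<rho> (\<lambda>x. ennreal (?\<phi> x))" for l
      proof -
        let ?m = "MAX Q\<in>S. measure lebesgue (P.cell l Q) / measure lebesgue Q"
        have "?m \<in> (\<lambda>Q. measure lebesgue (P.cell l Q) / measure lebesgue Q) ` S"
          using Sfin False by (intro Max_in) auto
        then have m0: "0 \<le> ?m" by auto
        have m1: "?m \<le> (1 / a) ^ l"
          using Sfin False
        proof (intro Max.boundedI)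
          fix t assume "t \<in> (\<lambda>Q. measure lebesgue (P.cell l Q) / measure lebesgue Q) ` S"
          then obtain Q where Q: "Q \<in> S" "t = measure lebesgue (P.cell l Q) / measure lebesgue Q" by blast
          then show "t \<le> (1 / a) ^ l"
            using cell(3)[OF Q(1), of l] cube_pos[of Q] SD by (auto simp: pos_divide_le_eq)
        qed auto
        \<comment> \<open>The \<open>l\<close>-th cells fill at most \<open>(1 / a) ^ l\<close> of
          their cubes, so the assumed decay becomes geometric in \<open>l\<close> with ratio
          \<open>(1 / a) powr \<delta>\<close>.\<close>
        have "?m powr \<delta> \<le> ((1 / a) ^ l) powr \<delta>" using m0 m1 \<delta> by (intro powr_mono2) auto
        also have "\<dots> = ((1 / a) powr \<delta>) ^ l"
          using a by (simp add: powr_realpow[symmetric] powr_powr mult.commute)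
        finally have "c * ?m powr \<delta> \<le> c * ((1 / a) powr \<delta>) ^ l" using c by (intro mult_left_mono) auto
        then have "ennreal (c * ?m powr \<delta>) * \<rho> (\<lambda>x. ennreal (?\<phi> x))
          \<le> ennreal (c * ((1 / a) powr \<delta>) ^ l) * \<rho> (\<lambda>x. ennreal (?\<phi> x))"
          by (intro mult_right_mono ennreal_leI) auto
        moreover have "\<rho> (\<lambda>x. ennreal (?\<phi>l l x)) \<le> ennreal (c * ?m powr \<delta>) * \<rho> (\<lambda>x. ennreal (?\<phi> x))"
          using cell \<alpha>0 by (intro decay[OF SD Sfin False sparse _ _ disj]) auto
        ultimately show ?thesis by (rule order_trans[rotated])
      qed
    qed (use \<alpha>0 c r a in auto)
  qed
  \<comment> \<open>By disjointness at most one term survives at a point, and its coefficient is at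
    most the average of \<open>g\<close> over a cube containing the point.\<close>
  have \<phi>M: "\<rho> (\<lambda>x. ennreal (?\<phi>l 0 x)) \<le> \<rho> (maximal_op g)"
  proof (rule bfn_mono[OF bfn borel_measurable_maximal_op])
    show "(\<lambda>x. ennreal (?\<phi>l 0 x)) \<in> borel_measurable lebesgue"
      using cell by (intro measurable_compose[OF _ measurable_ennreal] borel_measurable_sum_indicator) auto
    show "ennreal (?\<phi>l 0 x) \<le> maximal_op g x" for x
    proof (cases "\<exists>Q\<in>S. x \<in> P.cell 0 Q")
      case True
      then obtain Q where Q: "Q \<in> S" "x \<in> P.cell 0 Q" by blast
      have QD: "Q \<in> D" using Q SD by blast
      have "x \<notin> P.cell 0 R" if "R \<in> S - {Q}" for R
        using disj[of 0] Q that by (auto simp: disjoint_family_on_def)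
      then have eq: "?\<phi>l 0 x = \<alpha> Q"
        using Q by (subst sum.remove[OF Sfin Q(1)]) simp
      have "ennreal (\<alpha> Q) = ennreal (1 / measure lebesgue Q) * ennreal (\<alpha> Q * measure lebesgue Q)"
        using cube_pos[OF QD] \<alpha>0[of Q] by (subst ennreal_mult[symmetric]) auto
      also have "\<dots> \<le> ennreal (1 / measure lebesgue Q) * (\<integral>\<^sup>+y\<in>Q. ennreal (g y) \<partial>lebesgue)"
        using cell_int[OF Q(1)] \<alpha>[OF Q(1)] by (intro mult_left_mono) auto
      also have "\<dots> \<le> maximal_op g x"
        using maximal_op_ge_average[OF cube[OF QD], of x g] cell(2)[OF Q(1)] Q(2) g(2) by auto
      finally have "ennreal (\<alpha> Q) \<le> maximal_op g x" .
      with eq show ?thesis by simp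
    next
      case False
      then have "?\<phi>l 0 x = 0" by (intro sum.neutral) auto
      then show ?thesis by simp
    qed
  qed
  have gb: "bfs_norm \<rho> g = \<rho> (\<lambda>x. ennreal (g x))" using g(2) by (simp add: bfs_norm_def)
  have "\<rho> (maximal_op g) \<le> ennreal C * bfs_norm \<rho> g"
    using g(1) gfin gb by (intro M) (auto simp: bfs_def)
  also have "\<dots> \<le> ennreal C * 1" unfolding gb using g(3) by (intro mult_left_mono) auto
  finally have "2 * \<rho> (\<lambda>x. ennreal (?\<phi>l 0 x)) \<le> 2 * ennreal C"
    using \<phi>M by (intro mult_left_mono) auto
  with main have \<phi>n: "\<rho> (\<lambda>x. ennreal (?\<phi> x)) \<le> 2 * ennreal C" by (rule order_trans)
  have "(\<integral>\<^sup>+x. grid_maximal_op F f x * ennreal (g x) \<partial>lebesgue)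
    \<le> (\<integral>\<^sup>+x. ennreal (\<Sum>Q\<in>S. (a * P.avg Q) * indicator (P.cell 0 Q) x) * ennreal (g x) \<partial>lebesgue)"
  proof (intro nn_integral_mono mult_right_mono)
    fix x
    show "grid_maximal_op F f x \<le> ennreal (\<Sum>Q\<in>S. (a * P.avg Q) * indicator (P.cell 0 Q) x)"
      unfolding grid_maximal_op_def
    proof (rule SUP_least)
      fix R assume "R \<in> {R \<in> F. x \<in> R}"
      then have R: "R \<in> F" "x \<in> R" by auto
      then have RD: "R \<in> D" using F by blast
      obtain Q where Q: "Q \<in> S" "x \<in> P.cell 0 Q" "P.avg R \<le> a * P.avg Q"
        using P.avg_dominated[OF R] by (auto simp: S_def)
      have "ennreal (1 / measure lebesgue R) * (\<integral>\<^sup>+y\<in>R. ennreal \<bar>f y\<bar> \<partial>lebesgue) = ennreal (P.avg R)"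
        unfolding u[OF RD] P.avg_def by (subst ennreal_mult[symmetric]) (auto simp: u_def)
      also have "\<dots> \<le> ennreal ((a * P.avg Q) * indicator (P.cell 0 Q) x)"
        using Q by (intro ennreal_leI) simp
      also have "\<dots> \<le> ennreal (\<Sum>Q\<in>S. (a * P.avg Q) * indicator (P.cell 0 Q) x)"
        using Q(1) Sfin a P.avg_nonneg
        by (intro ennreal_leI member_le_sum) (auto simp: indicator_def)
      finally show "ennreal (1 / measure lebesgue R) * (\<integral>\<^sup>+y\<in>R. ennreal \<bar>f y\<bar> \<partial>lebesgue)
        \<le> ennreal (\<Sum>Q\<in>S. (a * P.avg Q) * indicator (P.cell 0 Q) x)" .
    qed
  qed simp
  also have "\<dots> = (\<Sum>Q\<in>S. ennreal (a * P.avg Q) * (\<integral>\<^sup>+x\<in>P.cell 0 Q. ennreal (g x) \<partial>lebesgue))"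
    using Sfin a P.avg_nonneg cell gm by (intro nn_integral_sum_indicator) auto
  also have "\<dots> = (\<Sum>Q\<in>S. ennreal a * (ennreal (\<alpha> Q) * (\<integral>\<^sup>+y\<in>Q. ennreal \<bar>f y\<bar> \<partial>lebesgue)))"
  proof (rule sum.cong)
    fix Q assume Q: "Q \<in> S"
    then have QD: "Q \<in> D" using SD by blast
    have "ennreal (a * P.avg Q) * ennreal (\<alpha> Q * measure lebesgue Q)
      = ennreal ((a * P.avg Q) * (\<alpha> Q * measure lebesgue Q))"
      using a P.avg_nonneg \<alpha>0 by (intro ennreal_mult[symmetric]) auto
    also have "(a * P.avg Q) * (\<alpha> Q * measure lebesgue Q) = a * (\<alpha> Q * u Q)"
      using cube_pos[OF QD] by (simp add: P.avg_def)
    also have "ennreal \<dots> = ennreal a * (ennreal (\<alpha> Q) * ennreal (u Q))"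
      using a \<alpha>0 P.u_nonneg by (simp add: ennreal_mult)
    finally show "ennreal (a * P.avg Q) * (\<integral>\<^sup>+x\<in>P.cell 0 Q. ennreal (g x) \<partial>lebesgue)
      = ennreal a * (ennreal (\<alpha> Q) * (\<integral>\<^sup>+y\<in>Q. ennreal \<bar>f y\<bar> \<partial>lebesgue))"
      using u[OF QD] \<alpha>[OF Q] by simp
  qed simp
  also have "\<dots> = ennreal a * (\<Sum>Q\<in>S. ennreal (\<alpha> Q) * (\<integral>\<^sup>+y\<in>Q. ennreal \<bar>f y\<bar> \<partial>lebesgue))"
    by (rule sum_distrib_left[symmetric])
  also have "(\<Sum>Q\<in>S. ennreal (\<alpha> Q) * (\<integral>\<^sup>+y\<in>Q. ennreal \<bar>f y\<bar> \<partial>lebesgue))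
    = (\<integral>\<^sup>+x. ennreal (?\<phi> x) * ennreal \<bar>f x\<bar> \<partial>lebesgue)"
    using Sfin \<alpha>0 fm SD cube_sets by (intro nn_integral_sum_indicator[symmetric]) auto
  also have "\<dots> = (\<integral>\<^sup>+x. ennreal \<bar>f x\<bar> * ennreal (?\<phi> x) \<partial>lebesgue)"
    by (simp add: mult.commute)
  also have "\<dots> \<le> associate_norm \<rho> (\<lambda>x. ennreal \<bar>f x\<bar>) * \<rho> (\<lambda>x. ennreal (?\<phi> x))"
  proof (rule associate_norm_Hoelder[OF bfn fm])
    show "?\<phi> \<in> borel_measurable lebesgue" using SD cube_sets by (intro borel_measurable_sum_indicator) auto
    show "0 \<le> ?\<phi> x" for x using \<alpha>0 by (intro sum_nonneg) (auto simp: indicator_def)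
    show "\<rho> (\<lambda>x. ennreal (?\<phi> x)) < \<infinity>"
      using \<phi>n by (rule le_less_trans) (simp add: ennreal_mult_less_top)
  qed
  also have "\<dots> \<le> associate_norm \<rho> (\<lambda>x. ennreal \<bar>f x\<bar>) * (2 * ennreal C)"
    using \<phi>n by (intro mult_left_mono) auto
  finally have "(\<integral>\<^sup>+x. grid_maximal_op F f x * ennreal (g x) \<partial>lebesgue)
    \<le> ennreal a * (associate_norm \<rho> (\<lambda>x. ennreal \<bar>f x\<bar>) * (2 * ennreal C))"
    by (simp add: mult_left_mono)
  also have "\<dots> = ennreal (2 * a * C) * bfs_norm (associate_norm \<rho>) f"
    using a C by (simp add: bfs_norm_def ennreal_mult mult_ac)
  finally show ?thesis .
qed

text \<open>A grid is countable, so its maximal operator is the increasing limit of those over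
  finite initial segments of an enumeration, and a uniform bound survives monotone
  convergence.\<close>

lemma grid_maximal_bound_from_finite:
  assumes D: "dyadic_grid D" and g: "g \<in> borel_measurable lebesgue"
    and fin: "\<And>F. finite F \<Longrightarrow> F \<subseteq> D \<Longrightarrow> (\<integral>\<^sup>+x. grid_maximal_op F f x * g x \<partial>lebesgue) \<le> B"
  shows "(\<integral>\<^sup>+x. grid_maximal_op D f x * g x \<partial>lebesgue) \<le> B"
proof -
  have ne: "D \<noteq> {}" using dyadic_grid_cover[OF D] by blast
  have cnt: "countable D" by (rule dyadic_grid_countable[OF D])
  have Ds: "D \<subseteq> sets lebesgue" using is_cube_sets[OF dyadic_grid_is_cube[OF D]] by blast
  define F where "F N = from_nat_into D ` {..<N}" for N :: nat
  have F: "finite (F N)" "F N \<subseteq> D" for N using from_nat_into[OF ne] by (auto simp: F_def)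
  have "(\<Union>N. F N) = range (from_nat_into D)" by (auto simp: F_def)
  then have FD: "(\<Union>N. F N) = D" using range_from_nat_into[OF ne cnt] by simp
  have "grid_maximal_op D f x = (SUP N. grid_maximal_op (F N) f x)" for x
    unfolding grid_maximal_op_eq by (subst FD[symmetric], rule SUP_UNION)
  then have "(\<integral>\<^sup>+x. grid_maximal_op D f x * g x \<partial>lebesgue)
    = (\<integral>\<^sup>+x. (SUP N. grid_maximal_op (F N) f x * g x) \<partial>lebesgue)"
    by (simp add: SUP_mult_right_ennreal)
  also have "\<dots> = (SUP N. (\<integral>\<^sup>+x. grid_maximal_op (F N) f x * g x \<partial>lebesgue))"
  proof (rule nn_integral_monotone_convergence_SUP)
    show "incseq (\<lambda>N x. grid_maximal_op (F N) f x * g x)"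
      unfolding grid_maximal_op_eq
      by (intro monoI le_funI mult_right_mono SUP_subset_mono) (auto simp: F_def)
    show "(\<lambda>x. grid_maximal_op (F N) f x * g x) \<in> borel_measurable lebesgue" for N
      using F[of N] Ds g
      by (intro borel_measurable_times_ennreal borel_measurable_grid_maximal_op countable_finite) auto
  qed
  also have "\<dots> \<le> B" using fin F by (intro SUP_least) auto
  finally show ?thesis .
qed

text \<open>The bound \<open>1 / (1 - \<eta>) \<le> a\<close> gives the sparsity, and
  \<open>max 2 (4 * c) \<le> a powr \<delta>\<close> gives both conditions needed for
  absorption.\<close>

lemma absorption_parameter_exists:
  fixes c \<delta> \<eta> :: real
  assumes "0 < c" "0 < \<delta>" "0 < \<eta>" "\<eta> < 1"
  obtains a :: real where "1 < a" "\<eta> \<le> 1 - 1 / a" "(1 / a) powr \<delta> \<le> 1/2" "c * (1 / a) powr \<delta> \<le> 1/4"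
proof -
  define b where "b = max 2 (4 * c)"
  define a where "a = max (1 / (1 - \<eta>)) (b powr (1 / \<delta>))"
  have a1: "1 / (1 - \<eta>) \<le> a" and a2: "b powr (1 / \<delta>) \<le> a" by (simp_all add: a_def)
  have "1 < 1 / (1 - \<eta>)" using assms by (simp add: field_simps)
  with a1 have a: "1 < a" by linarith
  have "1 / a \<le> 1 - \<eta>" using a1 a assms by (simp add: field_simps)
  then have \<eta>: "\<eta> \<le> 1 - 1 / a" by simp
  have "(b powr (1 / \<delta>)) powr \<delta> \<le> a powr \<delta>" using a2 assms by (intro powr_mono2) auto
  moreover have "(b powr (1 / \<delta>)) powr \<delta> = b" using assms by (simp add: powr_powr b_def)
  ultimately have b: "b \<le> a powr \<delta>" by simp
  have b2: "2 \<le> b" "4 * c \<le> b" by (simp_all add: b_def)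
  have inv: "(1 / a) powr \<delta> = 1 / a powr \<delta>" using a by (simp add: powr_divide)
  have inv_le: "1 / a powr \<delta> \<le> 1 / b" using b b2 by (intro divide_left_mono mult_pos_pos) auto
  have b3: "1 / b \<le> 1/2" "c * (1 / b) \<le> 1/4" using b2 by (simp_all add: field_simps)
  have "c * (1 / a powr \<delta>) \<le> c * (1 / b)"
    using inv_le assms by (intro mult_left_mono) auto
  with b3 inv_le have "1 / a powr \<delta> \<le> 1/2" "c * (1 / a powr \<delta>) \<le> 1/4" by linarith+
  then show ?thesis using that[OF a \<eta>] unfolding inv by blast
qed

lemma decay_imp_associate_maximal_bound:
  fixes \<rho> :: "(real ^ 'n \<Rightarrow> ennreal) \<Rightarrow> ennreal" and \<eta> c \<delta> :: real
  assumes bfn: "banach_function_norm \<rho>" and M: "maximal_op_bounded_on \<rho>"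
    and \<eta>: "0 < \<eta>" "\<eta> < 1" and c: "0 < c" and \<delta>: "0 < \<delta>"
    and decay: "\<And>D S \<alpha> G. dyadic_grid D \<Longrightarrow> S \<subseteq> D \<Longrightarrow> finite S \<Longrightarrow> S \<noteq> {} \<Longrightarrow> sparse_family \<eta> S \<Longrightarrow>
      (\<And>Q. Q \<in> S \<Longrightarrow> 0 \<le> \<alpha> Q) \<Longrightarrow> (\<And>Q. Q \<in> S \<Longrightarrow> G Q \<in> sets lebesgue \<and> G Q \<subseteq> Q) \<Longrightarrow>
      disjoint_family_on G S \<Longrightarrow>
      \<rho> (\<lambda>x. ennreal (\<Sum>Q\<in>S. \<alpha> Q * indicator (G Q) x)) \<le>
        ennreal (c * (MAX Q\<in>S. measure lebesgue (G Q) / measure lebesgue Q) powr \<delta>) *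
        \<rho> (\<lambda>x. ennreal (\<Sum>Q\<in>S. \<alpha> Q * indicator Q x))"
  shows "maximal_op_bounded_on (associate_norm \<rho>)"
proof -
  obtain C :: real where C: "0 < C" "\<And>f. f \<in> bfs \<rho> \<Longrightarrow> \<rho> (maximal_op f) \<le> ennreal C * bfs_norm \<rho> f"
    using M unfolding maximal_op_bounded_on_def by blast
  obtain a where a: "1 < a" "\<eta> \<le> 1 - 1 / a" "(1 / a) powr \<delta> \<le> 1/2" "c * (1 / a) powr \<delta> \<le> 1/4"
    by (rule absorption_parameter_exists[OF c \<delta> \<eta>])
  \<comment> \<open>The number of shifted grids, times the loss in passing to a containing cell,
    times the bound for a single grid.\<close>
  define K where "K = 2 ^ CARD('n) * (6 ^ CARD('n) * (2 * a * C))"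
  have "0 < K" using a C by (simp add: K_def)
  moreover have "associate_norm \<rho> (maximal_op f) \<le> ennreal K * bfs_norm (associate_norm \<rho>) f"
    if f: "f \<in> bfs (associate_norm \<rho>)" for f
  proof (rule associate_norm_leI)
    fix g :: "real ^ 'n \<Rightarrow> real"
    assume g: "g \<in> borel_measurable lebesgue" "\<And>x. 0 \<le> g x" "\<rho> (\<lambda>x. ennreal (g x)) \<le> 1"
    let ?B = "ennreal (2 * a * C) * bfs_norm (associate_norm \<rho>) f"
    let ?M = "\<lambda>A. grid_maximal_op (third_grid A :: (real ^ 'n) set set) f"
    have gm: "(\<lambda>x. ennreal (g x)) \<in> borel_measurable lebesgue" using g by simp
    have Mm: "?M A \<in> borel_measurable lebesgue" for A
      using dyadic_grid_countable[OF dyadic_grid_third_grid]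
        is_cube_sets[OF dyadic_grid_is_cube[OF dyadic_grid_third_grid]]
      by (intro borel_measurable_grid_maximal_op) blast+
    have grid: "(\<integral>\<^sup>+x. ?M A x * ennreal (g x) \<partial>lebesgue) \<le> ?B" for A
    proof (rule grid_maximal_bound_from_finite[OF dyadic_grid_third_grid gm])
      fix F :: "(real ^ 'n) set set" assume F: "finite F" "F \<subseteq> third_grid A"
      show "(\<integral>\<^sup>+x. grid_maximal_op F f x * ennreal (g x) \<partial>lebesgue) \<le> ?B"
        by (rule finite_grid_maximal_bound[OF bfn dyadic_grid_third_grid F a(1,2) C(1) c \<delta> a(3,4) C(2)
              decay[OF dyadic_grid_third_grid] f g])
    qed
    have "(\<integral>\<^sup>+x. maximal_op f x * ennreal (g x) \<partial>lebesgue)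
      \<le> (\<integral>\<^sup>+x. (\<Sum>A\<in>UNIV. ennreal (6 ^ CARD('n)) * (?M A x * ennreal (g x))) \<partial>lebesgue)"
    proof (rule nn_integral_mono)
      fix x
      have "maximal_op f x * ennreal (g x) \<le> (\<Sum>A\<in>UNIV. ennreal (6 ^ CARD('n)) * ?M A x) * ennreal (g x)"
        by (intro mult_right_mono maximal_op_le_grid_maximal_op) auto
      then show "maximal_op f x * ennreal (g x)
        \<le> (\<Sum>A\<in>UNIV. ennreal (6 ^ CARD('n)) * (?M A x * ennreal (g x)))"
        by (simp only: sum_distrib_right mult.assoc)
    qed
    also have "\<dots> = (\<Sum>A\<in>UNIV. (\<integral>\<^sup>+x. ennreal (6 ^ CARD('n)) * (?M A x * ennreal (g x)) \<partial>lebesgue))"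
      using Mm gm by (intro nn_integral_sum borel_measurable_times_ennreal borel_measurable_const) auto
    also have "\<dots> = (\<Sum>A\<in>UNIV. ennreal (6 ^ CARD('n)) * (\<integral>\<^sup>+x. ?M A x * ennreal (g x) \<partial>lebesgue))"
      using Mm gm by (intro sum.cong nn_integral_cmult borel_measurable_times_ennreal) auto
    also have "\<dots> \<le> (\<Sum>A\<in>(UNIV :: 'n set set). ennreal (6 ^ CARD('n)) * ?B)"
      using grid by (intro sum_mono mult_left_mono) auto
    also have "\<dots> = ennreal (2 ^ CARD('n)) * (ennreal (6 ^ CARD('n)) * ?B)"
      by (simp add: card_UNIV_set ennreal_of_nat_eq_real_of_nat)
    also have "\<dots> = ennreal K * bfs_norm (associate_norm \<rho>) f"
      using a C by (simp add: K_def ennreal_mult mult.assoc)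
    finally show "(\<integral>\<^sup>+x. maximal_op f x * ennreal (g x) \<partial>lebesgue)
      \<le> ennreal K * bfs_norm (associate_norm \<rho>) f" .
  qed
  ultimately show ?thesis unfolding maximal_op_bounded_on_def by blast
qed

theorem theorem3p1:
  fixes \<rho> :: "(real ^ 'n \<Rightarrow> ennreal) \<Rightarrow> ennreal" and \<eta> :: real
  assumes "banach_function_norm \<rho>"
    and "maximal_op_bounded_on \<rho>"
    and "0 < \<eta>" and "\<eta> < 1"
  shows "maximal_op_bounded_on (associate_norm \<rho>) \<longleftrightarrow>
    (\<exists>c \<delta> :: real. 0 < c \<and> 0 < \<delta> \<and>
      (\<forall>D S. dyadic_grid D \<and> S \<subseteq> D \<and> finite S \<and> sparse_family \<eta> S \<longrightarrow>
        (\<forall>(\<alpha> :: (real ^ 'n) set \<Rightarrow> real) (G :: (real ^ 'n) set \<Rightarrow> (real ^ 'n) set).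
          (\<forall>Q\<in>S. 0 \<le> \<alpha> Q) \<and>
          (\<forall>Q\<in>S. G Q \<in> sets lebesgue \<and> G Q \<subseteq> Q) \<and> disjoint_family_on G S \<longrightarrow>
          bfs_norm \<rho> (\<lambda>x. \<Sum>Q\<in>S. \<alpha> Q * indicator (G Q) x)
            \<le> ennreal (c * (MAX Q\<in>S. measure lebesgue (G Q) / measure lebesgue Q) powr \<delta>)
              * bfs_norm \<rho> (\<lambda>x. \<Sum>Q\<in>S. \<alpha> Q * indicator Q x))))"
  (is "?M \<longleftrightarrow> (\<exists>c \<delta>. 0 < c \<and> 0 < \<delta> \<and> ?P c \<delta>)")
proof
  assume M: ?M
  show "\<exists>c \<delta>. 0 < c \<and> 0 < \<delta> \<and> ?P c \<delta>"
  proof (rule associate_maximal_bound_imp_decay[OF assms(1) M])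
    fix c \<delta> :: real
    assume c: "0 < c" "0 < \<delta>" and decay:
      "\<And>D S \<alpha> G. dyadic_grid D \<Longrightarrow> S \<subseteq> D \<Longrightarrow> finite S \<Longrightarrow>
        (\<And>Q. Q \<in> S \<Longrightarrow> 0 \<le> \<alpha> Q) \<Longrightarrow> (\<And>Q. Q \<in> S \<Longrightarrow> G Q \<in> sets lebesgue \<and> G Q \<subseteq> Q) \<Longrightarrow>
        \<rho> (\<lambda>x. ennreal (\<Sum>Q\<in>S. \<alpha> Q * indicator (G Q) x)) \<le>
          ennreal (c * (MAX Q\<in>S. measure lebesgue (G Q) / measure lebesgue Q) powr \<delta>) *
          \<rho> (\<lambda>x. ennreal (\<Sum>Q\<in>S. \<alpha> Q * indicator Q x))"
    have "?P c \<delta>"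
    proof (intro allI impI, elim conjE)
      fix D S :: "(real ^ 'n) set set" and \<alpha> :: "(real ^ 'n) set \<Rightarrow> real"
        and G :: "(real ^ 'n) set \<Rightarrow> (real ^ 'n) set"
      assume DS: "dyadic_grid D" "S \<subseteq> D" "finite S"
        and "\<forall>Q\<in>S. 0 \<le> \<alpha> Q" and G: "\<forall>Q\<in>S. G Q \<in> sets lebesgue \<and> G Q \<subseteq> Q"
      then have \<alpha>: "0 \<le> \<alpha> Q" if "Q \<in> S" for Q using that by blast
      have norm_eq: "bfs_norm \<rho> (\<lambda>x. \<Sum>Q\<in>S. \<alpha> Q * indicator (A Q) x) =
        \<rho> (\<lambda>x. ennreal (\<Sum>Q\<in>S. \<alpha> Q * indicator (A Q) x))" for A
        by (rule bfs_norm_sum_indicator) (rule \<alpha>)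
      show "bfs_norm \<rho> (\<lambda>x. \<Sum>Q\<in>S. \<alpha> Q * indicator (G Q) x)
        \<le> ennreal (c * (MAX Q\<in>S. measure lebesgue (G Q) / measure lebesgue Q) powr \<delta>)
          * bfs_norm \<rho> (\<lambda>x. \<Sum>Q\<in>S. \<alpha> Q * indicator Q x)"
        unfolding norm_eq
        using G by (intro decay[OF DS \<alpha>]) blast+
    qed
    with c show ?thesis by blast
  qed
next
  assume "\<exists>c \<delta>. 0 < c \<and> 0 < \<delta> \<and> ?P c \<delta>"
  then show ?M
  proof (elim exE conjE)
    fix c \<delta> :: real
    assume c: "0 < c" "0 < \<delta>" and P: "?P c \<delta>"
    show ?M
    proof (rule decay_imp_associate_maximal_bound[OF assms c])
      fix D S :: "(real ^ 'n) set set" and \<alpha> :: "(real ^ 'n) set \<Rightarrow> real"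
        and G :: "(real ^ 'n) set \<Rightarrow> (real ^ 'n) set"
      assume DS: "dyadic_grid D" "S \<subseteq> D" "finite S" "sparse_family \<eta> S"
        and \<alpha>: "\<And>Q. Q \<in> S \<Longrightarrow> 0 \<le> \<alpha> Q"
        and G: "\<And>Q. Q \<in> S \<Longrightarrow> G Q \<in> sets lebesgue \<and> G Q \<subseteq> Q" "disjoint_family_on G S"
      have norm_eq: "bfs_norm \<rho> (\<lambda>x. \<Sum>Q\<in>S. \<alpha> Q * indicator (A Q) x) =
        \<rho> (\<lambda>x. ennreal (\<Sum>Q\<in>S. \<alpha> Q * indicator (A Q) x))" for A
        by (rule bfs_norm_sum_indicator) (rule \<alpha>)
      have "bfs_norm \<rho> (\<lambda>x. \<Sum>Q\<in>S. \<alpha> Q * indicator (G Q) x)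
        \<le> ennreal (c * (MAX Q\<in>S. measure lebesgue (G Q) / measure lebesgue Q) powr \<delta>)
          * bfs_norm \<rho> (\<lambda>x. \<Sum>Q\<in>S. \<alpha> Q * indicator Q x)"
      proof (rule P[THEN spec, THEN spec, THEN mp, THEN spec, THEN spec, THEN mp])
        show "dyadic_grid D \<and> S \<subseteq> D \<and> finite S \<and> sparse_family \<eta> S"
          using DS by (intro conjI)
        show "(\<forall>Q\<in>S. 0 \<le> \<alpha> Q) \<and> (\<forall>Q\<in>S. G Q \<in> sets lebesgue \<and> G Q \<subseteq> Q) \<and> disjoint_family_on G S"
          using \<alpha> G by blast
      qed
      then show "\<rho> (\<lambda>x. ennreal (\<Sum>Q\<in>S. \<alpha> Q * indicator (G Q) x)) \<le>
          ennreal (c * (MAX Q\<in>S. measure lebesgue (G Q) / measure lebesgue Q) powr \<delta>) *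
          \<rho> (\<lambda>x. ennreal (\<Sum>Q\<in>S. \<alpha> Q * indicator Q x))"
        unfolding norm_eq .
    qed
  qed
qed

end
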